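(* Let $T$ be a strong monad on $\mathbb{C}$, $Y$ an object, $S:=T(-\times Y)^Y$, $\mathcal{A}_S=(\mathbb{C},S,A,a)$ a $\lambda_c(\Sigma)$-structure and $\mathcal{A}_T=(\mathbb{C},T,A,\mathrm{SPS}(a))$ the associated $\lambda_c(\mathrm{SPS}(\Sigma))$-structure. Let $\tau^T\colon T(\Omega)\to\Omega$ be an Eilenberg–Moore algebra and define $\tau^{S}:=(\tau^T)^Y\circ T(\mathrm{ev}_{\Omega,Y})^Y\colon T(\Omega^Y\times Y)^Y\to\Omega^Y$. For every well-typed term $\Gamma\vdash M\colon\mathbf{t}$ over $\Sigma$ and every post-condition $Q\colon[\![\mathbf{t}]\!]_S\to\Omega^Y$, $$\big(\mathrm{wp}^{\mathcal{A}_S}_{\tau^S}[M](Q)\circ\rho_\Gamma^{-1}\big)^\dagger=\mathrm{wp}^{\mathcal{A}_T}_{\tau^T}[\mathrm{SPS}(M)]\big((Q\circ\rho_{\mathbf{t}}^{-1})^\dagger\big).$$ In particular, if all types in $\Gamma$ and $\mathbf{t}$ are ground types, then $\big(\mathrm{wp}^{\mathcal{A}_S}_{\tau^S}[M](Q)\big)^\dagger=\mathrm{wp}^{\mathcal{A}_T}_{\tau^T}[\mathrm{SPS}(M)](Q^\dagger)$.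
   Context: Standing conventions: $\mathbb{C}$ is a stable bicartesian closed category; $\mathrm{ev}_{X,Y}\colon X^Y\times Y\to X$ is evaluation, $(\cdot)^\dagger$ is transposition along $(-\times Y)\dashv(-)^Y$ (here turning $X\to W^Y$ into $X\times Y\to W$). Strong monads have left strength $\mathrm{st}$ and right strength $\mathrm{st}'$. $S=T(-\times Y)^Y$ is the strong monad with unit $(\eta^T_{X\times Y})^\dagger$, multiplication $(\mu^T_{X\times Y}\circ T(\mathrm{ev}))^Y$, strength $(\mathrm{st}^T\circ(X\times\mathrm{ev}))^\dagger$. Syntax: base types $B$; types $\mathbf{t}::=b\mid\mathbf{1}\mid\mathbf{t}_1\times\mathbf{t}_2\mid\mathbf{0}\mid\mathbf{t}_1+\mathbf{t}_2\mid\mathbf{t}_1\to\mathbf{t}_2$; ground types have no $\to$. Signature $\Sigma=(B,K,E,\mathrm{ar},\mathrm{car})$ with constants $K$, generic effects $E$, $\mathrm{ar},\mathrm{car}\colon K+E\to$ ground types. Terms $x\mid c\,M\mid e\,M\mid()\mid(M,N)\mid\pi_iM\mid\delta(M)\mid\iota_iM\mid\delta(M,x_1\colon\mathbf{t}_1.N_1,x_2\colon\mathbf{t}_2.N_2)\mid\lambda x\colon\mathbf{t}.M\mid M\,N$ with standard typing. A $\lambda_c(\Sigma)$-structure $(\mathbb{C},T,A,a)$: $T$ strong monad, $A(b)$ object for $b\in B$, $a(c)\colon[\![\mathrm{ar}(c)]\!]\to[\![\mathrm{car}(c)]\!]$, $a(e)\colon[\![\mathrm{ar}(e)]\!]\to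 T[\![\mathrm{car}(e)]\!]$; types via the bi-CCC structure with $[\![\mathbf{t}_1\to\mathbf{t}_2]\!]=T[\![\mathbf{t}_2]\!]^{[\![\mathbf{t}_1]\!]}$, contexts as products; terms interpreted as $[\![M]\!]\colon[\![\Gamma]\!]\to T[\![\mathbf{t}]\!]$ by Moggi's call-by-value semantics: $[\![x_i]\!]=\eta\circ\pi_i$, $[\![()]\!]=\eta\circ!$, $[\![c\,M]\!]=T(a(c))\circ[\![M]\!]$, $[\![e\,M]\!]=\mu\circ T(a(e))\circ[\![M]\!]$, $[\![(M,N)]\!]=\mu\circ T(\mathrm{st})\circ\mathrm{st}'\circ\langle[\![M]\!],[\![N]\!]\rangle$, $[\![\pi_iM]\!]=T\pi_i\circ[\![M]\!]$, $[\![\iota_iM]\!]=T\iota_i\circ[\![M]\!]$, $[\![\delta(M)]\!]=T!\circ[\![M]\!]$, $[\![\delta(M,x_1.N_1,x_2.N_2)]\!]=\mu\circ T([[\![N_1]\!],[\![N_2]\!]]\circ\mathrm{dist})\circ\mathrm{st}\circ\langle\mathrm{id},[\![M]\!]\rangle$, $[\![\lambda x.M]\!]=\eta\circ[\![M]\!]^\dagger$, $[\![M\,N]\!]=\mu\circ T\mu\circ T^2(\mathrm{ev})\circ T(\mathrm{st})\circ\mathrm{st}'\circ\langle[\![M]\!],[\![N]\!]\rangle$. $[\![\cdot]\!]_S$, $[\![\cdot]\!]_T$ denote type interpretations under $\mathcal{A}_S,\mathcal{A}_T$. Weakest pre-condition: for an Eilenberg–Moore algebra $\tau\colon T\Omega\to\Omega$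 of the structure's monad and $Q\colon[\![\mathbf{t}]\!]\to\Omega$, $\mathrm{wp}^{\mathcal{A}}_\tau[M](Q):=\tau\circ T(Q)\circ[\![M]\!]^{\mathcal{A}}$. SPS transformation: add base type $b^Y$ with $A(b^Y)=Y$. Types: $\mathbf{t}^\circ=\mathbf{t}$ for $b,\mathbf{1},\mathbf{0}$; $(\cdot)^\circ$ commutes with $\times,+$; $(\mathbf{t}_1\to\mathbf{t}_2)^\circ=(\mathbf{t}_1^\circ\times b^Y)\to(\mathbf{t}_2^\circ\times b^Y)$; $\mathrm{SPS}(\mathbf{t})=\mathbf{t}^\circ\times b^Y$; $\mathrm{SPS}(x_1\colon\mathbf{t}_1,\dots,x_m\colon\mathbf{t}_m)=x_1\colon\mathbf{t}_1^\circ,\dots,x_m\colon\mathbf{t}_m^\circ,y\colon b^Y$. Terms ($z$ fresh): $\mathrm{SPS}(x)=(x,y)$; $\mathrm{SPS}(c\,M)=c\,\mathrm{SPS}(M)$; $\mathrm{SPS}(e\,M)=e\,\mathrm{SPS}(M)$; $\mathrm{SPS}(())=((),y)$; $\mathrm{SPS}((M,N))=(\lambda z.((\pi_1z,\pi_1\pi_2z),\pi_2\pi_2z))((\lambda z.(\pi_1z,(\lambda y.\mathrm{SPS}(N))(\pi_2z)))\mathrm{SPS}(M))$; $\mathrm{SPS}(\pi_iM)=(\lambda z.(\pi_i\pi_1z,\pi_2z))\mathrm{SPS}(M)$; $\mathrm{SPS}(\delta(M))=(\lambda z.(\delta(\pi_1z),\pi_2z))\mathrm{SPS}(M)$; $\mathrm{SPS}(\iota_iM)=(\lambda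 z.(\iota_i\pi_1z,\pi_2z))\mathrm{SPS}(M)$; $\mathrm{SPS}(\delta(M,x_1\colon\mathbf{t}_1.M_1,x_2\colon\mathbf{t}_2.M_2))=\delta(N,z\colon\mathrm{SPS}(\mathbf{t}_1).\mathrm{SPS}(M_1)[\pi_1z/x_1,\pi_2z/y],z\colon\mathrm{SPS}(\mathbf{t}_2).\mathrm{SPS}(M_2)[\pi_1z/x_2,\pi_2z/y])$ with $N=(\lambda z.\delta(\pi_1z,x_1\colon\mathbf{t}_1^\circ.\iota_1(x_1,\pi_2z),x_2\colon\mathbf{t}_2^\circ.\iota_2(x_2,\pi_2z)))\mathrm{SPS}(M)$; $\mathrm{SPS}(\lambda x\colon\mathbf{t}_1.M)=(\lambda z\colon\mathrm{SPS}(\mathbf{t}_1).\mathrm{SPS}(M)[\pi_1z/x,\pi_2z/y],y)$; $\mathrm{SPS}(M\,N)=(\lambda z.(\pi_1z)((\lambda y.\mathrm{SPS}(N))(\pi_2z)))\mathrm{SPS}(M)$. Signature $\mathrm{SPS}(\Sigma)=(B+\{b^Y\},K,E,\mathrm{ar}',\mathrm{car}')$ with $\mathrm{ar}'(k)=\mathrm{ar}(k)\times b^Y$, $\mathrm{car}'(k)=\mathrm{car}(k)\times b^Y$. Structure $\mathcal{A}_T=(\mathbb{C},T,A,\mathrm{SPS}(a))$ with $\mathrm{SPS}(a)(c)=a(c)\times\mathrm{id}_Y$ and $\mathrm{SPS}(a)(e)=a(e)^\dagger\colon[\![\mathrm{ar}(e)]\!]\times Y\to T([\![\mathrm{car}(e)]\!]\times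 Y)$. Isomorphisms $\rho_{\mathbf{t}}\colon[\![\mathbf{t}]\!]_S\to[\![\mathbf{t}^\circ]\!]_T$: identity for $\mathbf{0},\mathbf{1},b$; $\rho_{\mathbf{t}_1\times\mathbf{t}_2}=\rho_{\mathbf{t}_1}\times\rho_{\mathbf{t}_2}$; $\rho_{\mathbf{t}_1+\mathbf{t}_2}=\rho_{\mathbf{t}_1}+\rho_{\mathbf{t}_2}$; $\rho_{\mathbf{t}_1\to\mathbf{t}_2}=\cong\circ\,S(\rho_{\mathbf{t}_2})^{\rho_{\mathbf{t}_1}^{-1}}$ (post-compose with $S(\rho_{\mathbf{t}_2})$, pre-compose with $\rho_{\mathbf{t}_1}^{-1}$, then the currying isomorphism $(T(W\times Y)^Y)^V\cong T(W\times Y)^{V\times Y}$). For $\Gamma=x_1\colon\mathbf{t}_1,\dots,x_m\colon\mathbf{t}_m$, $\rho_\Gamma=\rho_{\mathbf{t}_1\times\cdots\times\mathbf{t}_m}$. *)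

theory Defs
  imports Main
begin

section \<open>Categories and bicartesian closed categories\<close>

record ('o, 'm) category =
  obj :: "'o set"
  arr :: "'m set"
  src :: "'m \<Rightarrow> 'o"
  tgt :: "'m \<Rightarrow> 'o"
  idn :: "'o \<Rightarrow> 'm"
  cmp :: "'m \<Rightarrow> 'm \<Rightarrow> 'm"  (infixr "\<cdot>\<index>" 55)

definition hom :: "('o, 'm, 'x) category_scheme \<Rightarrow> 'o \<Rightarrow> 'o \<Rightarrow> 'm set" where
  "hom C A B = {f \<in> arr C. src C f = A \<and> tgt C f = B}"

locale category =
  fixes C :: "('o, 'm, 'x) category_scheme" (structure)
  assumes src_obj: "f \<in> arr C \<Longrightarrow> src C f \<in> obj C"
    and tgt_obj: "f \<in> arr C \<Longrightarrow> tgt C f \<in> obj C"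
    and idn_hom: "A \<in> obj C \<Longrightarrow> idn C A \<in> hom C A A"
    and cmp_hom: "f \<in> hom C A B \<Longrightarrow> g \<in> hom C B D \<Longrightarrow> g \<cdot> f \<in> hom C A D"
    and cmp_idn: "f \<in> hom C A B \<Longrightarrow> f \<cdot> idn C A = f"
    and idn_cmp: "f \<in> hom C A B \<Longrightarrow> idn C B \<cdot> f = f"
    and cmp_assoc: "f \<in> hom C A B \<Longrightarrow> g \<in> hom C B D \<Longrightarrow> h \<in> hom C D E
      \<Longrightarrow> (h \<cdot> g) \<cdot> f = h \<cdot> (g \<cdot> f)"

text \<open>Chosen structure. Projections, injections, evaluation and transposition carry their objects
  explicitly because the object operations need not be injective. The object \<open>expo C X Y\<close> is
  $X^Y$, \<open>ev C X Y\<close> is $\mathrm{ev}_{X,Y}$, and \<open>curr C Z Y f\<close> transposes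
  $f : Z \times Y \to X$ to $Z \to X^Y$.\<close>

record ('o, 'm) bicc = "('o, 'm) category" +
  terminal :: "'o"
  bang :: "'o \<Rightarrow> 'm"
  product :: "'o \<Rightarrow> 'o \<Rightarrow> 'o"  (infixl "\<otimes>\<index>" 70)
  pr1 :: "'o \<Rightarrow> 'o \<Rightarrow> 'm"
  pr2 :: "'o \<Rightarrow> 'o \<Rightarrow> 'm"
  tuple :: "'m \<Rightarrow> 'm \<Rightarrow> 'm"  ("\<langle>_,/ _\<rangle>\<index>")
  initial :: "'o"
  cobang :: "'o \<Rightarrow> 'm"
  coproduct :: "'o \<Rightarrow> 'o \<Rightarrow> 'o"  (infixl "\<oplus>\<index>" 65)
  in1 :: "'o \<Rightarrow> 'o \<Rightarrow> 'm"
  in2 :: "'o \<Rightarrow> 'o \<Rightarrow> 'm"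
  cotuple :: "'m \<Rightarrow> 'm \<Rightarrow> 'm"
  expo :: "'o \<Rightarrow> 'o \<Rightarrow> 'o"
  ev :: "'o \<Rightarrow> 'o \<Rightarrow> 'm"
  curr :: "'o \<Rightarrow> 'o \<Rightarrow> 'm \<Rightarrow> 'm"

context
  fixes C :: "('o, 'm, 'x) bicc_scheme" (structure)
begin

definition prod_map :: "'m \<Rightarrow> 'm \<Rightarrow> 'm" where
  "prod_map f g = \<langle>f \<cdot> pr1 C (src C f) (src C g), g \<cdot> pr2 C (src C f) (src C g)\<rangle>"

definition sum_map :: "'m \<Rightarrow> 'm \<Rightarrow> 'm" where
  "sum_map f g = cotuple C (in1 C (tgt C f) (tgt C g) \<cdot> f) (in2 C (tgt C f) (tgt C g) \<cdot> g)"

definition uncurr :: "'o \<Rightarrow> 'o \<Rightarrow> 'm \<Rightarrow> 'm" where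
  "uncurr X Y g = ev C X Y \<cdot> prod_map g (idn C Y)"

end

locale bicartesian_closed = category C for C :: "('o, 'm, 'x) bicc_scheme" (structure) +
  assumes terminal_obj: "terminal C \<in> obj C"
    and bang_hom: "A \<in> obj C \<Longrightarrow> bang C A \<in> hom C A (terminal C)"
    and bang_unique: "f \<in> hom C A (terminal C) \<Longrightarrow> f = bang C A"
    and product_obj: "A \<in> obj C \<Longrightarrow> B \<in> obj C \<Longrightarrow> A \<otimes> B \<in> obj C"
    and pr1_hom: "A \<in> obj C \<Longrightarrow> B \<in> obj C \<Longrightarrow> pr1 C A B \<in> hom C (A \<otimes> B) A"
    and pr2_hom: "A \<in> obj C \<Longrightarrow> B \<in> obj C \<Longrightarrow> pr2 C A B \<in> hom C (A \<otimes> B) B"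
    and tuple_hom: "f \<in> hom C Z A \<Longrightarrow> g \<in> hom C Z B \<Longrightarrow> \<langle>f, g\<rangle> \<in> hom C Z (A \<otimes> B)"
    and pr1_tuple: "f \<in> hom C Z A \<Longrightarrow> g \<in> hom C Z B \<Longrightarrow> pr1 C A B \<cdot> \<langle>f, g\<rangle> = f"
    and pr2_tuple: "f \<in> hom C Z A \<Longrightarrow> g \<in> hom C Z B \<Longrightarrow> pr2 C A B \<cdot> \<langle>f, g\<rangle> = g"
    and tuple_unique: "A \<in> obj C \<Longrightarrow> B \<in> obj C \<Longrightarrow> h \<in> hom C Z (A \<otimes> B)
      \<Longrightarrow> \<langle>pr1 C A B \<cdot> h, pr2 C A B \<cdot> h\<rangle> = h"
    and initial_obj: "initial C \<in> obj C"
    and cobang_hom: "A \<in> obj C \<Longrightarrow> cobang C A \<in> hom C (initial C) A"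
    and cobang_unique: "f \<in> hom C (initial C) A \<Longrightarrow> f = cobang C A"
    and coproduct_obj: "A \<in> obj C \<Longrightarrow> B \<in> obj C \<Longrightarrow> A \<oplus> B \<in> obj C"
    and in1_hom: "A \<in> obj C \<Longrightarrow> B \<in> obj C \<Longrightarrow> in1 C A B \<in> hom C A (A \<oplus> B)"
    and in2_hom: "A \<in> obj C \<Longrightarrow> B \<in> obj C \<Longrightarrow> in2 C A B \<in> hom C B (A \<oplus> B)"
    and cotuple_hom: "f \<in> hom C A Z \<Longrightarrow> g \<in> hom C B Z \<Longrightarrow> cotuple C f g \<in> hom C (A \<oplus> B) Z"
    and cotuple_in1: "f \<in> hom C A Z \<Longrightarrow> g \<in> hom C B Z \<Longrightarrow> cotuple C f g \<cdot> in1 C A B = f"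
    and cotuple_in2: "f \<in> hom C A Z \<Longrightarrow> g \<in> hom C B Z \<Longrightarrow> cotuple C f g \<cdot> in2 C A B = g"
    and cotuple_unique: "A \<in> obj C \<Longrightarrow> B \<in> obj C \<Longrightarrow> h \<in> hom C (A \<oplus> B) Z
      \<Longrightarrow> cotuple C (h \<cdot> in1 C A B) (h \<cdot> in2 C A B) = h"
    and expo_obj: "X \<in> obj C \<Longrightarrow> Y \<in> obj C \<Longrightarrow> expo C X Y \<in> obj C"
    and ev_hom: "X \<in> obj C \<Longrightarrow> Y \<in> obj C \<Longrightarrow> ev C X Y \<in> hom C (expo C X Y \<otimes> Y) X"
    and curr_hom: "Z \<in> obj C \<Longrightarrow> Y \<in> obj C \<Longrightarrow> f \<in> hom C (Z \<otimes> Y) X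
      \<Longrightarrow> curr C Z Y f \<in> hom C Z (expo C X Y)"
    and uncurr_curr: "Z \<in> obj C \<Longrightarrow> Y \<in> obj C \<Longrightarrow> f \<in> hom C (Z \<otimes> Y) X
      \<Longrightarrow> uncurr C X Y (curr C Z Y f) = f"
    and curr_uncurr: "X \<in> obj C \<Longrightarrow> Y \<in> obj C \<Longrightarrow> g \<in> hom C Z (expo C X Y)
      \<Longrightarrow> curr C Z Y (uncurr C X Y g) = g"

definition is_pullback :: "('o, 'm, 'x) category_scheme \<Rightarrow> 'm \<Rightarrow> 'm \<Rightarrow> 'm \<Rightarrow> 'm \<Rightarrow> bool" where
  "is_pullback C p q f g \<longleftrightarrow>
    p \<in> arr C \<and> q \<in> arr C \<and> f \<in> arr C \<and> g \<in> arr C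
    \<and> src C p = src C q \<and> tgt C p = src C f \<and> tgt C q = src C g \<and> tgt C f = tgt C g
    \<and> f \<cdot>\<^bsub>C\<^esub> p = g \<cdot>\<^bsub>C\<^esub> q
    \<and> (\<forall>X. \<forall>u \<in> hom C X (src C f). \<forall>v \<in> hom C X (src C g). f \<cdot>\<^bsub>C\<^esub> u = g \<cdot>\<^bsub>C\<^esub> v
        \<longrightarrow> (\<exists>!h. h \<in> hom C X (src C p) \<and> p \<cdot>\<^bsub>C\<^esub> h = u \<and> q \<cdot>\<^bsub>C\<^esub> h = v))"

definition is_coproduct :: "('o, 'm, 'x) category_scheme \<Rightarrow> 'm \<Rightarrow> 'm \<Rightarrow> bool" where
  "is_coproduct C i j \<longleftrightarrow>
    i \<in> arr C \<and> j \<in> arr C \<and> tgt C i = tgt C j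
    \<and> (\<forall>X. \<forall>u \<in> hom C (src C i) X. \<forall>v \<in> hom C (src C j) X.
        \<exists>!h. h \<in> hom C (tgt C i) X \<and> h \<cdot>\<^bsub>C\<^esub> i = u \<and> h \<cdot>\<^bsub>C\<^esub> j = v)"

definition is_initial :: "('o, 'm, 'x) category_scheme \<Rightarrow> 'o \<Rightarrow> bool" where
  "is_initial C Z \<longleftrightarrow> Z \<in> obj C \<and> (\<forall>X \<in> obj C. \<exists>!h. h \<in> hom C Z X)"

text \<open>Stability of the finite coproducts under pullback. The pullbacks of the injections along
  \<open>f\<close> are not required to exist, which is the weakest form of the condition.\<close>

locale stable_bicartesian_closed = bicartesian_closed C
  for C :: "('o, 'm, 'x) bicc_scheme" (structure) +
  assumes stable_initial: "f \<in> hom C Z (initial C) \<Longrightarrow> is_initial C Z"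
    and stable_coproduct: "A \<in> obj C \<Longrightarrow> B \<in> obj C \<Longrightarrow> f \<in> hom C Z (A \<oplus> B)
      \<Longrightarrow> is_pullback C p1 q1 f (in1 C A B) \<Longrightarrow> is_pullback C p2 q2 f (in2 C A B)
      \<Longrightarrow> is_coproduct C p1 p2"

definition inverse_arr :: "('o, 'm, 'x) category_scheme \<Rightarrow> 'm \<Rightarrow> 'm" where
  "inverse_arr C f = (THE g. g \<in> hom C (tgt C f) (src C f)
    \<and> g \<cdot>\<^bsub>C\<^esub> f = idn C (src C f) \<and> f \<cdot>\<^bsub>C\<^esub> g = idn C (tgt C f))"

context
  fixes C :: "('o, 'm, 'x) bicc_scheme" (structure)
begin

definition swap :: "'o \<Rightarrow> 'o \<Rightarrow> 'm" where
  "swap A B = \<langle>pr2 C A B, pr1 C A B\<rangle>"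

definition assoc_r :: "'o \<Rightarrow> 'o \<Rightarrow> 'o \<Rightarrow> 'm" where
  "assoc_r A B D =
    \<langle>pr1 C A B \<cdot> pr1 C (A \<otimes> B) D, \<langle>pr2 C A B \<cdot> pr1 C (A \<otimes> B) D, pr2 C (A \<otimes> B) D\<rangle>\<rangle>"

definition assoc_l :: "'o \<Rightarrow> 'o \<Rightarrow> 'o \<Rightarrow> 'm" where
  "assoc_l A B D =
    \<langle>\<langle>pr1 C A (B \<otimes> D), pr1 C B D \<cdot> pr2 C A (B \<otimes> D)\<rangle>, pr2 C B D \<cdot> pr2 C A (B \<otimes> D)\<rangle>"

definition dist :: "'o \<Rightarrow> 'o \<Rightarrow> 'o \<Rightarrow> 'm" where
  "dist X A B = inverse_arr C
    (cotuple C (prod_map C (idn C X) (in1 C A B)) (prod_map C (idn C X) (in2 C A B)))"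

text \<open>For $f : X \to X'$ and $g : V' \to V$ this is $f^g : X^V \to X'^{V'}$.\<close>

definition expo_map :: "'m \<Rightarrow> 'm \<Rightarrow> 'm" where
  "expo_map f g = curr C (expo C (src C f) (tgt C g)) (src C g)
    (f \<cdot> ev C (src C f) (tgt C g) \<cdot> prod_map C (idn C (expo C (src C f) (tgt C g))) g)"

text \<open>The isomorphism $(X^Y)^V \cong X^{V \times Y}$.\<close>

definition curry_iso :: "'o \<Rightarrow> 'o \<Rightarrow> 'o \<Rightarrow> 'm" where
  "curry_iso X Y V = curr C (expo C (expo C X Y) V) (V \<otimes> Y)
    (ev C X Y \<cdot> prod_map C (ev C (expo C X Y) V) (idn C Y)
      \<cdot> assoc_l (expo C (expo C X Y) V) V Y)"

end


section \<open>Strong monads\<close>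

record ('o, 'm) monad =
  tob :: "'o \<Rightarrow> 'o"
  tmap :: "'m \<Rightarrow> 'm"
  unit :: "'o \<Rightarrow> 'm"
  mult :: "'o \<Rightarrow> 'm"
  str :: "'o \<Rightarrow> 'o \<Rightarrow> 'm"

locale strong_monad = bicartesian_closed C
  for C :: "('o, 'm, 'x) bicc_scheme" (structure)
    and T :: "('o, 'm, 'y) monad_scheme" +
  assumes tob_obj: "A \<in> obj C \<Longrightarrow> tob T A \<in> obj C"
    and tmap_hom: "f \<in> hom C A B \<Longrightarrow> tmap T f \<in> hom C (tob T A) (tob T B)"
    and tmap_idn: "A \<in> obj C \<Longrightarrow> tmap T (idn C A) = idn C (tob T A)"
    and tmap_cmp: "f \<in> hom C A B \<Longrightarrow> g \<in> hom C B D \<Longrightarrow> tmap T (g \<cdot> f) = tmap T g \<cdot> tmap T f"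
    and unit_hom: "A \<in> obj C \<Longrightarrow> unit T A \<in> hom C A (tob T A)"
    and unit_natural: "f \<in> hom C A B \<Longrightarrow> unit T B \<cdot> f = tmap T f \<cdot> unit T A"
    and mult_hom: "A \<in> obj C \<Longrightarrow> mult T A \<in> hom C (tob T (tob T A)) (tob T A)"
    and mult_natural: "f \<in> hom C A B \<Longrightarrow> mult T B \<cdot> tmap T (tmap T f) = tmap T f \<cdot> mult T A"
    and mult_unit: "A \<in> obj C \<Longrightarrow> mult T A \<cdot> unit T (tob T A) = idn C (tob T A)"
    and mult_tmap_unit: "A \<in> obj C \<Longrightarrow> mult T A \<cdot> tmap T (unit T A) = idn C (tob T A)"
    and mult_mult: "A \<in> obj C \<Longrightarrow> mult T A \<cdot> tmap T (mult T A) = mult T A \<cdot> mult T (tob T A)"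
    and str_hom: "A \<in> obj C \<Longrightarrow> B \<in> obj C \<Longrightarrow> str T A B \<in> hom C (A \<otimes> tob T B) (tob T (A \<otimes> B))"
    and str_natural: "f \<in> hom C A A' \<Longrightarrow> g \<in> hom C B B'
      \<Longrightarrow> str T A' B' \<cdot> prod_map C f (tmap T g) = tmap T (prod_map C f g) \<cdot> str T A B"
    and str_terminal: "A \<in> obj C
      \<Longrightarrow> tmap T (pr2 C (terminal C) A) \<cdot> str T (terminal C) A = pr2 C (terminal C) (tob T A)"
    and str_assoc: "A \<in> obj C \<Longrightarrow> B \<in> obj C \<Longrightarrow> D \<in> obj C
      \<Longrightarrow> tmap T (assoc_r C A B D) \<cdot> str T (A \<otimes> B) D
        = str T A (B \<otimes> D) \<cdot> prod_map C (idn C A) (str T B D) \<cdot> assoc_r C A B (tob T D)"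
    and str_unit: "A \<in> obj C \<Longrightarrow> B \<in> obj C
      \<Longrightarrow> str T A B \<cdot> prod_map C (idn C A) (unit T B) = unit T (A \<otimes> B)"
    and str_mult: "A \<in> obj C \<Longrightarrow> B \<in> obj C
      \<Longrightarrow> str T A B \<cdot> prod_map C (idn C A) (mult T B)
        = mult T (A \<otimes> B) \<cdot> tmap T (str T A B) \<cdot> str T A (tob T B)"

text \<open>The right strength $TA \times B \to T(A \times B)$.\<close>

definition rstr :: "('o, 'm, 'x) bicc_scheme \<Rightarrow> ('o, 'm, 'y) monad_scheme \<Rightarrow> 'o \<Rightarrow> 'o \<Rightarrow> 'm" where
  "rstr C T A B = tmap T (swap C B A) \<cdot>\<^bsub>C\<^esub> str T B A \<cdot>\<^bsub>C\<^esub> swap C (tob T A) B"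

definition em_algebra :: "('o, 'm, 'x) bicc_scheme \<Rightarrow> ('o, 'm, 'y) monad_scheme \<Rightarrow> 'o \<Rightarrow> 'm \<Rightarrow> bool"
  where
  "em_algebra C T \<Omega> \<tau> \<longleftrightarrow> \<Omega> \<in> obj C \<and> \<tau> \<in> hom C (tob T \<Omega>) \<Omega>
    \<and> \<tau> \<cdot>\<^bsub>C\<^esub> unit T \<Omega> = idn C \<Omega> \<and> \<tau> \<cdot>\<^bsub>C\<^esub> tmap T \<tau> = \<tau> \<cdot>\<^bsub>C\<^esub> mult T \<Omega>"

text \<open>The monad $S = T(- \times Y)^Y$, whose strength is the transpose of
  $(X \times SZ) \times Y \cong X \times (SZ \times Y) \to X \times T(Z \times Y)
    \to T(X \times (Z \times Y)) \cong T((X \times Z) \times Y)$.\<close>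

definition state_monad ::
  "('o, 'm, 'x) bicc_scheme \<Rightarrow> ('o, 'm, 'y) monad_scheme \<Rightarrow> 'o \<Rightarrow> ('o, 'm) monad" where
  "state_monad C T Y = (let S = \<lambda>X. expo C (tob T (X \<otimes>\<^bsub>C\<^esub> Y)) Y in
    \<lparr> tob = S,
      tmap = (\<lambda>f. expo_map C (tmap T (prod_map C f (idn C Y))) (idn C Y)),
      unit = (\<lambda>X. curr C X Y (unit T (X \<otimes>\<^bsub>C\<^esub> Y))),
      mult = (\<lambda>X. expo_map C
        (mult T (X \<otimes>\<^bsub>C\<^esub> Y) \<cdot>\<^bsub>C\<^esub> tmap T (ev C (tob T (X \<otimes>\<^bsub>C\<^esub> Y)) Y)) (idn C Y)),
      str = (\<lambda>X Z. curr C (X \<otimes>\<^bsub>C\<^esub> S Z) Y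
        (tmap T (assoc_l C X Z Y) \<cdot>\<^bsub>C\<^esub> str T X (Z \<otimes>\<^bsub>C\<^esub> Y)
          \<cdot>\<^bsub>C\<^esub> prod_map C (idn C X) (ev C (tob T (Z \<otimes>\<^bsub>C\<^esub> Y)) Y) \<cdot>\<^bsub>C\<^esub> assoc_r C X (S Z) Y)) \<rparr>)"

definition state_algebra ::
  "('o, 'm, 'x) bicc_scheme \<Rightarrow> ('o, 'm, 'y) monad_scheme \<Rightarrow> 'o \<Rightarrow> 'o \<Rightarrow> 'm \<Rightarrow> 'm" where
  "state_algebra C T Y \<Omega> \<tau> =
    expo_map C \<tau> (idn C Y) \<cdot>\<^bsub>C\<^esub> expo_map C (tmap T (ev C \<Omega> Y)) (idn C Y)"


section \<open>Types, signatures and terms\<close>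

datatype (set_ty: 'b) ty =
    TBase 'b
  | TUnit
  | TProd "'b ty" "'b ty"
  | TZero
  | TSum "'b ty" "'b ty"
  | TFun "'b ty" "'b ty"
  for map: map_ty

primrec ground :: "'b ty \<Rightarrow> bool" where
  "ground (TBase b) = True"
| "ground TUnit = True"
| "ground (TProd t1 t2) = (ground t1 \<and> ground t2)"
| "ground TZero = True"
| "ground (TSum t1 t2) = (ground t1 \<and> ground t2)"
| "ground (TFun t1 t2) = False"

record ('b, 'k, 'e) signature =
  bases :: "'b set"
  constants :: "'k set"
  effects :: "'e set"
  ar :: "'k + 'e \<Rightarrow> 'b ty"
  car :: "'k + 'e \<Rightarrow> 'b ty"

definition wf_ty :: "('b, 'k, 'e) signature \<Rightarrow> 'b ty \<Rightarrow> bool" where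
  "wf_ty \<Sigma> t \<longleftrightarrow> set_ty t \<subseteq> bases \<Sigma>"

definition wf_signature :: "('b, 'k, 'e) signature \<Rightarrow> bool" where
  "wf_signature \<Sigma> \<longleftrightarrow> (\<forall>k \<in> constants \<Sigma> <+> effects \<Sigma>.
    ground (ar \<Sigma> k) \<and> wf_ty \<Sigma> (ar \<Sigma> k) \<and> ground (car \<Sigma> k) \<and> wf_ty \<Sigma> (car \<Sigma> k))"

text \<open>Terms are in de Bruijn form. \<open>Abort\<close>, \<open>Inj1\<close> and \<open>Inj2\<close> carry the type that their argument
  does not determine, so that a term has at most one type and its interpretation does not depend
  on a choice of typing derivation.\<close>

datatype ('b, 'k, 'e) tm =
    Var nat
  | Const 'k "('b, 'k, 'e) tm"
  | Effect 'e "('b, 'k, 'e) tm"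
  | Unit
  | Pair "('b, 'k, 'e) tm" "('b, 'k, 'e) tm"
  | Proj1 "('b, 'k, 'e) tm"
  | Proj2 "('b, 'k, 'e) tm"
  | Abort "'b ty" "('b, 'k, 'e) tm"
  | Inj1 "'b ty" "('b, 'k, 'e) tm"
  | Inj2 "'b ty" "('b, 'k, 'e) tm"
  | Case "('b, 'k, 'e) tm" "'b ty" "('b, 'k, 'e) tm" "'b ty" "('b, 'k, 'e) tm"
  | Lam "'b ty" "('b, 'k, 'e) tm"
  | App "('b, 'k, 'e) tm" "('b, 'k, 'e) tm"

text \<open>A context $x_1 : t_1, \dots, x_m : t_m$ is the list \<open>[t\<^sub>m, \<dots>, t\<^sub>1]\<close>: the head is the
  innermost variable, with index 0.\<close>

type_synonym 'b ctx = "'b ty list"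

inductive typing :: "('b, 'k, 'e) signature \<Rightarrow> 'b ctx \<Rightarrow> ('b, 'k, 'e) tm \<Rightarrow> 'b ty \<Rightarrow> bool"
  for \<Sigma> where
  t_Var: "(\<forall>s \<in> set \<Gamma>. wf_ty \<Sigma> s) \<Longrightarrow> i < length \<Gamma> \<Longrightarrow> typing \<Sigma> \<Gamma> (Var i) (\<Gamma> ! i)"
| t_Const: "c \<in> constants \<Sigma> \<Longrightarrow> typing \<Sigma> \<Gamma> M (ar \<Sigma> (Inl c)) \<Longrightarrow> typing \<Sigma> \<Gamma> (Const c M) (car \<Sigma> (Inl c))"
| t_Effect: "e \<in> effects \<Sigma> \<Longrightarrow> typing \<Sigma> \<Gamma> M (ar \<Sigma> (Inr e)) \<Longrightarrow> typing \<Sigma> \<Gamma> (Effect e M) (car \<Sigma> (Inr e))"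
| t_Unit: "(\<forall>s \<in> set \<Gamma>. wf_ty \<Sigma> s) \<Longrightarrow> typing \<Sigma> \<Gamma> Unit TUnit"
| t_Pair: "typing \<Sigma> \<Gamma> M t1 \<Longrightarrow> typing \<Sigma> \<Gamma> N t2 \<Longrightarrow> typing \<Sigma> \<Gamma> (Pair M N) (TProd t1 t2)"
| t_Proj1: "typing \<Sigma> \<Gamma> M (TProd t1 t2) \<Longrightarrow> typing \<Sigma> \<Gamma> (Proj1 M) t1"
| t_Proj2: "typing \<Sigma> \<Gamma> M (TProd t1 t2) \<Longrightarrow> typing \<Sigma> \<Gamma> (Proj2 M) t2"
| t_Abort: "wf_ty \<Sigma> t \<Longrightarrow> typing \<Sigma> \<Gamma> M TZero \<Longrightarrow> typing \<Sigma> \<Gamma> (Abort t M) t"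
| t_Inj1: "wf_ty \<Sigma> t2 \<Longrightarrow> typing \<Sigma> \<Gamma> M t1 \<Longrightarrow> typing \<Sigma> \<Gamma> (Inj1 t2 M) (TSum t1 t2)"
| t_Inj2: "wf_ty \<Sigma> t1 \<Longrightarrow> typing \<Sigma> \<Gamma> M t2 \<Longrightarrow> typing \<Sigma> \<Gamma> (Inj2 t1 M) (TSum t1 t2)"
| t_Case: "typing \<Sigma> \<Gamma> M (TSum t1 t2) \<Longrightarrow> typing \<Sigma> (t1 # \<Gamma>) N1 t \<Longrightarrow> typing \<Sigma> (t2 # \<Gamma>) N2 t
    \<Longrightarrow> typing \<Sigma> \<Gamma> (Case M t1 N1 t2 N2) t"
| t_Lam: "typing \<Sigma> (t1 # \<Gamma>) M t2 \<Longrightarrow> typing \<Sigma> \<Gamma> (Lam t1 M) (TFun t1 t2)"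
| t_App: "typing \<Sigma> \<Gamma> M (TFun t1 t2) \<Longrightarrow> typing \<Sigma> \<Gamma> N t1 \<Longrightarrow> typing \<Sigma> \<Gamma> (App M N) t2"

primrec type_of :: "('b, 'k, 'e) signature \<Rightarrow> 'b ctx \<Rightarrow> ('b, 'k, 'e) tm \<Rightarrow> 'b ty" where
  "type_of \<Sigma> \<Gamma> (Var i) = \<Gamma> ! i"
| "type_of \<Sigma> \<Gamma> (Const c M) = car \<Sigma> (Inl c)"
| "type_of \<Sigma> \<Gamma> (Effect e M) = car \<Sigma> (Inr e)"
| "type_of \<Sigma> \<Gamma> Unit = TUnit"
| "type_of \<Sigma> \<Gamma> (Pair M N) = TProd (type_of \<Sigma> \<Gamma> M) (type_of \<Sigma> \<Gamma> N)"
| "type_of \<Sigma> \<Gamma> (Proj1 M) = (case type_of \<Sigma> \<Gamma> M of TProd t1 t2 \<Rightarrow> t1 | _ \<Rightarrow> undefined)"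
| "type_of \<Sigma> \<Gamma> (Proj2 M) = (case type_of \<Sigma> \<Gamma> M of TProd t1 t2 \<Rightarrow> t2 | _ \<Rightarrow> undefined)"
| "type_of \<Sigma> \<Gamma> (Abort t M) = t"
| "type_of \<Sigma> \<Gamma> (Inj1 t2 M) = TSum (type_of \<Sigma> \<Gamma> M) t2"
| "type_of \<Sigma> \<Gamma> (Inj2 t1 M) = TSum t1 (type_of \<Sigma> \<Gamma> M)"
| "type_of \<Sigma> \<Gamma> (Case M t1 N1 t2 N2) = type_of \<Sigma> (t1 # \<Gamma>) N1"
| "type_of \<Sigma> \<Gamma> (Lam t M) = TFun t (type_of \<Sigma> (t # \<Gamma>) M)"
| "type_of \<Sigma> \<Gamma> (App M N) = (case type_of \<Sigma> \<Gamma> M of TFun t1 t2 \<Rightarrow> t2 | _ \<Rightarrow> undefined)"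

lemma typing_type_of: "typing \<Sigma> \<Gamma> M t \<Longrightarrow> type_of \<Sigma> \<Gamma> M = t"
  by (induction rule: typing.induct) auto

corollary typing_unique: "typing \<Sigma> \<Gamma> M t \<Longrightarrow> typing \<Sigma> \<Gamma> M t' \<Longrightarrow> t = t'"
  using typing_type_of by metis


section \<open>Structures and Moggi's call-by-value semantics\<close>

record ('o, 'm, 'b, 'k, 'e) lc_struct =
  cat :: "('o, 'm) bicc"
  mon :: "('o, 'm) monad"
  base_ob :: "'b \<Rightarrow> 'o"
  op_arr :: "'k + 'e \<Rightarrow> 'm"

primrec ty_ob :: "('o, 'm, 'b, 'k, 'e) lc_struct \<Rightarrow> 'b ty \<Rightarrow> 'o" where
  "ty_ob \<A> (TBase b) = base_ob \<A> b"
| "ty_ob \<A> TUnit = terminal (cat \<A>)"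
| "ty_ob \<A> (TProd t1 t2) = ty_ob \<A> t1 \<otimes>\<^bsub>cat \<A>\<^esub> ty_ob \<A> t2"
| "ty_ob \<A> TZero = initial (cat \<A>)"
| "ty_ob \<A> (TSum t1 t2) = ty_ob \<A> t1 \<oplus>\<^bsub>cat \<A>\<^esub> ty_ob \<A> t2"
| "ty_ob \<A> (TFun t1 t2) = expo (cat \<A>) (tob (mon \<A>) (ty_ob \<A> t2)) (ty_ob \<A> t1)"

definition lc_structure ::
  "('b, 'k, 'e) signature \<Rightarrow> ('o, 'm, 'b, 'k, 'e) lc_struct \<Rightarrow> bool" where
  "lc_structure \<Sigma> \<A> \<longleftrightarrow> wf_signature \<Sigma>
    \<and> stable_bicartesian_closed (cat \<A>) \<and> strong_monad (cat \<A>) (mon \<A>)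
    \<and> (\<forall>b \<in> bases \<Sigma>. base_ob \<A> b \<in> obj (cat \<A>))
    \<and> (\<forall>c \<in> constants \<Sigma>. op_arr \<A> (Inl c)
        \<in> hom (cat \<A>) (ty_ob \<A> (ar \<Sigma> (Inl c))) (ty_ob \<A> (car \<Sigma> (Inl c))))
    \<and> (\<forall>e \<in> effects \<Sigma>. op_arr \<A> (Inr e)
        \<in> hom (cat \<A>) (ty_ob \<A> (ar \<Sigma> (Inr e))) (tob (mon \<A>) (ty_ob \<A> (car \<Sigma> (Inr e)))))"

text \<open>The type $((1 \times t_1) \times \dots) \times t_m$ of a context.\<close>

primrec ctx_ty :: "'b ctx \<Rightarrow> 'b ty" where
  "ctx_ty [] = TUnit"
| "ctx_ty (t # \<Gamma>) = TProd (ctx_ty \<Gamma>) t"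

abbreviation ctx_ob :: "('o, 'm, 'b, 'k, 'e) lc_struct \<Rightarrow> 'b ctx \<Rightarrow> 'o" where
  "ctx_ob \<A> \<Gamma> \<equiv> ty_ob \<A> (ctx_ty \<Gamma>)"

primrec var_pr :: "('o, 'm, 'b, 'k, 'e) lc_struct \<Rightarrow> 'b ctx \<Rightarrow> nat \<Rightarrow> 'm" where
  "var_pr \<A> [] i = undefined"
| "var_pr \<A> (t # \<Gamma>) i = (case i of
      0 \<Rightarrow> pr2 (cat \<A>) (ctx_ob \<A> \<Gamma>) (ty_ob \<A> t)
    | Suc j \<Rightarrow> var_pr \<A> \<Gamma> j \<cdot>\<^bsub>cat \<A>\<^esub> pr1 (cat \<A>) (ctx_ob \<A> \<Gamma>) (ty_ob \<A> t))"

primrec sem ::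
  "('b, 'k, 'e) signature \<Rightarrow> ('o, 'm, 'b, 'k, 'e) lc_struct \<Rightarrow> 'b ctx \<Rightarrow> ('b, 'k, 'e) tm \<Rightarrow> 'm" where
  "sem \<Sigma> \<A> \<Gamma> (Var i) = unit (mon \<A>) (ty_ob \<A> (\<Gamma> ! i)) \<cdot>\<^bsub>cat \<A>\<^esub> var_pr \<A> \<Gamma> i"
| "sem \<Sigma> \<A> \<Gamma> (Const c M) = tmap (mon \<A>) (op_arr \<A> (Inl c)) \<cdot>\<^bsub>cat \<A>\<^esub> sem \<Sigma> \<A> \<Gamma> M"
| "sem \<Sigma> \<A> \<Gamma> (Effect e M) = mult (mon \<A>) (ty_ob \<A> (car \<Sigma> (Inr e)))
    \<cdot>\<^bsub>cat \<A>\<^esub> tmap (mon \<A>) (op_arr \<A> (Inr e)) \<cdot>\<^bsub>cat \<A>\<^esub> sem \<Sigma> \<A> \<Gamma> M"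
| "sem \<Sigma> \<A> \<Gamma> Unit = unit (mon \<A>) (terminal (cat \<A>)) \<cdot>\<^bsub>cat \<A>\<^esub> bang (cat \<A>) (ctx_ob \<A> \<Gamma>)"
| "sem \<Sigma> \<A> \<Gamma> (Pair M N) =
    (let A = ty_ob \<A> (type_of \<Sigma> \<Gamma> M); B = ty_ob \<A> (type_of \<Sigma> \<Gamma> N) in
      mult (mon \<A>) (A \<otimes>\<^bsub>cat \<A>\<^esub> B) \<cdot>\<^bsub>cat \<A>\<^esub> tmap (mon \<A>) (str (mon \<A>) A B)
        \<cdot>\<^bsub>cat \<A>\<^esub> rstr (cat \<A>) (mon \<A>) A (tob (mon \<A>) B)
        \<cdot>\<^bsub>cat \<A>\<^esub> \<langle>sem \<Sigma> \<A> \<Gamma> M, sem \<Sigma> \<A> \<Gamma> N\<rangle>\<^bsub>cat \<A>\<^esub>)"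
| "sem \<Sigma> \<A> \<Gamma> (Proj1 M) = (case type_of \<Sigma> \<Gamma> M of
      TProd t1 t2 \<Rightarrow> tmap (mon \<A>) (pr1 (cat \<A>) (ty_ob \<A> t1) (ty_ob \<A> t2)) \<cdot>\<^bsub>cat \<A>\<^esub> sem \<Sigma> \<A> \<Gamma> M
    | _ \<Rightarrow> undefined)"
| "sem \<Sigma> \<A> \<Gamma> (Proj2 M) = (case type_of \<Sigma> \<Gamma> M of
      TProd t1 t2 \<Rightarrow> tmap (mon \<A>) (pr2 (cat \<A>) (ty_ob \<A> t1) (ty_ob \<A> t2)) \<cdot>\<^bsub>cat \<A>\<^esub> sem \<Sigma> \<A> \<Gamma> M
    | _ \<Rightarrow> undefined)"
| "sem \<Sigma> \<A> \<Gamma> (Abort t M) = tmap (mon \<A>) (cobang (cat \<A>) (ty_ob \<A> t)) \<cdot>\<^bsub>cat \<A>\<^esub> sem \<Sigma> \<A> \<Gamma> M"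
| "sem \<Sigma> \<A> \<Gamma> (Inj1 t2 M) =
    tmap (mon \<A>) (in1 (cat \<A>) (ty_ob \<A> (type_of \<Sigma> \<Gamma> M)) (ty_ob \<A> t2)) \<cdot>\<^bsub>cat \<A>\<^esub> sem \<Sigma> \<A> \<Gamma> M"
| "sem \<Sigma> \<A> \<Gamma> (Inj2 t1 M) =
    tmap (mon \<A>) (in2 (cat \<A>) (ty_ob \<A> t1) (ty_ob \<A> (type_of \<Sigma> \<Gamma> M))) \<cdot>\<^bsub>cat \<A>\<^esub> sem \<Sigma> \<A> \<Gamma> M"
| "sem \<Sigma> \<A> \<Gamma> (Case M t1 N1 t2 N2) =
    (let X = ctx_ob \<A> \<Gamma>; A = ty_ob \<A> t1; B = ty_ob \<A> t2 in
      mult (mon \<A>) (ty_ob \<A> (type_of \<Sigma> (t1 # \<Gamma>) N1))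
        \<cdot>\<^bsub>cat \<A>\<^esub> tmap (mon \<A>) (cotuple (cat \<A>) (sem \<Sigma> \<A> (t1 # \<Gamma>) N1) (sem \<Sigma> \<A> (t2 # \<Gamma>) N2)
              \<cdot>\<^bsub>cat \<A>\<^esub> dist (cat \<A>) X A B)
        \<cdot>\<^bsub>cat \<A>\<^esub> str (mon \<A>) X (A \<oplus>\<^bsub>cat \<A>\<^esub> B)
        \<cdot>\<^bsub>cat \<A>\<^esub> \<langle>idn (cat \<A>) X, sem \<Sigma> \<A> \<Gamma> M\<rangle>\<^bsub>cat \<A>\<^esub>)"
| "sem \<Sigma> \<A> \<Gamma> (Lam t M) =
    unit (mon \<A>) (ty_ob \<A> (TFun t (type_of \<Sigma> (t # \<Gamma>) M)))
      \<cdot>\<^bsub>cat \<A>\<^esub> curr (cat \<A>) (ctx_ob \<A> \<Gamma>) (ty_ob \<A> t) (sem \<Sigma> \<A> (t # \<Gamma>) M)"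
| "sem \<Sigma> \<A> \<Gamma> (App M N) = (case type_of \<Sigma> \<Gamma> M of
      TFun t1 t2 \<Rightarrow>
        (let A = ty_ob \<A> t1; B = ty_ob \<A> t2; F = ty_ob \<A> (TFun t1 t2) in
          mult (mon \<A>) B \<cdot>\<^bsub>cat \<A>\<^esub> tmap (mon \<A>) (mult (mon \<A>) B)
            \<cdot>\<^bsub>cat \<A>\<^esub> tmap (mon \<A>) (tmap (mon \<A>) (ev (cat \<A>) (tob (mon \<A>) B) A))
            \<cdot>\<^bsub>cat \<A>\<^esub> tmap (mon \<A>) (str (mon \<A>) F A)
            \<cdot>\<^bsub>cat \<A>\<^esub> rstr (cat \<A>) (mon \<A>) F (tob (mon \<A>) A)
            \<cdot>\<^bsub>cat \<A>\<^esub> \<langle>sem \<Sigma> \<A> \<Gamma> M, sem \<Sigma> \<A> \<Gamma> N\<rangle>\<^bsub>cat \<A>\<^esub>)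
    | _ \<Rightarrow> undefined)"

definition wp :: "('b, 'k, 'e) signature \<Rightarrow> ('o, 'm, 'b, 'k, 'e) lc_struct \<Rightarrow> 'm
    \<Rightarrow> 'b ctx \<Rightarrow> ('b, 'k, 'e) tm \<Rightarrow> 'm \<Rightarrow> 'm" where
  "wp \<Sigma> \<A> \<tau> \<Gamma> M Q = \<tau> \<cdot>\<^bsub>cat \<A>\<^esub> tmap (mon \<A>) Q \<cdot>\<^bsub>cat \<A>\<^esub> sem \<Sigma> \<A> \<Gamma> M"


section \<open>Renaming and substitution\<close>

definition lift_ren :: "(nat \<Rightarrow> nat) \<Rightarrow> nat \<Rightarrow> nat" where
  "lift_ren r i = (case i of 0 \<Rightarrow> 0 | Suc j \<Rightarrow> Suc (r j))"

primrec rename :: "(nat \<Rightarrow> nat) \<Rightarrow> ('b, 'k, 'e) tm \<Rightarrow> ('b, 'k, 'e) tm" where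
  "rename r (Var i) = Var (r i)"
| "rename r (Const c M) = Const c (rename r M)"
| "rename r (Effect e M) = Effect e (rename r M)"
| "rename r Unit = Unit"
| "rename r (Pair M N) = Pair (rename r M) (rename r N)"
| "rename r (Proj1 M) = Proj1 (rename r M)"
| "rename r (Proj2 M) = Proj2 (rename r M)"
| "rename r (Abort t M) = Abort t (rename r M)"
| "rename r (Inj1 t M) = Inj1 t (rename r M)"
| "rename r (Inj2 t M) = Inj2 t (rename r M)"
| "rename r (Case M t1 N1 t2 N2) =
    Case (rename r M) t1 (rename (lift_ren r) N1) t2 (rename (lift_ren r) N2)"
| "rename r (Lam t M) = Lam t (rename (lift_ren r) M)"
| "rename r (App M N) = App (rename r M) (rename r N)"

definition lift_sub :: "(nat \<Rightarrow> ('b, 'k, 'e) tm) \<Rightarrow> nat \<Rightarrow> ('b, 'k, 'e) tm" where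
  "lift_sub s i = (case i of 0 \<Rightarrow> Var 0 | Suc j \<Rightarrow> rename Suc (s j))"

primrec subst :: "(nat \<Rightarrow> ('b, 'k, 'e) tm) \<Rightarrow> ('b, 'k, 'e) tm \<Rightarrow> ('b, 'k, 'e) tm" where
  "subst s (Var i) = s i"
| "subst s (Const c M) = Const c (subst s M)"
| "subst s (Effect e M) = Effect e (subst s M)"
| "subst s Unit = Unit"
| "subst s (Pair M N) = Pair (subst s M) (subst s N)"
| "subst s (Proj1 M) = Proj1 (subst s M)"
| "subst s (Proj2 M) = Proj2 (subst s M)"
| "subst s (Abort t M) = Abort t (subst s M)"
| "subst s (Inj1 t M) = Inj1 t (subst s M)"
| "subst s (Inj2 t M) = Inj2 t (subst s M)"
| "subst s (Case M t1 N1 t2 N2) =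
    Case (subst s M) t1 (subst (lift_sub s) N1) t2 (subst (lift_sub s) N2)"
| "subst s (Lam t M) = Lam t (subst (lift_sub s) M)"
| "subst s (App M N) = App (subst s M) (subst s N)"


section \<open>The state-passing-style transformation\<close>

text \<open>The base types of the target are \<open>'b + unit\<close>, the right summand being $b^Y$.\<close>

abbreviation bY :: "('b + unit) ty" where
  "bY \<equiv> TBase (Inr ())"

primrec circ :: "'b ty \<Rightarrow> ('b + unit) ty" where
  "circ (TBase b) = TBase (Inl b)"
| "circ TUnit = TUnit"
| "circ (TProd t1 t2) = TProd (circ t1) (circ t2)"
| "circ TZero = TZero"
| "circ (TSum t1 t2) = TSum (circ t1) (circ t2)"
| "circ (TFun t1 t2) = TFun (TProd (circ t1) bY) (TProd (circ t2) bY)"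

definition sps_ty :: "'b ty \<Rightarrow> ('b + unit) ty" where
  "sps_ty t = TProd (circ t) bY"

definition sps_ctx :: "'b ctx \<Rightarrow> ('b + unit) ctx" where
  "sps_ctx \<Gamma> = bY # map circ \<Gamma>"

definition sps_signature :: "('b, 'k, 'e) signature \<Rightarrow> ('b + unit, 'k, 'e) signature" where
  "sps_signature \<Sigma> =
    \<lparr> bases = bases \<Sigma> <+> {()}, constants = constants \<Sigma>, effects = effects \<Sigma>,
      ar = (\<lambda>k. TProd (map_ty Inl (ar \<Sigma> k)) bY),
      car = (\<lambda>k. TProd (map_ty Inl (car \<Sigma> k)) bY) \<rparr>"

text \<open>A transformed term lives in \<open>sps_ctx \<Gamma>\<close>, where \<open>Var 0\<close> is the state variable $y$ and
  \<open>Var (Suc i)\<close> is the source variable \<open>Var i\<close>.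

  \<open>under_y\<close> moves $\mathrm{SPS}(N)$ from $\Gamma^\circ, y$ to $\Gamma^\circ, y', z, y$ for use in
  $\lambda z.\, \dots (\lambda y.\, \mathrm{SPS}(N)) \dots$.

  \<open>split_z\<close> is the substitution $[\pi_1 z / x, \pi_2 z / y]$, taking $\Gamma^\circ, x, y$ to
  $\Gamma^\circ, y', z$.\<close>

definition under_y :: "('b, 'k, 'e) tm \<Rightarrow> ('b, 'k, 'e) tm" where
  "under_y = rename (\<lambda>i. case i of 0 \<Rightarrow> 0 | Suc j \<Rightarrow> j + 3)"

definition split_z :: "('b, 'k, 'e) tm \<Rightarrow> ('b, 'k, 'e) tm" where
  "split_z = subst (\<lambda>i. case i of
      0 \<Rightarrow> Proj2 (Var 0)
    | Suc 0 \<Rightarrow> Proj1 (Var 0)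
    | Suc (Suc j) \<Rightarrow> Var (j + 2))"

text \<open>The types of the bound variables $z$, left implicit in the usual notation, are those of the
  subterms in question; hence the dependency on \<open>\<Sigma>\<close> and \<open>\<Gamma>\<close>.\<close>

primrec sps :: "('b, 'k, 'e) signature \<Rightarrow> 'b ctx \<Rightarrow> ('b, 'k, 'e) tm \<Rightarrow> ('b + unit, 'k, 'e) tm" where
  "sps \<Sigma> \<Gamma> (Var i) = Pair (Var (Suc i)) (Var 0)"
| "sps \<Sigma> \<Gamma> (Const c M) = Const c (sps \<Sigma> \<Gamma> M)"
| "sps \<Sigma> \<Gamma> (Effect e M) = Effect e (sps \<Sigma> \<Gamma> M)"
| "sps \<Sigma> \<Gamma> Unit = Pair Unit (Var 0)"
| "sps \<Sigma> \<Gamma> (Pair M N) =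
    App (Lam (TProd (circ (type_of \<Sigma> \<Gamma> M)) (sps_ty (type_of \<Sigma> \<Gamma> N)))
          (Pair (Pair (Proj1 (Var 0)) (Proj1 (Proj2 (Var 0)))) (Proj2 (Proj2 (Var 0)))))
        (App (Lam (sps_ty (type_of \<Sigma> \<Gamma> M))
               (Pair (Proj1 (Var 0)) (App (Lam bY (under_y (sps \<Sigma> \<Gamma> N))) (Proj2 (Var 0)))))
             (sps \<Sigma> \<Gamma> M))"
| "sps \<Sigma> \<Gamma> (Proj1 M) =
    App (Lam (sps_ty (type_of \<Sigma> \<Gamma> M)) (Pair (Proj1 (Proj1 (Var 0))) (Proj2 (Var 0)))) (sps \<Sigma> \<Gamma> M)"
| "sps \<Sigma> \<Gamma> (Proj2 M) =
    App (Lam (sps_ty (type_of \<Sigma> \<Gamma> M)) (Pair (Proj2 (Proj1 (Var 0))) (Proj2 (Var 0)))) (sps \<Sigma> \<Gamma> M)"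
| "sps \<Sigma> \<Gamma> (Abort t M) =
    App (Lam (sps_ty TZero) (Pair (Abort (circ t) (Proj1 (Var 0))) (Proj2 (Var 0)))) (sps \<Sigma> \<Gamma> M)"
| "sps \<Sigma> \<Gamma> (Inj1 t2 M) =
    App (Lam (sps_ty (type_of \<Sigma> \<Gamma> M)) (Pair (Inj1 (circ t2) (Proj1 (Var 0))) (Proj2 (Var 0))))
        (sps \<Sigma> \<Gamma> M)"
| "sps \<Sigma> \<Gamma> (Inj2 t1 M) =
    App (Lam (sps_ty (type_of \<Sigma> \<Gamma> M)) (Pair (Inj2 (circ t1) (Proj1 (Var 0))) (Proj2 (Var 0))))
        (sps \<Sigma> \<Gamma> M)"
| "sps \<Sigma> \<Gamma> (Case M t1 M1 t2 M2) =
    Case (App (Lam (sps_ty (TSum t1 t2))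
                (Case (Proj1 (Var 0))
                  (circ t1) (Inj1 (sps_ty t2) (Pair (Var 0) (Proj2 (Var 1))))
                  (circ t2) (Inj2 (sps_ty t1) (Pair (Var 0) (Proj2 (Var 1))))))
              (sps \<Sigma> \<Gamma> M))
      (sps_ty t1) (split_z (sps \<Sigma> (t1 # \<Gamma>) M1))
      (sps_ty t2) (split_z (sps \<Sigma> (t2 # \<Gamma>) M2))"
| "sps \<Sigma> \<Gamma> (Lam t M) = Pair (Lam (sps_ty t) (split_z (sps \<Sigma> (t # \<Gamma>) M))) (Var 0)"
| "sps \<Sigma> \<Gamma> (App M N) =
    App (Lam (sps_ty (type_of \<Sigma> \<Gamma> M))
          (App (Proj1 (Var 0)) (App (Lam bY (under_y (sps \<Sigma> \<Gamma> N))) (Proj2 (Var 0)))))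
        (sps \<Sigma> \<Gamma> M)"


section \<open>The two structures and their comparison\<close>

definition struct_S :: "('o, 'm) bicc \<Rightarrow> ('o, 'm) monad \<Rightarrow> 'o \<Rightarrow> ('b \<Rightarrow> 'o) \<Rightarrow> ('k + 'e \<Rightarrow> 'm)
    \<Rightarrow> ('o, 'm, 'b, 'k, 'e) lc_struct" where
  "struct_S C T Y A a = \<lparr> cat = C, mon = state_monad C T Y, base_ob = A, op_arr = a \<rparr>"

definition struct_T :: "('b, 'k, 'e) signature \<Rightarrow> ('o, 'm) bicc \<Rightarrow> ('o, 'm) monad \<Rightarrow> 'o
    \<Rightarrow> ('b \<Rightarrow> 'o) \<Rightarrow> ('k + 'e \<Rightarrow> 'm) \<Rightarrow> ('o, 'm, 'b + unit, 'k, 'e) lc_struct" where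
  "struct_T \<Sigma> C T Y A a =
    \<lparr> cat = C, mon = T, base_ob = case_sum A (\<lambda>_. Y),
      op_arr = (\<lambda>k. case k of
          Inl c \<Rightarrow> prod_map C (a k) (idn C Y)
        | Inr e \<Rightarrow> uncurr C (tob T (ty_ob (struct_S C T Y A a) (car \<Sigma> k) \<otimes>\<^bsub>C\<^esub> Y)) Y (a k)) \<rparr>"

text \<open>\<open>rho \<AA>\<^sub>S \<AA>\<^sub>T Y t\<close> is $\rho_t : [\![t]\!]_S \to [\![t^\circ]\!]_T$.\<close>

primrec rho :: "('o, 'm, 'b, 'k, 'e) lc_struct \<Rightarrow> ('o, 'm, 'b + unit, 'k, 'e) lc_struct
    \<Rightarrow> 'o \<Rightarrow> 'b ty \<Rightarrow> 'm" where
  "rho \<A>S \<A>T Y (TBase b) = idn (cat \<A>S) (base_ob \<A>S b)"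
| "rho \<A>S \<A>T Y TUnit = idn (cat \<A>S) (terminal (cat \<A>S))"
| "rho \<A>S \<A>T Y (TProd t1 t2) = prod_map (cat \<A>S) (rho \<A>S \<A>T Y t1) (rho \<A>S \<A>T Y t2)"
| "rho \<A>S \<A>T Y TZero = idn (cat \<A>S) (initial (cat \<A>S))"
| "rho \<A>S \<A>T Y (TSum t1 t2) = sum_map (cat \<A>S) (rho \<A>S \<A>T Y t1) (rho \<A>S \<A>T Y t2)"
| "rho \<A>S \<A>T Y (TFun t1 t2) =
    curry_iso (cat \<A>S) (tob (mon \<A>T) (ty_ob \<A>T (circ t2) \<otimes>\<^bsub>cat \<A>S\<^esub> Y)) Y (ty_ob \<A>T (circ t1))
      \<cdot>\<^bsub>cat \<A>S\<^esub> expo_map (cat \<A>S) (tmap (mon \<A>S) (rho \<A>S \<A>T Y t2))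
            (inverse_arr (cat \<A>S) (rho \<A>S \<A>T Y t1))"

abbreviation rho_ctx :: "('o, 'm, 'b, 'k, 'e) lc_struct \<Rightarrow> ('o, 'm, 'b + unit, 'k, 'e) lc_struct
    \<Rightarrow> 'o \<Rightarrow> 'b ctx \<Rightarrow> 'm" where
  "rho_ctx \<A>S \<A>T Y \<Gamma> \<equiv> rho \<A>S \<A>T Y (ctx_ty \<Gamma>)"

end

theory Submission
  imports Defs
begin

text \<open>Write \<open>run\<close> for the transposition of \<open>f : X \<rightarrow> S A\<close> to \<open>X \<otimes> Y \<rightarrow> T (A \<otimes> Y)\<close>. It carries the unit and the
  Kleisli composition of \<open>S\<close> under a context to those of \<open>T\<close>. Call-by-value semantics only uses these two
  operations and the bicartesian closed structure, so \<open>run\<close> of the \<open>S\<close>-semantics of a term can be computed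
  clause by clause, and each clause of SPS has the same semantics in \<open>T\<close> up to the isomorphisms \<open>\<rho>\<close>. By
  induction on typing, \<open>sem (SPS M) \<cdot> (\<rho>\<^sub>\<Gamma> \<times> Y) = T (\<rho>\<^sub>t \<times> Y) \<cdot> run (sem M)\<close>; composing with the algebra,
  whose transpose is \<open>\<tau> \<cdot> T ev\<close>, gives the claim.\<close>


section \<open>Arrows with their end points\<close>

text \<open>Arrows live in one type with explicit end points, so every law is conditional on typings
  and an unaided calculation would be dominated by side conditions. The proof aims at normal forms
  instead: composites nested to the right, tuples pushed inwards, the strength, the multiplication
  and the functor action all expressed by one context-passing bind, and \<open>dist\<close>, which
  is given only as an inverse, by a case distinction that keeps its context. Two obstacles remain.
  SPS substitutes projections of variables for variables, so the substitution lemma has to cover all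
  terms whose denotation factors through the unit. And \<rho> at a function type contains the
  inverse at the argument type, so a target argument must be written as an image under \<rho> before
  an induction hypothesis applies to it. The strong monad laws for \<open>S\<close> are not derived
  from those of \<open>T\<close>: they are part of the assumption that the source is a
  structure.\<close>

text \<open>The premises of the rewrite rules about arrows have the form \<open>ends C f \<equiv> Some (A, B)\<close>: once
  the left-hand side is evaluated, the simplifier solves such a premise by reflexivity of \<open>\<equiv>\<close>, which
  instantiates the objects \<open>A\<close> and \<open>B\<close> that do not occur in the term being rewritten.\<close>

definition ends :: "('o, 'm, 'x) category_scheme \<Rightarrow> 'm \<Rightarrow> ('o \<times> 'o) option" where
  "ends C f = (if f \<in> arr C then Some (src C f, tgt C f) else None)"

text \<open>Makes every membership in a hom-set, also in the locale axioms, an equation for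
  \<open>ends\<close>, so that typing assumptions act as rewrite rules.\<close>

lemma hom_iff_ends [simp]: "f \<in> hom C A B \<longleftrightarrow> ends C f = Some (A, B)"
  by (auto simp: ends_def hom_def)

lemma ends_src [simp]: "ends C f \<equiv> Some (A, B) \<Longrightarrow> src C f = A"
  and ends_tgt [simp]: "ends C f \<equiv> Some (A, B) \<Longrightarrow> tgt C f = B"
  by (auto simp: ends_def atomize_eq split: if_splits)

text \<open>\<open>inverse_arr\<close> is a definite description, so nothing can be computed from it
  before an inverse is known. Arguments go through this relation, and \<open>inverse_arr_eqI\<close>
  transfers the result.\<close>

definition is_inverse :: "('o, 'm, 'x) category_scheme \<Rightarrow> 'm \<Rightarrow> 'm \<Rightarrow> bool" where
  "is_inverse C f g \<longleftrightarrow> (\<exists>A B. ends C f = Some (A, B) \<and> ends C g = Some (B, A)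
    \<and> g \<cdot>\<^bsub>C\<^esub> f = idn C A \<and> f \<cdot>\<^bsub>C\<^esub> g = idn C B)"

context category
begin

lemma ends_obj:
  assumes "ends C f = Some (A, B)"
  shows "A \<in> obj C" "B \<in> obj C"
  using assms src_obj[of f] tgt_obj[of f]
  by (auto simp: ends_def simp del: ends_src ends_tgt split: if_splits)

lemmas ends_obj_dom = ends_obj(1)[OF meta_eq_to_obj_eq]
  and ends_obj_cod = ends_obj(2)[OF meta_eq_to_obj_eq]

lemma ends_idn [simp]: "A \<in> obj C \<Longrightarrow> ends C (idn C A) = Some (A, A)"
  using idn_hom by simp

lemma ends_cmp [simp]:
  "ends C f \<equiv> Some (A, B) \<Longrightarrow> ends C g \<equiv> Some (B, D) \<Longrightarrow> ends C (g \<cdot> f) = Some (A, D)"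
  using cmp_hom by (simp add: atomize_eq)

lemma cmp_idn' [simp]: "ends C f \<equiv> Some (A, B) \<Longrightarrow> f \<cdot> idn C A = f"
  and idn_cmp' [simp]: "ends C f \<equiv> Some (A, B) \<Longrightarrow> idn C B \<cdot> f = f"
  using cmp_idn idn_cmp by (simp_all add: atomize_eq)

lemma cmp_assoc' [simp]:
  "ends C f \<equiv> Some (A, B) \<Longrightarrow> ends C g \<equiv> Some (B, D) \<Longrightarrow> ends C h \<equiv> Some (D, E)
    \<Longrightarrow> (h \<cdot> g) \<cdot> f = h \<cdot> g \<cdot> f"
  using cmp_assoc by (simp add: atomize_eq)

lemma inverse_arr_eqI: "is_inverse C f g \<Longrightarrow> inverse_arr C f = g"
  unfolding is_inverse_def
proof (elim exE conjE)
  fix A B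
  assume f: "ends C f = Some (A, B)" and g: "ends C g = Some (B, A)"
    and gf: "g \<cdot> f = idn C A" and fg: "f \<cdot> g = idn C B"
  have unique: "g' = g" if g': "ends C g' = Some (B, A)" and "g' \<cdot> f = idn C A" for g'
  proof -
    have "g' = g' \<cdot> (f \<cdot> g)" using g' fg by simp
    also have "\<dots> = (g' \<cdot> f) \<cdot> g" using f g g' by simp
    also have "\<dots> = g" using that(2) g by simp
    finally show ?thesis .
  qed
  have "src C f = A" "tgt C f = B" using f by simp_all
  then show ?thesis
    unfolding inverse_arr_def hom_iff_ends using g gf fg unique by (intro the_equality) blast+
qed

lemma is_inverse_sym: "is_inverse C f g \<Longrightarrow> is_inverse C g f"
  unfolding is_inverse_def by blast

lemma is_inverse_idn: "A \<in> obj C \<Longrightarrow> is_inverse C (idn C A) (idn C A)"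
  unfolding is_inverse_def by (intro exI[of _ A]) simp

end


section \<open>Products, sums and exponentials as rewrite rules\<close>

context bicartesian_closed
begin

declare terminal_obj [simp] initial_obj [simp] product_obj [simp] coproduct_obj [simp]
  expo_obj [simp]

lemma ends_tuple [simp]:
  "ends C f \<equiv> Some (Z, A) \<Longrightarrow> ends C g \<equiv> Some (Z, B) \<Longrightarrow> ends C \<langle>f, g\<rangle> = Some (Z, A \<otimes> B)"
  using tuple_hom by (simp add: atomize_eq)

lemma ends_pr1 [simp]: "A \<in> obj C \<Longrightarrow> B \<in> obj C \<Longrightarrow> ends C (pr1 C A B) = Some (A \<otimes> B, A)"
  and ends_pr2 [simp]: "A \<in> obj C \<Longrightarrow> B \<in> obj C \<Longrightarrow> ends C (pr2 C A B) = Some (A \<otimes> B, B)"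
  and ends_in1 [simp]: "A \<in> obj C \<Longrightarrow> B \<in> obj C \<Longrightarrow> ends C (in1 C A B) = Some (A, A \<oplus> B)"
  and ends_in2 [simp]: "A \<in> obj C \<Longrightarrow> B \<in> obj C \<Longrightarrow> ends C (in2 C A B) = Some (B, A \<oplus> B)"
  and ends_bang [simp]: "A \<in> obj C \<Longrightarrow> ends C (bang C A) = Some (A, terminal C)"
  and ends_cobang [simp]: "A \<in> obj C \<Longrightarrow> ends C (cobang C A) = Some (initial C, A)"
  and ends_ev [simp]: "A \<in> obj C \<Longrightarrow> B \<in> obj C \<Longrightarrow> ends C (ev C A B) = Some (expo C A B \<otimes> B, A)"
  using pr1_hom pr2_hom in1_hom in2_hom bang_hom cobang_hom ev_hom by simp_all

lemma ends_cotuple [simp]: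
  "ends C f \<equiv> Some (A, Z) \<Longrightarrow> ends C g \<equiv> Some (B, Z) \<Longrightarrow> ends C (cotuple C f g) = Some (A \<oplus> B, Z)"
  using cotuple_hom by (simp add: atomize_eq)

lemma ends_curr [simp]:
  "Z \<in> obj C \<Longrightarrow> Y \<in> obj C \<Longrightarrow> ends C f \<equiv> Some (Z \<otimes> Y, X)
    \<Longrightarrow> ends C (curr C Z Y f) = Some (Z, expo C X Y)"
  using curr_hom by (simp add: atomize_eq)

lemma pr1_tuple' [simp]:
  "ends C f \<equiv> Some (Z, A) \<Longrightarrow> ends C g \<equiv> Some (Z, B) \<Longrightarrow> pr1 C A B \<cdot> \<langle>f, g\<rangle> = f"
  and pr2_tuple' [simp]:
  "ends C f \<equiv> Some (Z, A) \<Longrightarrow> ends C g \<equiv> Some (Z, B) \<Longrightarrow> pr2 C A B \<cdot> \<langle>f, g\<rangle> = g"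
  using pr1_tuple pr2_tuple by (simp_all add: atomize_eq)

lemma tuple_eta [simp]:
  "A \<in> obj C \<Longrightarrow> B \<in> obj C \<Longrightarrow> ends C h \<equiv> Some (Z, A \<otimes> B)
    \<Longrightarrow> \<langle>pr1 C A B \<cdot> h, pr2 C A B \<cdot> h\<rangle> = h"
  using tuple_unique by (simp add: atomize_eq)

lemma tuple_pr [simp]: "A \<in> obj C \<Longrightarrow> B \<in> obj C \<Longrightarrow> \<langle>pr1 C A B, pr2 C A B\<rangle> = idn C (A \<otimes> B)"
  using tuple_eta[of A B "idn C (A \<otimes> B)" "A \<otimes> B"] by simp

lemma tuple_cmp [simp]:
  assumes "ends C h \<equiv> Some (W, Z)" "ends C f \<equiv> Some (Z, A)" "ends C g \<equiv> Some (Z, B)"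
  shows "\<langle>f, g\<rangle> \<cdot> h = \<langle>f \<cdot> h, g \<cdot> h\<rangle>"
proof -
  have "A \<in> obj C" "B \<in> obj C" using assms(2,3) ends_obj by (auto simp: atomize_eq)
  then have "\<langle>f, g\<rangle> \<cdot> h = \<langle>pr1 C A B \<cdot> \<langle>f, g\<rangle> \<cdot> h, pr2 C A B \<cdot> \<langle>f, g\<rangle> \<cdot> h\<rangle>"
    using assms by simp
  \<comment> \<open>Only associativity is used here; with the projection rule active the right-hand
    side would collapse to \<open>f \<cdot> h\<close> while the left-hand side stays nested.\<close>
  also have "pr1 C A B \<cdot> \<langle>f, g\<rangle> \<cdot> h = (pr1 C A B \<cdot> \<langle>f, g\<rangle>) \<cdot> h"
    using assms \<open>A \<in> obj C\<close> \<open>B \<in> obj C\<close> by (simp del: pr1_tuple')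
  also have "pr2 C A B \<cdot> \<langle>f, g\<rangle> \<cdot> h = (pr2 C A B \<cdot> \<langle>f, g\<rangle>) \<cdot> h"
    using assms \<open>A \<in> obj C\<close> \<open>B \<in> obj C\<close> by (simp del: pr2_tuple')
  finally show ?thesis using assms by simp
qed

lemma bang_cmp [simp]: "A \<in> obj C \<Longrightarrow> ends C h \<equiv> Some (B, A) \<Longrightarrow> bang C A \<cdot> h = bang C B"
  using bang_unique[of "bang C A \<cdot> h" B] by simp

text \<open>Uniqueness of arrows out of the initial object; the trailing \<open>x\<close> matches
  the right-nested form of composites. It absorbs \<rho> after an \<open>Abort\<close>.\<close>

lemma cmp_cobang_cmp:
  assumes "A \<in> obj C" "ends C x \<equiv> Some (X, initial C)" "ends C h \<equiv> Some (A, B)"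
  shows "h \<cdot> cobang C A \<cdot> x = cobang C B \<cdot> x"
proof -
  have "h \<cdot> cobang C A = cobang C B" using assms cobang_unique[of "h \<cdot> cobang C A" B] by simp
  moreover have "h \<cdot> cobang C A \<cdot> x = (h \<cdot> cobang C A) \<cdot> x" using assms by simp
  ultimately show ?thesis by simp
qed

lemma cotuple_in1' [simp]:
  "ends C f \<equiv> Some (A, Z) \<Longrightarrow> ends C g \<equiv> Some (B, Z) \<Longrightarrow> cotuple C f g \<cdot> in1 C A B = f"
  and cotuple_in2' [simp]:
  "ends C f \<equiv> Some (A, Z) \<Longrightarrow> ends C g \<equiv> Some (B, Z) \<Longrightarrow> cotuple C f g \<cdot> in2 C A B = g"
  using cotuple_in1 cotuple_in2 by (simp_all add: atomize_eq)

lemma cotuple_in1_cmp [simp]: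
  assumes "ends C f \<equiv> Some (A, Z)" "ends C g \<equiv> Some (B, Z)" "ends C h \<equiv> Some (W, A)"
  shows "cotuple C f g \<cdot> in1 C A B \<cdot> h = f \<cdot> h"
proof -
  have "A \<in> obj C" "B \<in> obj C" using assms(1,2) ends_obj by (auto simp: atomize_eq)
  then have "cotuple C f g \<cdot> in1 C A B \<cdot> h = (cotuple C f g \<cdot> in1 C A B) \<cdot> h"
    using assms by (simp del: cotuple_in1')
  then show ?thesis using assms by simp
qed

lemma cotuple_in2_cmp [simp]:
  assumes "ends C f \<equiv> Some (A, Z)" "ends C g \<equiv> Some (B, Z)" "ends C h \<equiv> Some (W, B)"
  shows "cotuple C f g \<cdot> in2 C A B \<cdot> h = g \<cdot> h"
proof -
  have "A \<in> obj C" "B \<in> obj C" using assms(1,2) ends_obj by (auto simp: atomize_eq)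
  then have "cotuple C f g \<cdot> in2 C A B \<cdot> h = (cotuple C f g \<cdot> in2 C A B) \<cdot> h"
    using assms by (simp del: cotuple_in2')
  then show ?thesis using assms by simp
qed

lemma cotuple_eqI:
  assumes "ends C h = Some (A \<oplus> B, Z)" "A \<in> obj C" "B \<in> obj C"
    and "h \<cdot> in1 C A B = f" "h \<cdot> in2 C A B = g"
  shows "h = cotuple C f g"
  using assms cotuple_unique by force

lemma cotuple_in [simp]:
  "A \<in> obj C \<Longrightarrow> B \<in> obj C \<Longrightarrow> cotuple C (in1 C A B) (in2 C A B) = idn C (A \<oplus> B)"
  by (rule cotuple_eqI[symmetric, of _ A B "A \<oplus> B"]) simp_all

lemma cmp_cotuple [simp]:
  assumes "ends C f \<equiv> Some (A, Z)" "ends C g \<equiv> Some (B, Z)" "ends C h \<equiv> Some (Z, W)"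
  shows "h \<cdot> cotuple C f g = cotuple C (h \<cdot> f) (h \<cdot> g)"
proof -
  have "A \<in> obj C" "B \<in> obj C" using assms(1,2) ends_obj by (auto simp: atomize_eq)
  with assms show ?thesis
    by (intro cotuple_eqI[of _ A B W]) simp_all
qed

lemma cmp_cotuple_cmp [simp]:
  assumes "ends C s \<equiv> Some (V, A \<oplus> B)" "ends C f \<equiv> Some (A, Z)" "ends C g \<equiv> Some (B, Z)"
    and "ends C h \<equiv> Some (Z, W)"
  shows "h \<cdot> cotuple C f g \<cdot> s = cotuple C (h \<cdot> f) (h \<cdot> g) \<cdot> s"
proof -
  have "h \<cdot> cotuple C f g \<cdot> s = (h \<cdot> cotuple C f g) \<cdot> s"
    using assms by (simp del: cmp_cotuple)
  then show ?thesis using assms by simp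
qed

lemma prod_map_eq [simp]:
  "ends C f \<equiv> Some (A, B) \<Longrightarrow> ends C g \<equiv> Some (A', B')
    \<Longrightarrow> prod_map C f g = \<langle>f \<cdot> pr1 C A A', g \<cdot> pr2 C A A'\<rangle>"
  by (simp add: prod_map_def)

lemma sum_map_eq [simp]:
  "ends C f \<equiv> Some (A, B) \<Longrightarrow> ends C g \<equiv> Some (A', B')
    \<Longrightarrow> sum_map C f g = cotuple C (in1 C B B' \<cdot> f) (in2 C B B' \<cdot> g)"
  by (simp add: sum_map_def)

lemma uncurr_eq [simp]:
  "Y \<in> obj C \<Longrightarrow> ends C g \<equiv> Some (Z, expo C X Y)
    \<Longrightarrow> uncurr C X Y g = ev C X Y \<cdot> \<langle>g \<cdot> pr1 C Z Y, pr2 C Z Y\<rangle>"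
  using ends_obj[of g] by (simp add: uncurr_def)

declare swap_def [simp] assoc_l_def [simp] assoc_r_def [simp]

lemma expo_map_eq [simp]:
  "ends C f \<equiv> Some (X, X') \<Longrightarrow> ends C g \<equiv> Some (V', V)
    \<Longrightarrow> expo_map C f g = curr C (expo C X V) V'
      (f \<cdot> ev C X V \<cdot> \<langle>pr1 C (expo C X V) V', g \<cdot> pr2 C (expo C X V) V'\<rangle>)"
  using ends_obj[of f] ends_obj[of g] by (simp add: expo_map_def)

text \<open>Transposition is injective because \<open>curr\<close> undoes \<open>uncurr\<close>;
  hence arrows into an exponential may be compared after evaluation.\<close>

lemma expo_ext:
  assumes "ends C f = Some (Z, expo C X Y)" "ends C g = Some (Z, expo C X Y)"
    and "X \<in> obj C" "Y \<in> obj C"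
    and "ev C X Y \<cdot> \<langle>f \<cdot> pr1 C Z Y, pr2 C Z Y\<rangle> = ev C X Y \<cdot> \<langle>g \<cdot> pr1 C Z Y, pr2 C Z Y\<rangle>"
  shows "f = g"
proof -
  have "uncurr C X Y f = uncurr C X Y g" using assms by simp
  moreover have "curr C Z Y (uncurr C X Y f) = f" "curr C Z Y (uncurr C X Y g) = g"
    using assms curr_uncurr by (simp_all del: uncurr_eq)
  ultimately show ?thesis by metis
qed

lemma ev_curr_pr:
  assumes "ends C f = Some (Z \<otimes> Y, X)" "Z \<in> obj C" "Y \<in> obj C"
  shows "ev C X Y \<cdot> \<langle>curr C Z Y f \<cdot> pr1 C Z Y, pr2 C Z Y\<rangle> = f"
  using uncurr_curr[of Z Y f X] assms by simp

text \<open>The beta rule with both arguments general: \<open>f\<close> is recovered by evaluating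
  its transpose at the projections, and the equation is then precomposed with the pair of
  \<open>u\<close> and \<open>v\<close>.\<close>

lemma ev_curr_tuple:
  assumes "Z \<in> obj C" "Y \<in> obj C" "ends C f \<equiv> Some (Z \<otimes> Y, X)"
    and "ends C u \<equiv> Some (W, Z)" "ends C v \<equiv> Some (W, Y)"
  shows "ev C X Y \<cdot> \<langle>curr C Z Y f \<cdot> u, v\<rangle> = f \<cdot> \<langle>u, v\<rangle>"
proof -
  have "X \<in> obj C" using assms(3) ends_obj by (auto simp: atomize_eq)
  have "f \<cdot> \<langle>u, v\<rangle> = (ev C X Y \<cdot> \<langle>curr C Z Y f \<cdot> pr1 C Z Y, pr2 C Z Y\<rangle>) \<cdot> \<langle>u, v\<rangle>"
    using assms by (subst ev_curr_pr) simp_all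
  also have "\<dots> = ev C X Y \<cdot> \<langle>curr C Z Y f \<cdot> u, v\<rangle>"
    using assms \<open>X \<in> obj C\<close> by simp
  finally show ?thesis by simp
qed

lemma ev_curr [simp]:
  assumes "Z \<in> obj C" "Y \<in> obj C" "ends C f \<equiv> Some (Z \<otimes> Y, X)" "ends C v \<equiv> Some (Z, Y)"
  shows "ev C X Y \<cdot> \<langle>curr C Z Y f, v\<rangle> = f \<cdot> \<langle>idn C Z, v\<rangle>"
  using ev_curr_tuple[of Z Y f X "idn C Z" Z v] assms by simp

text \<open>Naturality of transposition, by evaluation on both sides. As a rewrite rule it moves an
  environment into the body of a closure.\<close>

lemma curr_cmp [simp]:
  assumes "Z \<in> obj C" "Y \<in> obj C" "ends C f \<equiv> Some (Z \<otimes> Y, X)" "ends C h \<equiv> Some (W, Z)"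
  shows "curr C Z Y f \<cdot> h = curr C W Y (f \<cdot> \<langle>h \<cdot> pr1 C W Y, pr2 C W Y\<rangle>)"
proof -
  have "X \<in> obj C" "W \<in> obj C" using assms(3,4) ends_obj by (auto simp: atomize_eq)
  show ?thesis
    by (rule expo_ext[of _ W X Y]) (use assms \<open>X \<in> obj C\<close> \<open>W \<in> obj C\<close> in \<open>simp_all add: ev_curr_tuple\<close>)
qed

lemma curr_eta [simp]:
  assumes "Z \<in> obj C" "Y \<in> obj C" "X \<in> obj C" "ends C g \<equiv> Some (Z, expo C X Y)"
  shows "curr C Z Y (ev C X Y \<cdot> \<langle>g \<cdot> pr1 C Z Y, pr2 C Z Y\<rangle>) = g"
  using curr_uncurr[of X Y g Z] assms by simp

lemma curr_ev [simp]:
  "X \<in> obj C \<Longrightarrow> Y \<in> obj C \<Longrightarrow> curr C (expo C X Y) Y (ev C X Y) = idn C (expo C X Y)"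
  using curr_eta[of "expo C X Y" Y X "idn C (expo C X Y)"] by simp


section \<open>Case distinction under a context\<close>

text \<open>In \<open>case_arr A B s f g\<close> the scrutinee is \<open>s : X \<rightarrow> A \<oplus> B\<close>, and the branches
  \<open>f : X \<otimes> A \<rightarrow> Z\<close> and \<open>g : X \<otimes> B \<rightarrow> Z\<close> keep access to the context \<open>X\<close>. Transposing them along
  \<open>X\<close> avoids the inverse in the definition of \<open>dist\<close>.\<close>

definition case_arr :: "'o \<Rightarrow> 'o \<Rightarrow> 'm \<Rightarrow> 'm \<Rightarrow> 'm \<Rightarrow> 'm" where
  "case_arr A B s f g = (let X = src C s; Z = tgt C f in
    ev C Z X \<cdot> \<langle>cotuple C (curr C A X (f \<cdot> swap C A X)) (curr C B X (g \<cdot> swap C B X)) \<cdot> s, idn C X\<rangle>)"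

lemma case_arr_eq:
  assumes "A \<in> obj C" "B \<in> obj C"
    and "ends C s \<equiv> Some (X, A \<oplus> B)" "ends C f \<equiv> Some (X \<otimes> A, Z)" "ends C g \<equiv> Some (X \<otimes> B, Z)"
  shows "case_arr A B s f g = ev C Z X \<cdot> \<langle>cotuple C (curr C A X (f \<cdot> \<langle>pr2 C A X, pr1 C A X\<rangle>))
    (curr C B X (g \<cdot> \<langle>pr2 C B X, pr1 C B X\<rangle>)) \<cdot> s, idn C X\<rangle>"
  unfolding case_arr_def Let_def using assms by simp

lemma ends_case_arr [simp]:
  assumes "A \<in> obj C" "B \<in> obj C"
    and "ends C s \<equiv> Some (X, A \<oplus> B)" "ends C f \<equiv> Some (X \<otimes> A, Z)" "ends C g \<equiv> Some (X \<otimes> B, Z)"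
  shows "ends C (case_arr A B s f g) = Some (X, Z)"
proof -
  have "X \<in> obj C" "Z \<in> obj C" using assms(3,4) ends_obj by (auto simp: atomize_eq)
  then show ?thesis using assms by (simp add: case_arr_eq)
qed

lemma case_arr_in1 [simp]:
  assumes "A \<in> obj C" "B \<in> obj C"
    and "ends C v \<equiv> Some (X, A)" "ends C f \<equiv> Some (X \<otimes> A, Z)" "ends C g \<equiv> Some (X \<otimes> B, Z)"
  shows "case_arr A B (in1 C A B \<cdot> v) f g = f \<cdot> \<langle>idn C X, v\<rangle>"
proof -
  have "X \<in> obj C" "Z \<in> obj C" using assms(3,4) ends_obj by (auto simp: atomize_eq)
  then show ?thesis using assms by (simp add: case_arr_eq)
qed

lemma case_arr_in2 [simp]:
  assumes "A \<in> obj C" "B \<in> obj C"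
    and "ends C v \<equiv> Some (X, B)" "ends C f \<equiv> Some (X \<otimes> A, Z)" "ends C g \<equiv> Some (X \<otimes> B, Z)"
  shows "case_arr A B (in2 C A B \<cdot> v) f g = g \<cdot> \<langle>idn C X, v\<rangle>"
proof -
  have "X \<in> obj C" "Z \<in> obj C" using assms(3,4) ends_obj by (auto simp: atomize_eq)
  then show ?thesis using assms by (simp add: case_arr_eq)
qed

lemma case_arr_cmp [simp]:
  assumes "A \<in> obj C" "B \<in> obj C"
    and "ends C s \<equiv> Some (X, A \<oplus> B)" "ends C f \<equiv> Some (X \<otimes> A, Z)" "ends C g \<equiv> Some (X \<otimes> B, Z)"
    and "ends C h \<equiv> Some (W, X)"
  shows "case_arr A B s f g \<cdot> h
    = case_arr A B (s \<cdot> h) (f \<cdot> \<langle>h \<cdot> pr1 C W A, pr2 C W A\<rangle>) (g \<cdot> \<langle>h \<cdot> pr1 C W B, pr2 C W B\<rangle>)"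
proof -
  have X: "X \<in> obj C" "Z \<in> obj C" "W \<in> obj C" using assms(3,4,6) ends_obj by (auto simp: atomize_eq)
  let ?c = "cotuple C (curr C A X (f \<cdot> \<langle>pr2 C A X, pr1 C A X\<rangle>)) (curr C B X (g \<cdot> \<langle>pr2 C B X, pr1 C B X\<rangle>))"
  let ?d = "cotuple C (curr C A W (f \<cdot> \<langle>h \<cdot> pr2 C A W, pr1 C A W\<rangle>)) (curr C B W (g \<cdot> \<langle>h \<cdot> pr2 C B W, pr1 C B W\<rangle>))"
  \<comment> \<open>\<open>?e\<close> is precomposition with \<open>h\<close>, from Z^X to Z^W. It
    carries the transposes along \<open>X\<close> to those along \<open>W\<close>, so that beta
    reduction brings the evaluation at \<open>W\<close> back to one at \<open>X\<close>.\<close>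
  let ?e = "curr C (expo C Z X) W (ev C Z X \<cdot> \<langle>pr1 C (expo C Z X) W, h \<cdot> pr2 C (expo C Z X) W\<rangle>)"
  have c: "ends C ?c = Some (A \<oplus> B, expo C Z X)" using assms X by simp
  have 1: "?d = ?e \<cdot> ?c" using assms X by (simp add: ev_curr_tuple)
  have "ev C Z W \<cdot> \<langle>?d \<cdot> s \<cdot> h, idn C W\<rangle> = ev C Z W \<cdot> \<langle>?e \<cdot> (?c \<cdot> s \<cdot> h), idn C W\<rangle>"
    unfolding 1 using assms X c by (simp del: curr_cmp cmp_cotuple)
  also have "\<dots> = ev C Z X \<cdot> \<langle>?c \<cdot> s \<cdot> h, h\<rangle>"
    using c by (subst ev_curr_tuple) (use assms X in simp_all)
  finally show ?thesis using assms X by (simp add: case_arr_eq)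
qed

text \<open>Exponentials make the product with \<open>X\<close> preserve sums: after swapping and
  transposing along \<open>X\<close> both arrows start at \<open>A \<oplus> B\<close>, where
  agreement on the injections suffices.\<close>

lemma case_arr_ext:
  assumes "A \<in> obj C" "B \<in> obj C" "X \<in> obj C"
    and "ends C h = Some (X \<otimes> (A \<oplus> B), Z)" "ends C k = Some (X \<otimes> (A \<oplus> B), Z)"
    and 1: "h \<cdot> \<langle>pr1 C X A, in1 C A B \<cdot> pr2 C X A\<rangle> = k \<cdot> \<langle>pr1 C X A, in1 C A B \<cdot> pr2 C X A\<rangle>"
    and 2: "h \<cdot> \<langle>pr1 C X B, in2 C A B \<cdot> pr2 C X B\<rangle> = k \<cdot> \<langle>pr1 C X B, in2 C A B \<cdot> pr2 C X B\<rangle>"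
  shows "h = k"
proof -
  let ?sw = "\<langle>pr2 C (A \<oplus> B) X, pr1 C (A \<oplus> B) X\<rangle>"
  let ?c = "\<lambda>h. curr C (A \<oplus> B) X (h \<cdot> ?sw)"
  have Z: "Z \<in> obj C" using assms ends_obj by blast
  \<comment> \<open>Restricting a transpose to an injection gives the transpose of the restriction,
    and the restrictions are what the two premises compare.\<close>
  have in1: "?c h \<cdot> in1 C A B = curr C A X ((h \<cdot> \<langle>pr1 C X A, in1 C A B \<cdot> pr2 C X A\<rangle>) \<cdot> \<langle>pr2 C A X, pr1 C A X\<rangle>)"
    and in2: "?c h \<cdot> in2 C A B = curr C B X ((h \<cdot> \<langle>pr1 C X B, in2 C A B \<cdot> pr2 C X B\<rangle>) \<cdot> \<langle>pr2 C B X, pr1 C B X\<rangle>)"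
    if "ends C h = Some (X \<otimes> (A \<oplus> B), Z)" for h
    using assms(1-3) that Z by simp_all
  have "?c h = cotuple C (?c h \<cdot> in1 C A B) (?c h \<cdot> in2 C A B)"
    using assms Z by (intro cotuple_eqI[of _ A B "expo C Z X"]) simp_all
  also have "\<dots> = cotuple C (?c k \<cdot> in1 C A B) (?c k \<cdot> in2 C A B)"
    by (simp only: in1[OF assms(4)] in2[OF assms(4)] in1[OF assms(5)] in2[OF assms(5)] 1 2)
  also have "\<dots> = ?c k"
    using assms Z by (intro cotuple_eqI[of _ A B "expo C Z X", symmetric]) simp_all
  finally have eq: "?c h = ?c k" .
  have "h = ev C Z X \<cdot> \<langle>?c h \<cdot> pr2 C X (A \<oplus> B), pr1 C X (A \<oplus> B)\<rangle>"
    by (subst ev_curr_tuple) (use assms Z in simp_all)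
  also have "\<dots> = k"
    unfolding eq by (subst ev_curr_tuple) (use assms Z in simp_all)
  finally show ?thesis .
qed

text \<open>The case distinction on the second component that returns the two injections inverts the
  canonical map, so it is the arrow that the definite description in \<open>dist\<close> denotes.
  Its branches have all of \<open>X \<otimes> (A \<oplus> B)\<close> as context and must first
  project it to \<open>X\<close>.\<close>

lemma cotuple_dist:
  assumes "A \<in> obj C" "B \<in> obj C" "X \<in> obj C"
    and "ends C f \<equiv> Some (X \<otimes> A, Z)" "ends C g \<equiv> Some (X \<otimes> B, Z)"
  shows "cotuple C f g \<cdot> dist C X A B = case_arr A B (pr2 C X (A \<oplus> B))
      (f \<cdot> \<langle>pr1 C X (A \<oplus> B) \<cdot> pr1 C (X \<otimes> (A \<oplus> B)) A, pr2 C (X \<otimes> (A \<oplus> B)) A\<rangle>)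
      (g \<cdot> \<langle>pr1 C X (A \<oplus> B) \<cdot> pr1 C (X \<otimes> (A \<oplus> B)) B, pr2 C (X \<otimes> (A \<oplus> B)) B\<rangle>)"
    (is "_ = ?case f g")
    and "ends C (dist C X A B) = Some (X \<otimes> (A \<oplus> B), (X \<otimes> A) \<oplus> (X \<otimes> B))"
proof -
  have Z: "Z \<in> obj C" using assms ends_obj by (auto simp: atomize_eq)
  let ?i = "in1 C (X \<otimes> A) (X \<otimes> B)" and ?j = "in2 C (X \<otimes> A) (X \<otimes> B)"
  let ?can = "cotuple C (prod_map C (idn C X) (in1 C A B)) (prod_map C (idn C X) (in2 C A B))"
  let ?d = "?case ?i ?j"
  have "is_inverse C ?can ?d"
    unfolding is_inverse_def
  proof (intro exI conjI)
    show can: "ends C ?can = Some ((X \<otimes> A) \<oplus> (X \<otimes> B), X \<otimes> (A \<oplus> B))"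
      and d: "ends C ?d = Some (X \<otimes> (A \<oplus> B), (X \<otimes> A) \<oplus> (X \<otimes> B))"
      using assms by simp_all
    show "?d \<cdot> ?can = idn C ((X \<otimes> A) \<oplus> (X \<otimes> B))"
      using assms by simp
    show "?can \<cdot> ?d = idn C (X \<otimes> (A \<oplus> B))"
      by (rule case_arr_ext[where X = X and A = A and B = B and Z = "X \<otimes> (A \<oplus> B)"]) (use assms in simp_all)
  qed
  then have dist: "dist C X A B = ?d" unfolding dist_def by (rule inverse_arr_eqI)
  show "ends C (dist C X A B) = Some (X \<otimes> (A \<oplus> B), (X \<otimes> A) \<oplus> (X \<otimes> B))"
    unfolding dist using assms by simp
  show "cotuple C f g \<cdot> dist C X A B = ?case f g"
    unfolding dist by (rule case_arr_ext[where X = X and A = A and B = B and Z = Z]) (use assms Z in simp_all)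
qed

text \<open>A commuting conversion in which \<open>h\<close> may also use the context. For the
  generic scrutinee, the second projection of \<open>X \<otimes> (A \<oplus> B)\<close>, it follows
  from \<open>case_arr_ext\<close>; precomposing with the pair of the identity and \<open>s\<close>
  gives the general case.\<close>

lemma cmp_case_arr:
  assumes "A \<in> obj C" "B \<in> obj C"
    and "ends C s \<equiv> Some (X, A \<oplus> B)" "ends C f \<equiv> Some (X \<otimes> A, Z)" "ends C g \<equiv> Some (X \<otimes> B, Z)"
    and "ends C h \<equiv> Some (X \<otimes> Z, W)"
  shows "h \<cdot> \<langle>idn C X, case_arr A B s f g\<rangle>
    = case_arr A B s (h \<cdot> \<langle>pr1 C X A, f\<rangle>) (h \<cdot> \<langle>pr1 C X B, g\<rangle>)"
proof -
  have X: "X \<in> obj C" "Z \<in> obj C" using assms(3,4) ends_obj by (auto simp: atomize_eq)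
  let ?case = "\<lambda>f g. case_arr A B (pr2 C X (A \<oplus> B))
      (f \<cdot> \<langle>pr1 C X (A \<oplus> B) \<cdot> pr1 C (X \<otimes> (A \<oplus> B)) A, pr2 C (X \<otimes> (A \<oplus> B)) A\<rangle>)
      (g \<cdot> \<langle>pr1 C X (A \<oplus> B) \<cdot> pr1 C (X \<otimes> (A \<oplus> B)) B, pr2 C (X \<otimes> (A \<oplus> B)) B\<rangle>)"
  have eq: "h \<cdot> \<langle>pr1 C X (A \<oplus> B), ?case f g\<rangle> = ?case (h \<cdot> \<langle>pr1 C X A, f\<rangle>) (h \<cdot> \<langle>pr1 C X B, g\<rangle>)"
    by (rule case_arr_ext[where X = X and A = A and B = B and Z = W]) (use assms X in simp_all)
  have "h \<cdot> \<langle>idn C X, case_arr A B s f g\<rangle> = (h \<cdot> \<langle>pr1 C X (A \<oplus> B), ?case f g\<rangle>) \<cdot> \<langle>idn C X, s\<rangle>"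
    using assms X by simp
  also have "\<dots> = ?case (h \<cdot> \<langle>pr1 C X A, f\<rangle>) (h \<cdot> \<langle>pr1 C X B, g\<rangle>) \<cdot> \<langle>idn C X, s\<rangle>"
    by (simp only: eq)
  also have "\<dots> = case_arr A B s (h \<cdot> \<langle>pr1 C X A, f\<rangle>) (h \<cdot> \<langle>pr1 C X B, g\<rangle>)"
    using assms X by simp
  finally show ?thesis .
qed

text \<open>Lets a sum map in the scrutinee, such as \<rho> at a sum type, be absorbed into the
  branches.\<close>

lemma case_arr_sum_map [simp]:
  assumes "ends C s \<equiv> Some (X, A \<oplus> B)" "ends C p \<equiv> Some (A, A')" "ends C q \<equiv> Some (B, B')"
    and "ends C f \<equiv> Some (X \<otimes> A', Z)" "ends C g \<equiv> Some (X \<otimes> B', Z)"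
  shows "case_arr A' B' (cotuple C (in1 C A' B' \<cdot> p) (in2 C A' B' \<cdot> q) \<cdot> s) f g
    = case_arr A B s (f \<cdot> \<langle>pr1 C X A, p \<cdot> pr2 C X A\<rangle>) (g \<cdot> \<langle>pr1 C X B, q \<cdot> pr2 C X B\<rangle>)"
proof -
  have "X \<in> obj C" "Z \<in> obj C" "A \<in> obj C" "A' \<in> obj C" "B \<in> obj C" "B' \<in> obj C"
    using assms(1-4)[THEN ends_obj_dom] assms(2-4)[THEN ends_obj_cod] by simp_all
  then show ?thesis using assms by (simp add: case_arr_eq)
qed

end



section \<open>The binding operator of a strong monad\<close>

context strong_monad
begin

declare tob_obj [simp] tmap_idn [simp]

lemma ends_tmap [simp]: "ends C f \<equiv> Some (A, B) \<Longrightarrow> ends C (tmap T f) = Some (tob T A, tob T B)"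
  using tmap_hom by simp

lemma ends_unit [simp]: "A \<in> obj C \<Longrightarrow> ends C (unit T A) = Some (A, tob T A)"
  and ends_mult [simp]: "A \<in> obj C \<Longrightarrow> ends C (mult T A) = Some (tob T (tob T A), tob T A)"
  and ends_str [simp]:
    "A \<in> obj C \<Longrightarrow> B \<in> obj C \<Longrightarrow> ends C (str T A B) = Some (A \<otimes> tob T B, tob T (A \<otimes> B))"
  using unit_hom mult_hom str_hom by simp_all

lemma tmap_tmap: "ends C f \<equiv> Some (A, B) \<Longrightarrow> ends C g \<equiv> Some (B, D)
    \<Longrightarrow> tmap T g \<cdot> tmap T f = tmap T (g \<cdot> f)"
  using tmap_cmp by simp

lemma tmap_tmap_cmp:
  assumes "ends C h \<equiv> Some (Z, tob T A)" "ends C f \<equiv> Some (A, B)" "ends C g \<equiv> Some (B, D)"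
  shows "tmap T g \<cdot> tmap T f \<cdot> h = tmap T (g \<cdot> f) \<cdot> h"
proof -
  have "tmap T g \<cdot> tmap T f \<cdot> h = (tmap T g \<cdot> tmap T f) \<cdot> h" using assms by simp
  then show ?thesis using assms tmap_tmap by simp
qed

lemma tmap_unit:
  assumes "ends C v \<equiv> Some (X, A)" "ends C f \<equiv> Some (A, B)"
  shows "tmap T f \<cdot> unit T A \<cdot> v = unit T B \<cdot> f \<cdot> v"
proof -
  have "A \<in> obj C" "B \<in> obj C"
    using assms(2)[THEN ends_obj_dom] assms(2)[THEN ends_obj_cod] by simp_all
  have "tmap T f \<cdot> unit T A \<cdot> v = (tmap T f \<cdot> unit T A) \<cdot> v"
    using assms \<open>A \<in> obj C\<close> by simp
  also have "\<dots> = (unit T B \<cdot> f) \<cdot> v" using unit_natural[of f A B] assms by simp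
  also have "\<dots> = unit T B \<cdot> f \<cdot> v" using assms \<open>B \<in> obj C\<close> by simp
  finally show ?thesis .
qed

text \<open>Here \<open>f : X \<rightarrow> T A\<close> and \<open>g : X \<otimes> A \<rightarrow> T B\<close>. The simplifier turns every arrow built from the
  monad structure into binds followed by units, whose continuations see the whole context.\<close>

definition bind :: "'o \<Rightarrow> 'o \<Rightarrow> 'm \<Rightarrow> 'm \<Rightarrow> 'm" where
  "bind A B f g = mult T B \<cdot> tmap T g \<cdot> str T (src C f) A \<cdot> \<langle>idn C (src C f), f\<rangle>"

text \<open>Naturality of the strength in its first argument: the component \<open>u\<close> is
  replaced by the whole context, and the continuation applies \<open>u\<close> instead. This is the
  shape that \<open>bind\<close> requires.\<close>

lemma str_tuple:
  assumes "A \<in> obj C" "ends C u = Some (X, Z)" "ends C f = Some (X, tob T A)"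
  shows "str T Z A \<cdot> \<langle>u, f\<rangle> = tmap T \<langle>u \<cdot> pr1 C X A, pr2 C X A\<rangle> \<cdot> str T X A \<cdot> \<langle>idn C X, f\<rangle>"
proof -
  have X: "X \<in> obj C" "Z \<in> obj C" using assms ends_obj by blast+
  have "str T Z A \<cdot> \<langle>u, f\<rangle> = (str T Z A \<cdot> prod_map C u (tmap T (idn C A))) \<cdot> \<langle>idn C X, f\<rangle>"
    using assms X by simp
  also have "str T Z A \<cdot> prod_map C u (tmap T (idn C A)) = tmap T (prod_map C u (idn C A)) \<cdot> str T X A"
    by (rule str_natural) (use assms in simp_all)
  finally show ?thesis using assms X by simp
qed

lemma bind_tuple:
  assumes "A \<in> obj C" "B \<in> obj C" "ends C u = Some (X, Z)" "ends C f = Some (X, tob T A)"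
    and "ends C g = Some (Z \<otimes> A, tob T B)"
  shows "mult T B \<cdot> tmap T g \<cdot> str T Z A \<cdot> \<langle>u, f\<rangle> = bind A B f (g \<cdot> \<langle>u \<cdot> pr1 C X A, pr2 C X A\<rangle>)"
proof -
  have "X \<in> obj C" "Z \<in> obj C" using assms ends_obj by blast+
  then show ?thesis using assms
    by (simp add: bind_def str_tuple[of A u X Z f] tmap_tmap_cmp)
qed

lemma ends_bind [simp]:
  assumes "A \<in> obj C" "B \<in> obj C" "ends C f \<equiv> Some (X, tob T A)" "ends C g \<equiv> Some (X \<otimes> A, tob T B)"
  shows "ends C (bind A B f g) = Some (X, tob T B)"
proof -
  have "X \<in> obj C" using assms(3) by (rule ends_obj_dom)
  then show ?thesis using assms by (simp add: bind_def)
qed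

lemma bind_cmp [simp]:
  assumes "A \<in> obj C" "B \<in> obj C" "ends C f \<equiv> Some (X, tob T A)" "ends C g \<equiv> Some (X \<otimes> A, tob T B)"
    and "ends C h \<equiv> Some (W, X)"
  shows "bind A B f g \<cdot> h = bind A B (f \<cdot> h) (g \<cdot> \<langle>h \<cdot> pr1 C W A, pr2 C W A\<rangle>)"
proof -
  have X: "X \<in> obj C" "W \<in> obj C" using assms(3,5)[THEN ends_obj_dom] by simp_all
  have "bind A B f g \<cdot> h = mult T B \<cdot> tmap T g \<cdot> str T X A \<cdot> \<langle>h, f \<cdot> h\<rangle>"
    using assms X by (simp add: bind_def)
  then show ?thesis using assms by (simp add: bind_tuple)
qed

lemma str_unit_tuple:
  assumes "ends C u = Some (X, A)" "ends C v = Some (X, B)"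
  shows "str T A B \<cdot> \<langle>u, unit T B \<cdot> v\<rangle> = unit T (A \<otimes> B) \<cdot> \<langle>u, v\<rangle>"
proof -
  have X: "A \<in> obj C" "B \<in> obj C" using assms ends_obj by blast+
  have "str T A B \<cdot> \<langle>u, unit T B \<cdot> v\<rangle> = (str T A B \<cdot> prod_map C (idn C A) (unit T B)) \<cdot> \<langle>u, v\<rangle>"
    using assms X by simp
  also have "\<dots> = unit T (A \<otimes> B) \<cdot> \<langle>u, v\<rangle>" by (simp only: str_unit[OF X])
  finally show ?thesis .
qed

lemma mult_unit_cmp:
  assumes "A \<in> obj C" "ends C f = Some (X, tob T A)"
  shows "mult T A \<cdot> unit T (tob T A) \<cdot> f = f"
proof -
  have "mult T A \<cdot> unit T (tob T A) \<cdot> f = (mult T A \<cdot> unit T (tob T A)) \<cdot> f"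
    using assms by simp
  then show ?thesis using assms by (simp add: mult_unit)
qed

lemma mult_tmap_unit_cmp:
  assumes "A \<in> obj C" "ends C f = Some (X, tob T A)"
  shows "mult T A \<cdot> tmap T (unit T A) \<cdot> f = f"
proof -
  have "mult T A \<cdot> tmap T (unit T A) \<cdot> f = (mult T A \<cdot> tmap T (unit T A)) \<cdot> f"
    using assms by simp
  then show ?thesis using assms by (simp add: mult_tmap_unit)
qed

lemma bind_unit [simp]:
  assumes "A \<in> obj C" "B \<in> obj C" "ends C v \<equiv> Some (X, A)" "ends C g \<equiv> Some (X \<otimes> A, tob T B)"
  shows "bind A B (unit T A \<cdot> v) g = g \<cdot> \<langle>idn C X, v\<rangle>"
proof -
  have X: "X \<in> obj C" using assms(3)[THEN ends_obj_dom] assms(3)[THEN ends_obj_cod] by simp_all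
  have "bind A B (unit T A \<cdot> v) g = mult T B \<cdot> tmap T g \<cdot> unit T (X \<otimes> A) \<cdot> \<langle>idn C X, v\<rangle>"
    using assms X by (simp add: bind_def str_unit_tuple)
  also have "\<dots> = mult T B \<cdot> unit T (tob T B) \<cdot> g \<cdot> \<langle>idn C X, v\<rangle>"
    using assms X by (simp add: tmap_unit)
  also have "\<dots> = g \<cdot> \<langle>idn C X, v\<rangle>" by (rule mult_unit_cmp) (use assms X in simp_all)
  finally show ?thesis .
qed

lemma bind_unit_idn [simp]:
  "A \<in> obj C \<Longrightarrow> B \<in> obj C \<Longrightarrow> ends C g \<equiv> Some (A \<otimes> A, tob T B)
    \<Longrightarrow> bind A B (unit T A) g = g \<cdot> \<langle>idn C A, idn C A\<rangle>"
  using bind_unit[of A B "idn C A" A g] by simp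

text \<open>Inserting the identity \<open>mult \<cdot> tmap unit\<close> in front turns a bare
  strength into a bind whose continuation returns the pair.\<close>

lemma str_eq_bind [simp]:
  assumes "A \<in> obj C" "B \<in> obj C" "ends C v \<equiv> Some (X, A)" "ends C f \<equiv> Some (X, tob T B)"
  shows "str T A B \<cdot> \<langle>v, f\<rangle> = bind B (A \<otimes> B) f (unit T (A \<otimes> B) \<cdot> \<langle>v \<cdot> pr1 C X B, pr2 C X B\<rangle>)"
proof -
  have "str T A B \<cdot> \<langle>v, f\<rangle> = mult T (A \<otimes> B) \<cdot> tmap T (unit T (A \<otimes> B)) \<cdot> (str T A B \<cdot> \<langle>v, f\<rangle>)"
    by (rule mult_tmap_unit_cmp[symmetric]) (use assms in simp_all)
  also have "\<dots> = bind B (A \<otimes> B) f (unit T (A \<otimes> B) \<cdot> \<langle>v \<cdot> pr1 C X B, pr2 C X B\<rangle>)"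
    by (rule bind_tuple) (use assms in simp_all)
  finally show ?thesis .
qed

text \<open>The law that relates the strength to a projection, \<open>str_terminal\<close>, concerns
  the terminal object. The continuation ignores the context, so by \<open>bind_tuple\<close> the
  context \<open>X\<close> may be replaced by the terminal one along \<open>bang\<close>.\<close>

lemma bind_return [simp]:
  assumes "A \<in> obj C" "ends C f \<equiv> Some (X, tob T A)"
  shows "bind A A f (unit T A \<cdot> pr2 C X A) = f"
proof -
  have X: "X \<in> obj C" using assms(2)[THEN ends_obj_dom] assms(2)[THEN ends_obj_cod] by simp_all
  let ?s = "str T (terminal C) A \<cdot> \<langle>bang C X, f\<rangle>"
  have "bind A A f (unit T A \<cdot> pr2 C X A) = mult T A \<cdot> tmap T (unit T A \<cdot> pr2 C (terminal C) A) \<cdot> ?s"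
    using assms X by (subst bind_tuple[where X = X]) simp_all
  also have "\<dots> = mult T A \<cdot> tmap T (unit T A) \<cdot> (tmap T (pr2 C (terminal C) A) \<cdot> ?s)"
    using assms X by (simp add: tmap_tmap_cmp del: str_eq_bind)
  also have "tmap T (pr2 C (terminal C) A) \<cdot> ?s
      = (tmap T (pr2 C (terminal C) A) \<cdot> str T (terminal C) A) \<cdot> \<langle>bang C X, f\<rangle>"
    using assms X by (simp del: str_eq_bind)
  also have "\<dots> = f"
    using assms X by (simp add: str_terminal)
  also have "mult T A \<cdot> tmap T (unit T A) \<cdot> f = f"
    by (rule mult_tmap_unit_cmp) (use assms in simp_all)
  finally show ?thesis .
qed

text \<open>The context is needed again after \<open>A\<close> has been bound.
  \<open>str_assoc\<close> at the diagonal of \<open>X\<close> provides the second copy (1),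
  naturality moves \<open>g\<close> under the strength (2), and \<open>str_mult\<close> exchanges
  strength and multiplication (3); the rest is naturality and associativity of the
  multiplication.\<close>

lemma bind_assoc [simp]:
  assumes AB: "A \<in> obj C" "B \<in> obj C" "D \<in> obj C"
    and e: "ends C f \<equiv> Some (X, tob T A)" "ends C g \<equiv> Some (X \<otimes> A, tob T B)" "ends C h \<equiv> Some (X \<otimes> B, tob T D)"
  shows "bind B D (bind A B f g) h
    = bind A D f (bind B D g (h \<cdot> \<langle>pr1 C X A \<cdot> pr1 C (X \<otimes> A) B, pr2 C (X \<otimes> A) B\<rangle>))"
proof -
  have X: "X \<in> obj C" using e(1) by (rule ends_obj_dom)
  note [simp del] = str_eq_bind
  let ?id = "idn C X" and ?XA = "X \<otimes> A"
  let ?k = "mult T D \<cdot> tmap T h \<cdot> str T X B \<cdot> \<langle>pr1 C X A, g\<rangle>"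
  let ?f = "str T X A \<cdot> \<langle>?id, f\<rangle>"
  have 1: "str T X ?XA \<cdot> \<langle>?id, ?f\<rangle> = tmap T \<langle>pr1 C X A, idn C ?XA\<rangle> \<cdot> ?f"
  proof -
    have "str T X ?XA \<cdot> \<langle>?id, ?f\<rangle>
      = (str T X ?XA \<cdot> prod_map C ?id (str T X A) \<cdot> assoc_r C X X (tob T A)) \<cdot> \<langle>\<langle>?id, ?id\<rangle>, f\<rangle>"
      using AB e X by simp
    also have "\<dots> = (tmap T (assoc_r C X X A) \<cdot> str T (X \<otimes> X) A) \<cdot> \<langle>\<langle>?id, ?id\<rangle>, f\<rangle>"
      using AB X by (simp only: str_assoc)
    also have "\<dots> = tmap T (assoc_r C X X A) \<cdot> str T (X \<otimes> X) A \<cdot> \<langle>\<langle>?id, ?id\<rangle>, f\<rangle>"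
      using AB e X by simp
    also have "str T (X \<otimes> X) A \<cdot> \<langle>\<langle>?id, ?id\<rangle>, f\<rangle> = tmap T \<langle>\<langle>?id, ?id\<rangle> \<cdot> pr1 C X A, pr2 C X A\<rangle> \<cdot> ?f"
      by (rule str_tuple) (use AB e X in simp_all)
    finally show ?thesis using AB e X by (simp add: tmap_tmap_cmp)
  qed
  have 2: "str T X (tob T B) \<cdot> \<langle>?id, tmap T g \<cdot> ?f\<rangle> = tmap T \<langle>pr1 C X A, g\<rangle> \<cdot> ?f"
  proof -
    have "str T X (tob T B) \<cdot> \<langle>?id, tmap T g \<cdot> ?f\<rangle> = (str T X (tob T B) \<cdot> prod_map C ?id (tmap T g)) \<cdot> \<langle>?id, ?f\<rangle>"
      using AB e X by simp
    also have "str T X (tob T B) \<cdot> prod_map C ?id (tmap T g) = tmap T (prod_map C ?id g) \<cdot> str T X ?XA"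
      by (rule str_natural) (use AB e X in simp_all)
    also have "(tmap T (prod_map C ?id g) \<cdot> str T X ?XA) \<cdot> \<langle>?id, ?f\<rangle>
        = tmap T (prod_map C ?id g) \<cdot> (str T X ?XA \<cdot> \<langle>?id, ?f\<rangle>)"
      using AB e X by simp
    finally show ?thesis unfolding 1 using AB e X by (simp add: tmap_tmap_cmp)
  qed
  have "str T X B \<cdot> \<langle>?id, bind A B f g\<rangle>
      = (str T X B \<cdot> prod_map C ?id (mult T B)) \<cdot> \<langle>?id, tmap T g \<cdot> ?f\<rangle>"
    using AB e X by (simp add: bind_def)
  also have "\<dots> = (mult T (X \<otimes> B) \<cdot> tmap T (str T X B) \<cdot> str T X (tob T B)) \<cdot> \<langle>?id, tmap T g \<cdot> ?f\<rangle>"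
    using AB X by (simp only: str_mult)
  also have "\<dots> = mult T (X \<otimes> B) \<cdot> tmap T (str T X B) \<cdot> (str T X (tob T B) \<cdot> \<langle>?id, tmap T g \<cdot> ?f\<rangle>)"
    using AB e X by simp
  also have "\<dots> = mult T (X \<otimes> B) \<cdot> tmap T (str T X B \<cdot> \<langle>pr1 C X A, g\<rangle>) \<cdot> ?f"
    unfolding 2 using AB e X by (simp add: tmap_tmap_cmp)
  finally have 3: "str T X B \<cdot> \<langle>?id, bind A B f g\<rangle>
      = mult T (X \<otimes> B) \<cdot> tmap T (str T X B \<cdot> \<langle>pr1 C X A, g\<rangle>) \<cdot> ?f" .
  have "bind B D (bind A B f g) h = mult T D \<cdot> tmap T h \<cdot> (str T X B \<cdot> \<langle>?id, bind A B f g\<rangle>)"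
    using AB e X by (simp add: bind_def[of B D])
  also have "\<dots> = mult T D \<cdot> (tmap T h \<cdot> mult T (X \<otimes> B)) \<cdot> tmap T (str T X B \<cdot> \<langle>pr1 C X A, g\<rangle>) \<cdot> ?f"
    unfolding 3 using AB e X by simp
  also have "tmap T h \<cdot> mult T (X \<otimes> B) = mult T (tob T D) \<cdot> tmap T (tmap T h)"
    using mult_natural[of h "X \<otimes> B" "tob T D"] e by simp
  also have "mult T D \<cdot> (mult T (tob T D) \<cdot> tmap T (tmap T h)) \<cdot> tmap T (str T X B \<cdot> \<langle>pr1 C X A, g\<rangle>) \<cdot> ?f
      = (mult T D \<cdot> mult T (tob T D)) \<cdot> tmap T (tmap T h \<cdot> str T X B \<cdot> \<langle>pr1 C X A, g\<rangle>) \<cdot> ?f"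
    using AB e X by (simp add: tmap_tmap_cmp)
  also have "mult T D \<cdot> mult T (tob T D) = mult T D \<cdot> tmap T (mult T D)"
    using mult_mult AB by simp
  also have "(mult T D \<cdot> tmap T (mult T D)) \<cdot> tmap T (tmap T h \<cdot> str T X B \<cdot> \<langle>pr1 C X A, g\<rangle>) \<cdot> ?f = bind A D f ?k"
    using AB e X by (simp add: tmap_tmap_cmp bind_def)
  also have "?k = bind B D g (h \<cdot> \<langle>pr1 C X A \<cdot> pr1 C (X \<otimes> A) B, pr2 C (X \<otimes> A) B\<rangle>)"
    by (rule bind_tuple) (use AB e X in simp_all)
  finally show ?thesis .
qed

text \<open>Multiplication is the bind whose continuation is the computation it receives.
  \<open>bind_return\<close> first presents \<open>f\<close> as a bind, and \<open>mult_mult\<close>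
  then pushes the outer multiplication into the continuation.\<close>

lemma mult_eq_bind [simp]:
  assumes "B \<in> obj C" "ends C f \<equiv> Some (X, tob T (tob T B))"
  shows "mult T B \<cdot> f = bind (tob T B) B f (pr2 C X (tob T B))"
proof -
  have X: "X \<in> obj C" using assms(2) by (rule ends_obj_dom)
  let ?g = "unit T (tob T B) \<cdot> pr2 C X (tob T B)"
  have "mult T B \<cdot> f = mult T B \<cdot> bind (tob T B) (tob T B) f ?g" using assms by simp
  also have "\<dots> = (mult T B \<cdot> mult T (tob T B)) \<cdot> tmap T ?g \<cdot> str T X (tob T B) \<cdot> \<langle>idn C X, f\<rangle>"
    using assms X by (simp add: bind_def del: bind_return str_eq_bind)
  also have "\<dots> = (mult T B \<cdot> tmap T (mult T B)) \<cdot> tmap T ?g \<cdot> str T X (tob T B) \<cdot> \<langle>idn C X, f\<rangle>"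
    using assms by (simp only: mult_mult)
  also have "\<dots> = bind (tob T B) B f (mult T B \<cdot> unit T (tob T B) \<cdot> pr2 C X (tob T B))"
    using assms X by (simp add: bind_def tmap_tmap_cmp del: str_eq_bind)
  also have "mult T B \<cdot> unit T (tob T B) \<cdot> pr2 C X (tob T B) = pr2 C X (tob T B)"
    by (rule mult_unit_cmp) (use assms X in simp_all)
  finally show ?thesis .
qed

text \<open>Together with \<open>str_eq_bind\<close> and \<open>mult_eq_bind\<close> this leaves
  only units and binds in composites; proofs that have to work with the raw monad structure switch
  these rules off.\<close>

lemma tmap_eq_bind [simp]:
  assumes "ends C f \<equiv> Some (X, tob T A)" "ends C k \<equiv> Some (A, B)"
  shows "tmap T k \<cdot> f = bind A B f (unit T B \<cdot> k \<cdot> pr2 C X A)"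
proof -
  have X: "X \<in> obj C" using assms(1) by (rule ends_obj_dom)
  have A: "A \<in> obj C" "B \<in> obj C" using assms(2)[THEN ends_obj_dom] assms(2)[THEN ends_obj_cod] by simp_all
  have "tmap T k \<cdot> f = mult T B \<cdot> tmap T (unit T B) \<cdot> tmap T k \<cdot> f"
    by (rule mult_tmap_unit_cmp[symmetric]) (use assms A in simp_all)
  also have "\<dots> = mult T B \<cdot> tmap T (unit T B \<cdot> k) \<cdot> bind A A f (unit T A \<cdot> pr2 C X A)"
    using assms X A by (simp add: tmap_tmap_cmp del: mult_eq_bind)
  also have "\<dots> = mult T B \<cdot> (tmap T (unit T B \<cdot> k) \<cdot> mult T A) \<cdot> tmap T (unit T A \<cdot> pr2 C X A) \<cdot> str T X A \<cdot> \<langle>idn C X, f\<rangle>"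
    using assms X A by (simp add: bind_def del: bind_return str_eq_bind mult_eq_bind)
  also have "tmap T (unit T B \<cdot> k) \<cdot> mult T A = mult T (tob T B) \<cdot> tmap T (tmap T (unit T B \<cdot> k))"
    using mult_natural[of "unit T B \<cdot> k" A "tob T B"] assms A by simp
  also have "mult T B \<cdot> (mult T (tob T B) \<cdot> tmap T (tmap T (unit T B \<cdot> k))) \<cdot> tmap T (unit T A \<cdot> pr2 C X A) \<cdot> str T X A \<cdot> \<langle>idn C X, f\<rangle>
    = (mult T B \<cdot> mult T (tob T B)) \<cdot> tmap T (tmap T (unit T B \<cdot> k)) \<cdot> tmap T (unit T A \<cdot> pr2 C X A) \<cdot> str T X A \<cdot> \<langle>idn C X, f\<rangle>"
    using assms X A by (simp del: mult_eq_bind str_eq_bind)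
  also have "\<dots> = (mult T B \<cdot> tmap T (mult T B)) \<cdot> tmap T (tmap T (unit T B \<cdot> k)) \<cdot> tmap T (unit T A \<cdot> pr2 C X A) \<cdot> str T X A \<cdot> \<langle>idn C X, f\<rangle>"
    using A by (simp only: mult_mult)
  also have "\<dots> = mult T B \<cdot> tmap T (mult T B \<cdot> tmap T (unit T B \<cdot> k) \<cdot> unit T A \<cdot> pr2 C X A) \<cdot> str T X A \<cdot> \<langle>idn C X, f\<rangle>"
    using assms X A by (simp add: tmap_tmap_cmp del: mult_eq_bind str_eq_bind)
  also have "tmap T (unit T B \<cdot> k) \<cdot> unit T A \<cdot> pr2 C X A = unit T (tob T B) \<cdot> unit T B \<cdot> k \<cdot> pr2 C X A"
    using assms X A by (simp add: tmap_unit)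
  also have "mult T B \<cdot> unit T (tob T B) \<cdot> unit T B \<cdot> k \<cdot> pr2 C X A = unit T B \<cdot> k \<cdot> pr2 C X A"
    by (rule mult_unit_cmp) (use assms X A in simp_all)
  finally show ?thesis using assms X A by (simp add: bind_def del: str_eq_bind mult_eq_bind)
qed

text \<open>A bind postcomposes the pair of context and computation with the arrow
  \<open>?k\<close>, so this is an instance of \<open>cmp_case_arr\<close>.\<close>

lemma bind_case_arr [simp]:
  assumes "A \<in> obj C" "B \<in> obj C" "D \<in> obj C" "E \<in> obj C"
    and "ends C s \<equiv> Some (X, A \<oplus> B)" "ends C f \<equiv> Some (X \<otimes> A, tob T D)"
    and "ends C g \<equiv> Some (X \<otimes> B, tob T D)" "ends C h \<equiv> Some (X \<otimes> D, tob T E)"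
  shows "bind D E (case_arr A B s f g) h = case_arr A B s
     (bind D E f (h \<cdot> \<langle>pr1 C X A \<cdot> pr1 C (X \<otimes> A) D, pr2 C (X \<otimes> A) D\<rangle>))
     (bind D E g (h \<cdot> \<langle>pr1 C X B \<cdot> pr1 C (X \<otimes> B) D, pr2 C (X \<otimes> B) D\<rangle>))"
proof -
  have X: "X \<in> obj C" using assms(5) by (rule ends_obj_dom)
  let ?k = "mult T E \<cdot> tmap T h \<cdot> str T X D"
  note [simp del] = str_eq_bind mult_eq_bind tmap_eq_bind
  have "bind D E (case_arr A B s f g) h = ?k \<cdot> \<langle>idn C X, case_arr A B s f g\<rangle>"
    using assms X by (simp add: bind_def)
  also have "\<dots> = case_arr A B s (?k \<cdot> \<langle>pr1 C X A, f\<rangle>) (?k \<cdot> \<langle>pr1 C X B, g\<rangle>)"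
    by (rule cmp_case_arr) (use assms X in simp_all)
  also have "?k \<cdot> \<langle>pr1 C X A, f\<rangle> = bind D E f (h \<cdot> \<langle>pr1 C X A \<cdot> pr1 C (X \<otimes> A) D, pr2 C (X \<otimes> A) D\<rangle>)"
    using bind_tuple[of D E "pr1 C X A" _ X f h] assms X by simp
  also have "?k \<cdot> \<langle>pr1 C X B, g\<rangle> = bind D E g (h \<cdot> \<langle>pr1 C X B \<cdot> pr1 C (X \<otimes> B) D, pr2 C (X \<otimes> B) D\<rangle>)"
    using bind_tuple[of D E "pr1 C X B" _ X g h] assms X by simp
  finally show ?thesis .
qed

lemma rstr_tuple [simp]:
  assumes "A \<in> obj C" "B \<in> obj C" "ends C f \<equiv> Some (X, tob T A)" "ends C g \<equiv> Some (X, B)"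
  shows "rstr C T A B \<cdot> \<langle>f, g\<rangle> = bind A (A \<otimes> B) f (unit T (A \<otimes> B) \<cdot> \<langle>pr2 C X A, g \<cdot> pr1 C X A\<rangle>)"
proof -
  have X: "X \<in> obj C" using assms(3) by (rule ends_obj_dom)
  then show ?thesis using assms by (simp add: rstr_def)
qed

end



section \<open>Call-by-value semantics in terms of binding\<close>

text \<open>The device of \<open>ends\<close> applied to typing: a premise with \<open>infer\<close>
  on the left of \<open>\<equiv>\<close> is solved by evaluation, which finds the types that do not
  occur in the term being rewritten.\<close>

definition infer :: "('b, 'k, 'e) signature \<Rightarrow> 'b ctx \<Rightarrow> ('b, 'k, 'e) tm \<Rightarrow> 'b ty option" where
  "infer \<Sigma> \<Gamma> M = (if \<exists>t. typing \<Sigma> \<Gamma> M t then Some (type_of \<Sigma> \<Gamma> M) else None)"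

lemma infer_iff: "infer \<Sigma> \<Gamma> M = Some t \<longleftrightarrow> typing \<Sigma> \<Gamma> M t"
  unfolding infer_def using typing_type_of by auto

lemma type_of_infer [simp]: "infer \<Sigma> \<Gamma> M \<equiv> Some t \<Longrightarrow> type_of \<Sigma> \<Gamma> M = t"
  using infer_iff typing_type_of by (metis atomize_eq)

lemma infer_Var [simp]:
  "(\<forall>s \<in> set \<Gamma>. wf_ty \<Sigma> s) \<Longrightarrow> i < length \<Gamma> \<Longrightarrow> infer \<Sigma> \<Gamma> (Var i) = Some (\<Gamma> ! i)"
  by (simp add: infer_iff t_Var)

lemma infer_Unit [simp]: "(\<forall>s \<in> set \<Gamma>. wf_ty \<Sigma> s) \<Longrightarrow> infer \<Sigma> \<Gamma> Unit = Some TUnit"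
  by (simp add: infer_iff t_Unit)

lemma infer_Const [simp]: "c \<in> constants \<Sigma> \<Longrightarrow> infer \<Sigma> \<Gamma> M \<equiv> Some (ar \<Sigma> (Inl c))
    \<Longrightarrow> infer \<Sigma> \<Gamma> (Const c M) = Some (car \<Sigma> (Inl c))"
  and infer_Effect [simp]: "e \<in> effects \<Sigma> \<Longrightarrow> infer \<Sigma> \<Gamma> M \<equiv> Some (ar \<Sigma> (Inr e))
    \<Longrightarrow> infer \<Sigma> \<Gamma> (Effect e M) = Some (car \<Sigma> (Inr e))"
  and infer_Pair [simp]: "infer \<Sigma> \<Gamma> M \<equiv> Some t1 \<Longrightarrow> infer \<Sigma> \<Gamma> N \<equiv> Some t2
    \<Longrightarrow> infer \<Sigma> \<Gamma> (Pair M N) = Some (TProd t1 t2)"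
  and infer_Proj1 [simp]: "infer \<Sigma> \<Gamma> M \<equiv> Some (TProd t1 t2) \<Longrightarrow> infer \<Sigma> \<Gamma> (Proj1 M) = Some t1"
  and infer_Proj2 [simp]: "infer \<Sigma> \<Gamma> M \<equiv> Some (TProd t1 t2) \<Longrightarrow> infer \<Sigma> \<Gamma> (Proj2 M) = Some t2"
  and infer_Abort [simp]: "wf_ty \<Sigma> t \<Longrightarrow> infer \<Sigma> \<Gamma> M \<equiv> Some TZero \<Longrightarrow> infer \<Sigma> \<Gamma> (Abort t M) = Some t"
  and infer_Inj1 [simp]: "wf_ty \<Sigma> t2 \<Longrightarrow> infer \<Sigma> \<Gamma> M \<equiv> Some t1
    \<Longrightarrow> infer \<Sigma> \<Gamma> (Inj1 t2 M) = Some (TSum t1 t2)"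
  and infer_Inj2 [simp]: "wf_ty \<Sigma> t1 \<Longrightarrow> infer \<Sigma> \<Gamma> M \<equiv> Some t2
    \<Longrightarrow> infer \<Sigma> \<Gamma> (Inj2 t1 M) = Some (TSum t1 t2)"
  and infer_Case [simp]: "infer \<Sigma> \<Gamma> M \<equiv> Some (TSum t1 t2) \<Longrightarrow> infer \<Sigma> (t1 # \<Gamma>) N1 \<equiv> Some t
    \<Longrightarrow> infer \<Sigma> (t2 # \<Gamma>) N2 \<equiv> Some t \<Longrightarrow> infer \<Sigma> \<Gamma> (Case M t1 N1 t2 N2) = Some t"
  and infer_Lam [simp]: "infer \<Sigma> (t1 # \<Gamma>) M \<equiv> Some t2 \<Longrightarrow> infer \<Sigma> \<Gamma> (Lam t1 M) = Some (TFun t1 t2)"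
  and infer_App [simp]: "infer \<Sigma> \<Gamma> M \<equiv> Some (TFun t1 t2) \<Longrightarrow> infer \<Sigma> \<Gamma> N \<equiv> Some t1
    \<Longrightarrow> infer \<Sigma> \<Gamma> (App M N) = Some t2"
  unfolding atomize_eq infer_iff by (rule typing.intros; assumption)+

lemma wf_ty_simps [simp]:
  "wf_ty \<Sigma> TUnit" "wf_ty \<Sigma> TZero"
  "wf_ty \<Sigma> (TProd t1 t2) \<longleftrightarrow> wf_ty \<Sigma> t1 \<and> wf_ty \<Sigma> t2"
  "wf_ty \<Sigma> (TSum t1 t2) \<longleftrightarrow> wf_ty \<Sigma> t1 \<and> wf_ty \<Sigma> t2"
  "wf_ty \<Sigma> (TFun t1 t2) \<longleftrightarrow> wf_ty \<Sigma> t1 \<and> wf_ty \<Sigma> t2"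
  by (simp_all add: wf_ty_def)

lemma typing_wf:
  assumes "wf_signature \<Sigma>" and "typing \<Sigma> \<Gamma> M t"
  shows "(\<forall>s \<in> set \<Gamma>. wf_ty \<Sigma> s) \<and> wf_ty \<Sigma> t"
  using assms(2)
proof induction
  case (t_Const c \<Gamma> M)
  then show ?case using assms(1) unfolding wf_signature_def by blast
next
  case (t_Effect e \<Gamma> M)
  then show ?case using assms(1) unfolding wf_signature_def by blast
qed auto

text \<open>Covers source and target alike, so semantics and substitution are treated once.
  \<open>C\<close> and \<open>T\<close> are parameters, tied to the structure by equations, so that
  the rules of \<open>strong_monad\<close> apply to interpretations directly.\<close>

locale lc_model = strong_monad C T
  for C :: "('o, 'm) bicc" (structure) and T :: "('o, 'm) monad" +
  fixes \<Sigma> :: "('b, 'k, 'e) signature" and \<A> :: "('o, 'm, 'b, 'k, 'e) lc_struct"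
  assumes cat_model [simp]: "cat \<A> = C" and mon_model [simp]: "mon \<A> = T"
    and wf_sig: "wf_signature \<Sigma>"
    and base_obj: "b \<in> bases \<Sigma> \<Longrightarrow> base_ob \<A> b \<in> obj C"
    and ends_const [simp]: "c \<in> constants \<Sigma>
      \<Longrightarrow> ends C (op_arr \<A> (Inl c)) = Some (ty_ob \<A> (ar \<Sigma> (Inl c)), ty_ob \<A> (car \<Sigma> (Inl c)))"
    and ends_effect [simp]: "e \<in> effects \<Sigma>
      \<Longrightarrow> ends C (op_arr \<A> (Inr e)) = Some (ty_ob \<A> (ar \<Sigma> (Inr e)), tob T (ty_ob \<A> (car \<Sigma> (Inr e))))"
begin

lemma ty_ob_obj [simp]: "wf_ty \<Sigma> t \<Longrightarrow> ty_ob \<A> t \<in> obj C"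
proof (induction t)
  case (TBase b)
  then show ?case by (simp add: wf_ty_def base_obj)
qed simp_all

lemma wf_ctx_ty [simp]: "wf_ty \<Sigma> (ctx_ty \<Gamma>) \<longleftrightarrow> (\<forall>s \<in> set \<Gamma>. wf_ty \<Sigma> s)"
  by (induction \<Gamma>) auto

lemma infer_wf:
  assumes "infer \<Sigma> \<Gamma> M = Some t"
  shows "\<forall>s \<in> set \<Gamma>. wf_ty \<Sigma> s" "wf_ty \<Sigma> t"
  using assms typing_wf[OF wf_sig] infer_iff by blast+

lemma op_wf:
  "c \<in> constants \<Sigma> \<Longrightarrow> wf_ty \<Sigma> (ar \<Sigma> (Inl c)) \<and> wf_ty \<Sigma> (car \<Sigma> (Inl c))"
  "e \<in> effects \<Sigma> \<Longrightarrow> wf_ty \<Sigma> (ar \<Sigma> (Inr e)) \<and> wf_ty \<Sigma> (car \<Sigma> (Inr e))"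
  using wf_sig unfolding wf_signature_def by blast+

lemma ends_var_pr [simp]:
  "i < length \<Gamma> \<Longrightarrow> (\<forall>s \<in> set \<Gamma>. wf_ty \<Sigma> s)
    \<Longrightarrow> ends C (var_pr \<A> \<Gamma> i) = Some (ctx_ob \<A> \<Gamma>, ty_ob \<A> (\<Gamma> ! i))"
proof (induction \<Gamma> arbitrary: i)
  case (Cons s \<Gamma>)
  then show ?case by (cases i) simp_all
qed simp

declare sem.simps [simp del]

lemmas sem_Var = sem.simps(1)
  and sem_Const = sem.simps(2)
  and sem_Effect = sem.simps(3)
  and sem_Unit = sem.simps(4)
  and sem_Abort = sem.simps(8)

lemma ends_sem [simp]:
  assumes "infer \<Sigma> \<Gamma> M \<equiv> Some t"
  shows "ends C (sem \<Sigma> \<A> \<Gamma> M) = Some (ctx_ob \<A> \<Gamma>, tob T (ty_ob \<A> t))"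
proof -
  have "typing \<Sigma> \<Gamma> M t" using assms infer_iff[of \<Sigma> \<Gamma> M t] by simp
  then show ?thesis
  proof induction
    case (t_Const c \<Gamma> M)
    then show ?case using op_wf typing_wf[OF wf_sig t_Const.hyps(2)] by (simp add: sem.simps)
  next
    case (t_Effect e \<Gamma> M)
    then show ?case using op_wf typing_wf[OF wf_sig t_Effect.hyps(2)] by (simp add: sem.simps)
  next
    case (t_Case \<Gamma> M t1 t2 N1 t N2)
    note wf = t_Case.hyps[THEN typing_wf[OF wf_sig]]
    then show ?case using t_Case by (simp add: sem.simps cotuple_dist typing_type_of Let_def)
  next
    case (t_App \<Gamma> M t1 t2 N)
    then show ?case using t_App.hyps[THEN typing_wf[OF wf_sig]] by (simp add: sem.simps typing_type_of Let_def)
  next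
    case (t_Pair \<Gamma> M t1 N t2)
    then show ?case using t_Pair.hyps[THEN typing_wf[OF wf_sig]] by (simp add: sem.simps typing_type_of Let_def)
  next
    case (t_Lam t1 \<Gamma> M t2)
    then show ?case using t_Lam.hyps[THEN typing_wf[OF wf_sig]] by (simp add: sem.simps typing_type_of Let_def)
  next
    case (t_Abort t \<Gamma> M)
    then show ?case using typing_wf[OF wf_sig t_Abort.hyps(2)] by (simp add: sem.simps)
  next
    case (t_Proj1 \<Gamma> M t1 t2)
    then show ?case using t_Proj1.hyps[THEN typing_wf[OF wf_sig]] by (simp add: sem.simps typing_type_of Let_def)
  next
    case (t_Proj2 \<Gamma> M t1 t2)
    then show ?case using t_Proj2.hyps[THEN typing_wf[OF wf_sig]] by (simp add: sem.simps typing_type_of Let_def)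
  next
    case (t_Inj1 t2 \<Gamma> M t1)
    then show ?case using t_Inj1.hyps(2)[THEN typing_wf[OF wf_sig]] by (simp add: sem.simps typing_type_of Let_def)
  next
    case (t_Inj2 t1 \<Gamma> M t2)
    then show ?case using t_Inj2.hyps(2)[THEN typing_wf[OF wf_sig]] by (simp add: sem.simps typing_type_of Let_def)
  qed (simp_all add: sem.simps typing_type_of Let_def)
qed

text \<open>These clauses replace \<open>sem.simps\<close>: types come from \<open>infer\<close>
  rather than \<open>type_of\<close>, and the strengths of the pairing, application and case clauses
  are already normalised to binds.\<close>

lemma sem_Pair:
  assumes "infer \<Sigma> \<Gamma> M \<equiv> Some t1" "infer \<Sigma> \<Gamma> N \<equiv> Some t2"
  shows "sem \<Sigma> \<A> \<Gamma> (Pair M N) = (let X = ctx_ob \<A> \<Gamma>; A = ty_ob \<A> t1; B = ty_ob \<A> t2 in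
    bind A (A \<otimes> B) (sem \<Sigma> \<A> \<Gamma> M) (bind B (A \<otimes> B) (sem \<Sigma> \<A> \<Gamma> N \<cdot> pr1 C X A)
      (unit T (A \<otimes> B) \<cdot> \<langle>pr2 C X A \<cdot> pr1 C (X \<otimes> A) B, pr2 C (X \<otimes> A) B\<rangle>)))"
  using assms assms[THEN meta_eq_to_obj_eq, THEN infer_wf(2)] infer_wf(1)[OF assms(1)[THEN meta_eq_to_obj_eq]]
  by (simp add: sem.simps Let_def)

lemma sem_Proj:
  assumes "infer \<Sigma> \<Gamma> M \<equiv> Some (TProd t1 t2)"
  shows "sem \<Sigma> \<A> \<Gamma> (Proj1 M) = tmap T (pr1 C (ty_ob \<A> t1) (ty_ob \<A> t2)) \<cdot> sem \<Sigma> \<A> \<Gamma> M"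
    and "sem \<Sigma> \<A> \<Gamma> (Proj2 M) = tmap T (pr2 C (ty_ob \<A> t1) (ty_ob \<A> t2)) \<cdot> sem \<Sigma> \<A> \<Gamma> M"
  using assms by (simp_all add: sem.simps del: tmap_eq_bind)

lemma sem_Inj:
  assumes "infer \<Sigma> \<Gamma> M \<equiv> Some t"
  shows "sem \<Sigma> \<A> \<Gamma> (Inj1 t2 M) = tmap T (in1 C (ty_ob \<A> t) (ty_ob \<A> t2)) \<cdot> sem \<Sigma> \<A> \<Gamma> M"
    and "sem \<Sigma> \<A> \<Gamma> (Inj2 t1 M) = tmap T (in2 C (ty_ob \<A> t1) (ty_ob \<A> t)) \<cdot> sem \<Sigma> \<A> \<Gamma> M"
  using assms by (simp_all add: sem.simps del: tmap_eq_bind)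

lemma sem_Lam:
  assumes "infer \<Sigma> (t1 # \<Gamma>) M \<equiv> Some t2"
  shows "sem \<Sigma> \<A> \<Gamma> (Lam t1 M) = unit T (expo C (tob T (ty_ob \<A> t2)) (ty_ob \<A> t1))
    \<cdot> curr C (ctx_ob \<A> \<Gamma>) (ty_ob \<A> t1) (sem \<Sigma> \<A> (t1 # \<Gamma>) M)"
  using assms by (simp add: sem.simps)

lemma sem_App:
  assumes "infer \<Sigma> \<Gamma> M \<equiv> Some (TFun t1 t2)" "infer \<Sigma> \<Gamma> N \<equiv> Some t1"
  shows "sem \<Sigma> \<A> \<Gamma> (App M N)
    = (let X = ctx_ob \<A> \<Gamma>; A = ty_ob \<A> t1; B = ty_ob \<A> t2; F = expo C (tob T B) A in
      bind F B (sem \<Sigma> \<A> \<Gamma> M) (bind A B (sem \<Sigma> \<A> \<Gamma> N \<cdot> pr1 C X F)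
        (ev C (tob T B) A \<cdot> \<langle>pr2 C X F \<cdot> pr1 C (X \<otimes> F) A, pr2 C (X \<otimes> F) A\<rangle>)))"
  using assms assms[THEN meta_eq_to_obj_eq, THEN infer_wf(2)] infer_wf(1)[OF assms(1)[THEN meta_eq_to_obj_eq]]
  by (simp add: sem.simps Let_def)

lemma sem_Case:
  assumes "infer \<Sigma> \<Gamma> M \<equiv> Some (TSum t1 t2)"
    and "infer \<Sigma> (t1 # \<Gamma>) N1 \<equiv> Some t" "infer \<Sigma> (t2 # \<Gamma>) N2 \<equiv> Some t"
  shows "sem \<Sigma> \<A> \<Gamma> (Case M t1 N1 t2 N2)
    = (let X = ctx_ob \<A> \<Gamma>; A = ty_ob \<A> t1; B = ty_ob \<A> t2 in
      bind (A \<oplus> B) (ty_ob \<A> t) (sem \<Sigma> \<A> \<Gamma> M) (case_arr A B (pr2 C X (A \<oplus> B))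
        (sem \<Sigma> \<A> (t1 # \<Gamma>) N1 \<cdot> \<langle>pr1 C X (A \<oplus> B) \<cdot> pr1 C (X \<otimes> (A \<oplus> B)) A, pr2 C (X \<otimes> (A \<oplus> B)) A\<rangle>)
        (sem \<Sigma> \<A> (t2 # \<Gamma>) N2 \<cdot> \<langle>pr1 C X (A \<oplus> B) \<cdot> pr1 C (X \<otimes> (A \<oplus> B)) B, pr2 C (X \<otimes> (A \<oplus> B)) B\<rangle>)))"
  using assms assms[THEN meta_eq_to_obj_eq, THEN infer_wf(2)] infer_wf(1)[OF assms(1)[THEN meta_eq_to_obj_eq]]
  by (simp add: sem.simps Let_def cotuple_dist)

lemmas sem_simps = sem_Var sem_Const sem_Effect sem_Unit sem_Pair sem_Proj sem_Abort sem_Inj sem_Lam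
  sem_App sem_Case Let_def


section \<open>Substitution of values\<close>

text \<open>Says that \<open>h\<close> represents \<open>s\<close>. The terms \<open>s i\<close>
  need not be variables or values in form: their denotation has to factor through the unit, which
  holds for the projections used in \<open>split_z\<close>.\<close>

definition subst_arr :: "'b ctx \<Rightarrow> 'b ctx \<Rightarrow> (nat \<Rightarrow> ('b, 'k, 'e) tm) \<Rightarrow> 'm \<Rightarrow> bool" where
  "subst_arr \<Gamma> \<Delta> s h \<longleftrightarrow> ends C h = Some (ctx_ob \<A> \<Delta>, ctx_ob \<A> \<Gamma>)
    \<and> (\<forall>t \<in> set \<Gamma>. wf_ty \<Sigma> t) \<and> (\<forall>t \<in> set \<Delta>. wf_ty \<Sigma> t)
    \<and> (\<forall>i < length \<Gamma>. infer \<Sigma> \<Delta> (s i) = Some (\<Gamma> ! i)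
      \<and> sem \<Sigma> \<A> \<Delta> (s i) = unit T (ty_ob \<A> (\<Gamma> ! i)) \<cdot> var_pr \<A> \<Gamma> i \<cdot> h)"

text \<open>Lifting a substitution renames its terms, and renaming is itself a substitution. The
  parameter \<open>R\<close> lets one induction serve both for renamings and for general substitutions.\<close>

lemma sem_subst_closed:
  assumes sub: "\<And>\<Gamma> \<Delta> s h. R \<Gamma> \<Delta> s h \<Longrightarrow> subst_arr \<Gamma> \<Delta> s h"
    and lift: "\<And>\<Gamma> \<Delta> s h t. R \<Gamma> \<Delta> s h \<Longrightarrow> wf_ty \<Sigma> t \<Longrightarrow> R (t # \<Gamma>) (t # \<Delta>) (lift_sub s)
      \<langle>h \<cdot> pr1 C (ctx_ob \<A> \<Delta>) (ty_ob \<A> t), pr2 C (ctx_ob \<A> \<Delta>) (ty_ob \<A> t)\<rangle>"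
  shows "typing \<Sigma> \<Gamma> M t \<Longrightarrow> R \<Gamma> \<Delta> s h
    \<Longrightarrow> infer \<Sigma> \<Delta> (subst s M) = Some t \<and> sem \<Sigma> \<A> \<Delta> (subst s M) = sem \<Sigma> \<A> \<Gamma> M \<cdot> h"
proof (induction arbitrary: \<Delta> s h rule: typing.induct)
  case (t_Var \<Gamma> i)
  then show ?case using sub[OF t_Var(3)] by (simp add: subst_arr_def sem_Var)
next
  case (t_Const c \<Gamma> M)
  have "infer \<Sigma> \<Gamma> M = Some (ar \<Sigma> (Inl c))" using t_Const by (simp add: infer_iff)
  then show ?case using t_Const.IH[OF t_Const.prems] sub[OF t_Const.prems] t_Const.hyps op_wf(1)[of c]
      infer_wf[of \<Gamma> M]
    by (simp add: subst_arr_def sem_simps)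
next
  case (t_Effect e \<Gamma> M)
  have "infer \<Sigma> \<Gamma> M = Some (ar \<Sigma> (Inr e))" using t_Effect by (simp add: infer_iff)
  then show ?case using t_Effect.IH[OF t_Effect.prems] sub[OF t_Effect.prems] t_Effect.hyps op_wf(2)[of e]
      infer_wf[of \<Gamma> M]
    by (simp add: subst_arr_def sem_simps)
next
  case (t_Unit \<Gamma>)
  then show ?case using sub[OF t_Unit(2)] by (simp add: subst_arr_def sem_simps)
next
  case (t_Pair \<Gamma> M t1 N t2)
  have "infer \<Sigma> \<Gamma> M = Some t1" "infer \<Sigma> \<Gamma> N = Some t2" using t_Pair by (simp_all add: infer_iff)
  then show ?case using t_Pair.IH(1)[OF t_Pair.prems] t_Pair.IH(2)[OF t_Pair.prems] sub[OF t_Pair.prems]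
      infer_wf[of \<Gamma> M] infer_wf[of \<Gamma> N]
    by (simp add: subst_arr_def sem_simps)
next
  case (t_Proj1 \<Gamma> M t1 t2)
  have "infer \<Sigma> \<Gamma> M = Some (TProd t1 t2)" using t_Proj1 by (simp add: infer_iff)
  then show ?case using t_Proj1.IH[OF t_Proj1.prems] sub[OF t_Proj1.prems] infer_wf[of \<Gamma> M]
    by (simp add: subst_arr_def sem_simps)
next
  case (t_Proj2 \<Gamma> M t1 t2)
  have "infer \<Sigma> \<Gamma> M = Some (TProd t1 t2)" using t_Proj2 by (simp add: infer_iff)
  then show ?case using t_Proj2.IH[OF t_Proj2.prems] sub[OF t_Proj2.prems] infer_wf[of \<Gamma> M]
    by (simp add: subst_arr_def sem_simps)
next
  case (t_Abort t \<Gamma> M)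
  have "infer \<Sigma> \<Gamma> M = Some TZero" using t_Abort by (simp add: infer_iff)
  then show ?case using t_Abort.IH[OF t_Abort.prems] sub[OF t_Abort.prems] infer_wf[of \<Gamma> M] t_Abort.hyps
    by (simp add: subst_arr_def sem_simps)
next
  case (t_Inj1 t2 \<Gamma> M t1)
  have "infer \<Sigma> \<Gamma> M = Some t1" using t_Inj1 by (simp add: infer_iff)
  then show ?case using t_Inj1.IH[OF t_Inj1.prems] sub[OF t_Inj1.prems] infer_wf[of \<Gamma> M] t_Inj1.hyps
    by (simp add: subst_arr_def sem_simps)
next
  case (t_Inj2 t1 \<Gamma> M t2)
  have "infer \<Sigma> \<Gamma> M = Some t2" using t_Inj2 by (simp add: infer_iff)
  then show ?case using t_Inj2.IH[OF t_Inj2.prems] sub[OF t_Inj2.prems] infer_wf[of \<Gamma> M] t_Inj2.hyps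
    by (simp add: subst_arr_def sem_simps)
next
  case (t_Case \<Gamma> M t1 t2 N1 t N2)
  have i: "infer \<Sigma> \<Gamma> M = Some (TSum t1 t2)" "infer \<Sigma> (t1 # \<Gamma>) N1 = Some t" "infer \<Sigma> (t2 # \<Gamma>) N2 = Some t"
    using t_Case by (simp_all add: infer_iff)
  then have wf: "wf_ty \<Sigma> t1" "wf_ty \<Sigma> t2" "wf_ty \<Sigma> t" "\<forall>s \<in> set \<Gamma>. wf_ty \<Sigma> s"
    using infer_wf[of \<Gamma> M] infer_wf[of _ N1] by simp_all
  show ?case
    using i wf t_Case.IH(1)[OF t_Case.prems] t_Case.IH(2)[OF lift[OF t_Case.prems wf(1)]]
      t_Case.IH(3)[OF lift[OF t_Case.prems wf(2)]] sub[OF t_Case.prems]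
    by (simp add: subst_arr_def sem_simps)
next
  case (t_Lam t1 \<Gamma> M t2)
  have i: "infer \<Sigma> (t1 # \<Gamma>) M = Some t2" using t_Lam by (simp_all add: infer_iff)
  then have wf: "wf_ty \<Sigma> t1" "wf_ty \<Sigma> t2" "\<forall>s \<in> set \<Gamma>. wf_ty \<Sigma> s"
    using infer_wf[of _ M] by simp_all
  show ?case
    using i wf t_Lam.IH[OF lift[OF t_Lam.prems wf(1)]] sub[OF t_Lam.prems]
    by (simp add: subst_arr_def sem_simps)
next
  case (t_App \<Gamma> M t1 t2 N)
  have "infer \<Sigma> \<Gamma> M = Some (TFun t1 t2)" "infer \<Sigma> \<Gamma> N = Some t1" using t_App by (simp_all add: infer_iff)
  then show ?case using t_App.IH(1)[OF t_App.prems] t_App.IH(2)[OF t_App.prems] sub[OF t_App.prems]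
      infer_wf[of \<Gamma> M] infer_wf[of \<Gamma> N]
    by (simp add: subst_arr_def sem_simps)
qed

lemma lift_sub_Var: "lift_sub (\<lambda>i. Var (r i)) = (\<lambda>i. Var (lift_ren r i))"
  by (auto simp: lift_sub_def lift_ren_def split: nat.split)

lemma rename_eq_subst: "rename r M = subst (\<lambda>i. Var (r i)) M"
  by (induction M arbitrary: r) (simp_all add: lift_sub_Var)

lemma sem_rename:
  assumes "infer \<Sigma> \<Gamma> M = Some t" and "ends C h = Some (ctx_ob \<A> \<Delta>, ctx_ob \<A> \<Gamma>)"
    and "\<forall>t \<in> set \<Delta>. wf_ty \<Sigma> t"
    and "\<And>i. i < length \<Gamma> \<Longrightarrow> r i < length \<Delta> \<and> \<Delta> ! r i = \<Gamma> ! i \<and> var_pr \<A> \<Delta> (r i) = var_pr \<A> \<Gamma> i \<cdot> h"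
  shows "infer \<Sigma> \<Delta> (rename r M) = Some t" "sem \<Sigma> \<A> \<Delta> (rename r M) = sem \<Sigma> \<A> \<Gamma> M \<cdot> h"
proof -
  \<comment> \<open>\<open>R\<close> records that the substitution consists of variables. By
    \<open>lift_sub_Var\<close> this survives lifting, so nothing about the semantics of renaming is
    presupposed.\<close>
  define R where "R \<Gamma> \<Delta> s h \<longleftrightarrow> ends C h = Some (ctx_ob \<A> \<Delta>, ctx_ob \<A> \<Gamma>)
    \<and> (\<forall>t \<in> set \<Gamma>. wf_ty \<Sigma> t) \<and> (\<forall>t \<in> set \<Delta>. wf_ty \<Sigma> t)
    \<and> (\<exists>r. s = (\<lambda>i. Var (r i)) \<and> (\<forall>i < length \<Gamma>. r i < length \<Delta> \<and> \<Delta> ! r i = \<Gamma> ! i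
      \<and> var_pr \<A> \<Delta> (r i) = var_pr \<A> \<Gamma> i \<cdot> h))" for \<Gamma> \<Delta> and s :: "nat \<Rightarrow> ('b, 'k, 'e) tm" and h
  have sub: "subst_arr \<Gamma> \<Delta> s h" if "R \<Gamma> \<Delta> s h" for \<Gamma> \<Delta> s h
    using that by (auto simp: R_def subst_arr_def sem_Var)
  have lift: "R (t # \<Gamma>) (t # \<Delta>) (lift_sub s) \<langle>h \<cdot> pr1 C (ctx_ob \<A> \<Delta>) (ty_ob \<A> t), pr2 C (ctx_ob \<A> \<Delta>) (ty_ob \<A> t)\<rangle>"
    if R: "R \<Gamma> \<Delta> s h" and "wf_ty \<Sigma> t" for \<Gamma> \<Delta> s h t
  proof -
    from R obtain r where h: "ends C h = Some (ctx_ob \<A> \<Delta>, ctx_ob \<A> \<Gamma>)" "\<forall>t \<in> set \<Gamma>. wf_ty \<Sigma> t" "\<forall>t \<in> set \<Delta>. wf_ty \<Sigma> t"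
      and s: "s = (\<lambda>i. Var (r i))"
      and r: "\<And>i. i < length \<Gamma> \<Longrightarrow> r i < length \<Delta> \<and> \<Delta> ! r i = \<Gamma> ! i \<and> var_pr \<A> \<Delta> (r i) = var_pr \<A> \<Gamma> i \<cdot> h"
      unfolding R_def by blast
    have obj: "ctx_ob \<A> \<Gamma> \<in> obj C" "ctx_ob \<A> \<Delta> \<in> obj C" using h(1) ends_obj by blast+
    have "lift_ren r i < length (t # \<Delta>) \<and> (t # \<Delta>) ! lift_ren r i = (t # \<Gamma>) ! i
      \<and> var_pr \<A> (t # \<Delta>) (lift_ren r i) = var_pr \<A> (t # \<Gamma>) i
        \<cdot> \<langle>h \<cdot> pr1 C (ctx_ob \<A> \<Delta>) (ty_ob \<A> t), pr2 C (ctx_ob \<A> \<Delta>) (ty_ob \<A> t)\<rangle>"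
      if "i < length (t # \<Gamma>)" for i
    proof (cases i)
      case 0
      then show ?thesis using h obj \<open>wf_ty \<Sigma> t\<close> by (simp add: lift_ren_def)
    next
      case (Suc j)
      then have j: "r j < length \<Delta>" "\<Delta> ! r j = \<Gamma> ! j" "var_pr \<A> \<Delta> (r j) = var_pr \<A> \<Gamma> j \<cdot> h"
        using r[of j] that by simp_all
      moreover have "ends C (var_pr \<A> \<Gamma> j) = Some (ctx_ob \<A> \<Gamma>, ty_ob \<A> (\<Gamma> ! j))"
        using h Suc that by simp
      ultimately show ?thesis using h obj \<open>wf_ty \<Sigma> t\<close> Suc j by (simp add: lift_ren_def)
    qed
    then show ?thesis
      unfolding R_def s lift_sub_Var using h obj \<open>wf_ty \<Sigma> t\<close> by auto
  qed
  have "R \<Gamma> \<Delta> (\<lambda>i. Var (r i)) h" using assms infer_wf(1) unfolding R_def by blast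
  then have "infer \<Sigma> \<Delta> (subst (\<lambda>i. Var (r i)) M) = Some t
      \<and> sem \<Sigma> \<A> \<Delta> (subst (\<lambda>i. Var (r i)) M) = sem \<Sigma> \<A> \<Gamma> M \<cdot> h"
    using assms(1) by (intro sem_subst_closed[where R = R]) (simp_all add: sub lift infer_iff)
  then show "infer \<Sigma> \<Delta> (rename r M) = Some t" "sem \<Sigma> \<A> \<Delta> (rename r M) = sem \<Sigma> \<A> \<Gamma> M \<cdot> h"
    by (simp_all add: rename_eq_subst)
qed

text \<open>Going under a binder renames by \<open>Suc\<close>, so the lifting step rests on
  \<open>sem_rename\<close> for the projection \<open>?p\<close> that forgets the new
  variable.\<close>

lemma sem_subst:
  assumes "infer \<Sigma> \<Gamma> M = Some t" and "subst_arr \<Gamma> \<Delta> s h"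
  shows "infer \<Sigma> \<Delta> (subst s M) = Some t" "sem \<Sigma> \<A> \<Delta> (subst s M) = sem \<Sigma> \<A> \<Gamma> M \<cdot> h"
proof -
  have lift: "subst_arr (t # \<Gamma>) (t # \<Delta>) (lift_sub s)
      \<langle>h \<cdot> pr1 C (ctx_ob \<A> \<Delta>) (ty_ob \<A> t), pr2 C (ctx_ob \<A> \<Delta>) (ty_ob \<A> t)\<rangle>"
    if s: "subst_arr \<Gamma> \<Delta> s h" and t: "wf_ty \<Sigma> t" for \<Gamma> \<Delta> s h t
  proof -
    have h: "ends C h = Some (ctx_ob \<A> \<Delta>, ctx_ob \<A> \<Gamma>)" "\<forall>t \<in> set \<Gamma>. wf_ty \<Sigma> t" "\<forall>t \<in> set \<Delta>. wf_ty \<Sigma> t"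
      and s: "\<And>i. i < length \<Gamma> \<Longrightarrow> infer \<Sigma> \<Delta> (s i) = Some (\<Gamma> ! i)
        \<and> sem \<Sigma> \<A> \<Delta> (s i) = unit T (ty_ob \<A> (\<Gamma> ! i)) \<cdot> var_pr \<A> \<Gamma> i \<cdot> h"
      using s unfolding subst_arr_def by blast+
    let ?p = "pr1 C (ctx_ob \<A> \<Delta>) (ty_ob \<A> t)"
    have "infer \<Sigma> (t # \<Delta>) (lift_sub s i) = Some ((t # \<Gamma>) ! i)
      \<and> sem \<Sigma> \<A> (t # \<Delta>) (lift_sub s i) = unit T (ty_ob \<A> ((t # \<Gamma>) ! i))
        \<cdot> var_pr \<A> (t # \<Gamma>) i \<cdot> \<langle>h \<cdot> ?p, pr2 C (ctx_ob \<A> \<Delta>) (ty_ob \<A> t)\<rangle>"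
      if "i < length (t # \<Gamma>)" for i
    proof (cases i)
      case 0
      then show ?thesis using h t by (simp add: lift_sub_def sem_Var)
    next
      case (Suc j)
      then have j: "j < length \<Gamma>" using that by simp
      have "wf_ty \<Sigma> (\<Gamma> ! j)" using h(2) j by simp
      have "infer \<Sigma> (t # \<Delta>) (rename Suc (s j)) = Some (\<Gamma> ! j)
        \<and> sem \<Sigma> \<A> (t # \<Delta>) (rename Suc (s j)) = sem \<Sigma> \<A> \<Delta> (s j) \<cdot> ?p"
        using sem_rename[of \<Delta> "s j" "\<Gamma> ! j" ?p "t # \<Delta>" Suc] s[OF j] h t by simp
      then show ?thesis using h t s[OF j] j Suc \<open>wf_ty \<Sigma> (\<Gamma> ! j)\<close> by (simp add: lift_sub_def)
    qed
    then show ?thesis unfolding subst_arr_def using h t by auto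
  qed
  have "infer \<Sigma> \<Delta> (subst s M) = Some t \<and> sem \<Sigma> \<A> \<Delta> (subst s M) = sem \<Sigma> \<A> \<Gamma> M \<cdot> h"
    using assms by (intro sem_subst_closed[where R = subst_arr]) (simp_all add: lift infer_iff)
  then show "infer \<Sigma> \<Delta> (subst s M) = Some t" "sem \<Sigma> \<A> \<Delta> (subst s M) = sem \<Sigma> \<A> \<Gamma> M \<cdot> h"
    by simp_all
qed

end



section \<open>The state monad transformer\<close>

text \<open>\<open>S\<close> is a parameter with an equation and not an abbreviation, so its monad
  rules apply to \<open>tob S\<close> and \<open>bind\<close> without the exponentials appearing;
  \<open>S_simps\<close> unfolds it where required.\<close>

locale state_transformer = strong_monad C T + S: strong_monad C S
  for C :: "('o, 'm) bicc" (structure) and T S :: "('o, 'm) monad" +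
  fixes Y :: 'o
  assumes Y_obj [simp]: "Y \<in> obj C"
    and S_eq: "S = state_monad C T Y"
begin

lemma S_simps:
  "tob S A = expo C (tob T (A \<otimes> Y)) Y"
  "tmap S f = expo_map C (tmap T (prod_map C f (idn C Y))) (idn C Y)"
  "unit S A = curr C A Y (unit T (A \<otimes> Y))"
  "mult S A = expo_map C (mult T (A \<otimes> Y) \<cdot> tmap T (ev C (tob T (A \<otimes> Y)) Y)) (idn C Y)"
  "str S A B = curr C (A \<otimes> tob S B) Y
    (tmap T (assoc_l C A B Y) \<cdot> str T A (B \<otimes> Y)
      \<cdot> prod_map C (idn C A) (ev C (tob T (B \<otimes> Y)) Y) \<cdot> assoc_r C A (tob S B) Y)"
  by (simp_all add: S_eq state_monad_def Let_def del: swap_def assoc_l_def assoc_r_def)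

definition run :: "'o \<Rightarrow> 'm \<Rightarrow> 'm" where
  "run A f = uncurr C (tob T (A \<otimes> Y)) Y f"

lemma run_eq:
  "A \<in> obj C \<Longrightarrow> ends C f \<equiv> Some (X, tob S A)
    \<Longrightarrow> run A f = ev C (tob T (A \<otimes> Y)) Y \<cdot> \<langle>f \<cdot> pr1 C X Y, pr2 C X Y\<rangle>"
  by (simp add: run_def S_simps)

lemma ends_run [simp]:
  assumes "A \<in> obj C" "ends C f \<equiv> Some (X, tob S A)"
  shows "ends C (run A f) = Some (X \<otimes> Y, tob T (A \<otimes> Y))"
proof -
  have "X \<in> obj C" using assms(2) by (rule ends_obj_dom)
  then show ?thesis using assms by (simp add: run_eq) (simp add: S_simps)
qed

lemma run_cmp [simp]:
  assumes "A \<in> obj C" "ends C f \<equiv> Some (X, tob S A)" "ends C h \<equiv> Some (W, X)"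
  shows "run A (f \<cdot> h) = run A f \<cdot> \<langle>h \<cdot> pr1 C W Y, pr2 C W Y\<rangle>"
proof -
  have "X \<in> obj C" "W \<in> obj C" using assms(2,3)[THEN ends_obj_dom] by simp_all
  then show ?thesis using assms by (simp add: run_eq S_simps)
qed

lemma run_unit [simp]: "A \<in> obj C \<Longrightarrow> run A (unit S A) = unit T (A \<otimes> Y)"
  by (simp add: run_def S_simps ev_curr_tuple)

text \<open>Running is postcomposition with \<open>?k\<close>, which evaluates at the state found in
  the context; \<open>cmp_case_arr\<close> pushes it into the branches. The tuples move the bound
  value in front of the state.\<close>

lemma run_case_arr [simp]:
  assumes "A \<in> obj C" "B \<in> obj C" "D \<in> obj C"
    and "ends C s \<equiv> Some (X, A \<oplus> B)" "ends C f \<equiv> Some (X \<otimes> A, tob S D)" "ends C g \<equiv> Some (X \<otimes> B, tob S D)"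
  shows "run D (case_arr A B s f g) = case_arr A B (s \<cdot> pr1 C X Y)
    (run D f \<cdot> \<langle>\<langle>pr1 C X Y \<cdot> pr1 C (X \<otimes> Y) A, pr2 C (X \<otimes> Y) A\<rangle>, pr2 C X Y \<cdot> pr1 C (X \<otimes> Y) A\<rangle>)
    (run D g \<cdot> \<langle>\<langle>pr1 C X Y \<cdot> pr1 C (X \<otimes> Y) B, pr2 C (X \<otimes> Y) B\<rangle>, pr2 C X Y \<cdot> pr1 C (X \<otimes> Y) B\<rangle>)"
proof -
  have X: "X \<in> obj C" using assms(4) by (rule ends_obj_dom)
  let ?Z = "tob T (D \<otimes> Y)"
  let ?E = "expo C ?Z Y" and ?XY = "X \<otimes> Y"
  let ?k = "ev C ?Z Y \<cdot> \<langle>pr2 C ?XY ?E, pr2 C X Y \<cdot> pr1 C ?XY ?E\<rangle>"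
  let ?f = "\<lambda>A f. f \<cdot> \<langle>pr1 C X Y \<cdot> pr1 C ?XY A, pr2 C ?XY A\<rangle>"
  have "run D (case_arr A B s f g) = ?k \<cdot> \<langle>idn C ?XY, case_arr A B (s \<cdot> pr1 C X Y) (?f A f) (?f B g)\<rangle>"
    using assms X by (simp add: run_def S_simps)
  also have "\<dots> = case_arr A B (s \<cdot> pr1 C X Y) (?k \<cdot> \<langle>pr1 C ?XY A, ?f A f\<rangle>) (?k \<cdot> \<langle>pr1 C ?XY B, ?f B g\<rangle>)"
    by (rule cmp_case_arr) (use assms X in \<open>simp_all add: S_simps\<close>)
  finally show ?thesis using assms X by (simp add: run_def S_simps)
qed

lemma ev_expo_map:
  assumes "ends C k = Some (D, E)" "ends C x = Some (W, expo C D Y)"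
  shows "ev C E Y \<cdot> \<langle>expo_map C k (idn C Y) \<cdot> x \<cdot> pr1 C W Y, pr2 C W Y\<rangle>
    = k \<cdot> ev C D Y \<cdot> \<langle>x \<cdot> pr1 C W Y, pr2 C W Y\<rangle>"
proof -
  have "D \<in> obj C" "E \<in> obj C" "W \<in> obj C" using assms ends_obj by blast+
  then show ?thesis using assms by (simp add: ev_curr_tuple)
qed

text \<open>State threading: the continuation receives the old context with its old state and the
  value with its new state, and the tuple keeps the context, the value and the new state. In the
  proof multiplication and functor action of \<open>S\<close> are exponent maps, removed one at a
  time by \<open>ev_expo_map\<close>.\<close>

lemma run_bind [simp]:
  assumes "A \<in> obj C" "B \<in> obj C"
    and "ends C f \<equiv> Some (X, tob S A)" "ends C g \<equiv> Some (X \<otimes> A, tob S B)"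
  shows "run B (S.bind A B f g) = bind (A \<otimes> Y) (B \<otimes> Y) (run A f)
    (run B g \<cdot> \<langle>\<langle>pr1 C X Y \<cdot> pr1 C (X \<otimes> Y) (A \<otimes> Y), pr1 C A Y \<cdot> pr2 C (X \<otimes> Y) (A \<otimes> Y)\<rangle>,
      pr2 C A Y \<cdot> pr2 C (X \<otimes> Y) (A \<otimes> Y)\<rangle>)"
proof -
  have X: "X \<in> obj C" using assms(3) by (rule ends_obj_dom)
  have f: "ends C f = Some (X, expo C (tob T (A \<otimes> Y)) Y)" and g: "ends C g = Some (X \<otimes> A, expo C (tob T (B \<otimes> Y)) Y)"
    using assms by (simp_all add: S_simps)
  note [simp del] = str_eq_bind mult_eq_bind tmap_eq_bind S.str_eq_bind S.mult_eq_bind S.tmap_eq_bind expo_map_eq curr_cmp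
  let ?p1 = "pr1 C X Y" and ?p2 = "pr2 C X Y"
  let ?s = "str S X A \<cdot> \<langle>idn C X, f\<rangle>"
  let ?m = "mult T (B \<otimes> Y) \<cdot> tmap T (ev C (tob T (B \<otimes> Y)) Y)"
  let ?g = "tmap T (prod_map C g (idn C Y))"
  let ?SB = "expo C (tob T (B \<otimes> Y)) Y"
  have "ends C ?s = Some (X, tob S (X \<otimes> A))"
    using assms X by simp
  then have s: "ends C ?s = Some (X, expo C (tob T ((X \<otimes> A) \<otimes> Y)) Y)"
    by (simp only: S_simps(1))
  have "run B (S.bind A B f g) = ev C (tob T (B \<otimes> Y)) Y \<cdot> \<langle>S.bind A B f g \<cdot> ?p1, ?p2\<rangle>"
    using assms X by (simp add: run_eq)
  also have "S.bind A B f g \<cdot> ?p1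
      = expo_map C ?m (idn C Y) \<cdot> (expo_map C ?g (idn C Y) \<cdot> ?s) \<cdot> ?p1"
  proof -
    have "S.bind A B f g \<cdot> ?p1 = (mult S B \<cdot> tmap S g \<cdot> str S X A \<cdot> \<langle>idn C X, f\<rangle>) \<cdot> ?p1"
      using assms X by (simp add: S.bind_def)
    also have "\<dots> = mult S B \<cdot> (tmap S g \<cdot> ?s) \<cdot> ?p1" using assms X by simp
    finally show ?thesis by (simp only: S_simps(2,4))
  qed
  also have "ev C (tob T (B \<otimes> Y)) Y \<cdot> \<langle>expo_map C ?m (idn C Y) \<cdot> (expo_map C ?g (idn C Y) \<cdot> ?s) \<cdot> ?p1, ?p2\<rangle>
      = ?m \<cdot> ev C (tob T (?SB \<otimes> Y)) Y \<cdot> \<langle>(expo_map C ?g (idn C Y) \<cdot> ?s) \<cdot> ?p1, ?p2\<rangle>"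
    by (rule ev_expo_map) (use assms X f g s in \<open>simp_all add: expo_map_eq S_simps(1)\<close>)
  also have "(expo_map C ?g (idn C Y) \<cdot> ?s) \<cdot> ?p1 = expo_map C ?g (idn C Y) \<cdot> ?s \<cdot> ?p1"
    using assms X f g s by (simp add: expo_map_eq S_simps(1))
  also have "ev C (tob T (?SB \<otimes> Y)) Y \<cdot> \<langle>expo_map C ?g (idn C Y) \<cdot> ?s \<cdot> ?p1, ?p2\<rangle>
      = ?g \<cdot> ev C (tob T ((X \<otimes> A) \<otimes> Y)) Y \<cdot> \<langle>?s \<cdot> ?p1, ?p2\<rangle>"
    by (rule ev_expo_map) (use assms X f g s in \<open>simp_all add: S_simps(1)\<close>)
  \<comment> \<open>The strength of \<open>S\<close> is unfolded: it is the transpose of the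
    strength of \<open>T\<close>, surrounded by reassociations.\<close>
  also have "ev C (tob T ((X \<otimes> A) \<otimes> Y)) Y \<cdot> \<langle>?s \<cdot> ?p1, ?p2\<rangle>
      = tmap T (assoc_l C X A Y) \<cdot> str T X (A \<otimes> Y) \<cdot> \<langle>?p1, run A f\<rangle>"
    using assms X f by (simp add: run_eq S_simps ev_curr_tuple)
  also have "?m \<cdot> ?g \<cdot> tmap T (assoc_l C X A Y) \<cdot> str T X (A \<otimes> Y) \<cdot> \<langle>?p1, run A f\<rangle>
     = mult T (B \<otimes> Y) \<cdot> tmap T (run B g \<cdot> assoc_l C X A Y) \<cdot> str T X (A \<otimes> Y) \<cdot> \<langle>?p1, run A f\<rangle>"
    using assms X f g by (simp add: tmap_tmap_cmp run_eq S_simps(1))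
  also have "\<dots> = bind (A \<otimes> Y) (B \<otimes> Y) (run A f) ((run B g \<cdot> assoc_l C X A Y)
      \<cdot> \<langle>?p1 \<cdot> pr1 C (X \<otimes> Y) (A \<otimes> Y), pr2 C (X \<otimes> Y) (A \<otimes> Y)\<rangle>)"
    by (rule bind_tuple) (use assms X f g in simp_all)
  finally show ?thesis using assms X f g by simp
qed

text \<open>After transposition the evaluation inside the algebra meets the product of
  \<open>q\<close> with the identity on \<open>Y\<close>, and the two form the transpose of
  \<open>q\<close>.\<close>

lemma uncurr_algebra:
  assumes "ends C \<tau> = Some (tob T \<Omega>, \<Omega>)" and "ends C f = Some (X, tob S A)"
    and "ends C q = Some (A, expo C \<Omega> Y)" and "\<Omega> \<in> obj C"
  shows "ends C (state_algebra C T Y \<Omega> \<tau> \<cdot> tmap S q \<cdot> f) = Some (X, expo C \<Omega> Y)"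
    and "uncurr C \<Omega> Y (state_algebra C T Y \<Omega> \<tau> \<cdot> tmap S q \<cdot> f)
      = \<tau> \<cdot> tmap T (uncurr C \<Omega> Y q) \<cdot> run A f"
proof -
  have X: "X \<in> obj C" "A \<in> obj C" using assms ends_obj by blast+
  note [simp del] = str_eq_bind mult_eq_bind tmap_eq_bind S.str_eq_bind S.mult_eq_bind S.tmap_eq_bind
  show "ends C (state_algebra C T Y \<Omega> \<tau> \<cdot> tmap S q \<cdot> f) = Some (X, expo C \<Omega> Y)"
    using assms X by (simp add: state_algebra_def S_simps)
  show "uncurr C \<Omega> Y (state_algebra C T Y \<Omega> \<tau> \<cdot> tmap S q \<cdot> f)
      = \<tau> \<cdot> tmap T (uncurr C \<Omega> Y q) \<cdot> run A f"
    using assms X by (simp add: state_algebra_def S_simps run_def ev_curr_tuple tmap_tmap_cmp)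
qed

end



section \<open>Isomorphisms\<close>

context category
begin

lemma is_inverse_cmp:
  assumes "is_inverse C f g" "is_inverse C f' g'" "ends C f = Some (A, B)" "ends C f' = Some (B, D)"
  shows "is_inverse C (f' \<cdot> f) (g \<cdot> g')"
proof -
  have g: "ends C g = Some (B, A)" "ends C g' = Some (D, B)"
    and inv: "g \<cdot> f = idn C A" "f \<cdot> g = idn C B" "g' \<cdot> f' = idn C B" "f' \<cdot> g' = idn C D"
    using assms unfolding is_inverse_def by auto
  have "(g \<cdot> g') \<cdot> f' \<cdot> f = g \<cdot> (g' \<cdot> f') \<cdot> f"
    and "(f' \<cdot> f) \<cdot> g \<cdot> g' = f' \<cdot> (f \<cdot> g) \<cdot> g'"
    using assms g by simp_all
  then have "(g \<cdot> g') \<cdot> f' \<cdot> f = idn C A" "(f' \<cdot> f) \<cdot> g \<cdot> g' = idn C D"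
    using assms(3,4) g by (simp_all add: inv)
  then show ?thesis unfolding is_inverse_def using assms(3,4) g by auto
qed

lemma is_inverse_cancel:
  assumes "is_inverse C f g" "ends C f \<equiv> Some (A, B)" "ends C h \<equiv> Some (W, A)"
  shows "g \<cdot> f \<cdot> h = h"
proof -
  have g: "ends C g = Some (B, A)" "g \<cdot> f = idn C A"
    using assms(1,2) unfolding is_inverse_def by auto
  have "g \<cdot> f \<cdot> h = (g \<cdot> f) \<cdot> h" using assms g(1) by simp
  then show ?thesis using assms g(2) by simp
qed

end

context bicartesian_closed
begin

lemma is_inverse_prod_map:
  assumes "is_inverse C f f'" "is_inverse C g g'"
  shows "is_inverse C (prod_map C f g) (prod_map C f' g')"
proof -
  obtain A B where f: "ends C f = Some (A, B)" "ends C f' = Some (B, A)" using assms(1) unfolding is_inverse_def by blast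
  obtain D E where g: "ends C g = Some (D, E)" "ends C g' = Some (E, D)" using assms(2) unfolding is_inverse_def by blast
  have obj: "A \<in> obj C" "B \<in> obj C" "D \<in> obj C" "E \<in> obj C" using f g ends_obj by blast+
  show ?thesis unfolding is_inverse_def
    by (intro exI[of _ "A \<otimes> D"] exI[of _ "B \<otimes> E"])
      (use f g obj assms[THEN is_inverse_cancel] assms[THEN is_inverse_sym, THEN is_inverse_cancel] in simp)
qed

lemma is_inverse_sum_map:
  assumes "is_inverse C f f'" "is_inverse C g g'"
  shows "is_inverse C (sum_map C f g) (sum_map C f' g')"
proof -
  obtain A B where f: "ends C f = Some (A, B)" "ends C f' = Some (B, A)" "f' \<cdot> f = idn C A" "f \<cdot> f' = idn C B"
    using assms(1) unfolding is_inverse_def by blast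
  obtain D E where g: "ends C g = Some (D, E)" "ends C g' = Some (E, D)" "g' \<cdot> g = idn C D" "g \<cdot> g' = idn C E"
    using assms(2) unfolding is_inverse_def by blast
  have obj: "A \<in> obj C" "B \<in> obj C" "D \<in> obj C" "E \<in> obj C" using f g ends_obj by blast+
  show ?thesis unfolding is_inverse_def
    by (intro exI[of _ "A \<oplus> D"] exI[of _ "B \<oplus> E"]) (use f g obj in simp)
qed

lemma is_inverse_expo_map:
  assumes "is_inverse C f f'" "is_inverse C g g'"
  shows "is_inverse C (expo_map C f g') (expo_map C f' g)"
proof -
  obtain A B where f: "ends C f = Some (A, B)" "ends C f' = Some (B, A)" using assms(1) unfolding is_inverse_def by blast
  obtain D E where g: "ends C g = Some (D, E)" "ends C g' = Some (E, D)" using assms(2) unfolding is_inverse_def by blast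
  have obj: "A \<in> obj C" "B \<in> obj C" "D \<in> obj C" "E \<in> obj C" using f g ends_obj by blast+
  show ?thesis unfolding is_inverse_def
    by (intro exI[of _ "expo C A D"] exI[of _ "expo C B E"])
      (use f g obj assms[THEN is_inverse_cancel] assms[THEN is_inverse_sym, THEN is_inverse_cancel] in
        \<open>simp add: ev_curr_tuple\<close>)
qed

lemma is_inverse_curry_iso:
  assumes "X \<in> obj C" "Y \<in> obj C" "V \<in> obj C"
  shows "ends C (curry_iso C X Y V) = Some (expo C (expo C X Y) V, expo C X (V \<otimes> Y))"
    and "\<exists>g. is_inverse C (curry_iso C X Y V) g"
proof -
  show ends: "ends C (curry_iso C X Y V) = Some (expo C (expo C X Y) V, expo C X (V \<otimes> Y))"
    using assms by (simp add: curry_iso_def)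
  let ?E = "expo C X (V \<otimes> Y)" and ?D = "expo C (expo C X Y) V"
  \<comment> \<open>The inverse transposes the evaluation at \<open>V \<otimes> Y\<close> along
    \<open>Y\<close> and then along \<open>V\<close>.\<close>
  let ?g = "curr C ?E V (curr C (?E \<otimes> V) Y
    (ev C X (V \<otimes> Y) \<cdot> \<langle>pr1 C ?E V \<cdot> pr1 C (?E \<otimes> V) Y, \<langle>pr2 C ?E V \<cdot> pr1 C (?E \<otimes> V) Y, pr2 C (?E \<otimes> V) Y\<rangle>\<rangle>))"
  have "?g \<cdot> curry_iso C X Y V = idn C ?D" "curry_iso C X Y V \<cdot> ?g = idn C ?E"
    using assms by (simp_all add: curry_iso_def ev_curr_tuple)
  then have "is_inverse C (curry_iso C X Y V) ?g"
    unfolding is_inverse_def using assms ends by simp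
  then show "\<exists>g. is_inverse C (curry_iso C X Y V) g" ..
qed

end

context strong_monad
begin

lemma is_inverse_tmap:
  assumes "is_inverse C f g"
  shows "is_inverse C (tmap T f) (tmap T g)"
proof -
  obtain A B where f: "ends C f = Some (A, B)" "ends C g = Some (B, A)" "g \<cdot> f = idn C A" "f \<cdot> g = idn C B"
    using assms unfolding is_inverse_def by blast
  have "A \<in> obj C" "B \<in> obj C" using f ends_obj by blast+
  then have "tmap T g \<cdot> tmap T f = idn C (tob T A)" "tmap T f \<cdot> tmap T g = idn C (tob T B)"
    using f by (simp_all add: tmap_tmap del: tmap_eq_bind)
  then show ?thesis unfolding is_inverse_def using f by auto
qed

end

section \<open>The two models and their comparison\<close>

text \<open>The target signature embeds arities by \<open>map_ty Inl\<close>, whereas transformed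
  terms have types given by \<open>circ\<close>; transformed operations are well typed because the
  two agree on ground types.\<close>

lemma circ_ground: "ground t \<Longrightarrow> circ t = map_ty Inl t"
  by (induction t) simp_all

lemma ground_circ: "ground t \<Longrightarrow> ground (circ t)"
  by (induction t) simp_all

lemma circ_ctx_ty [simp]: "circ (ctx_ty \<Gamma>) = ctx_ty (map circ \<Gamma>)"
  by (induction \<Gamma>) simp_all

lemma ground_ctx_ty [simp]: "ground (ctx_ty \<Gamma>) \<longleftrightarrow> (\<forall>s \<in> set \<Gamma>. ground s)"
  by (induction \<Gamma>) auto

lemma wf_ty_sps [simp]:
  "wf_ty (sps_signature \<Sigma>) bY"
  "wf_ty (sps_signature \<Sigma>) (circ t) \<longleftrightarrow> wf_ty \<Sigma> t"
proof -
  show "wf_ty (sps_signature \<Sigma>) bY" by (auto simp: wf_ty_def sps_signature_def)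
  then show "wf_ty (sps_signature \<Sigma>) (circ t) \<longleftrightarrow> wf_ty \<Sigma> t"
    by (induction t) (auto simp: wf_ty_def[of _ "TBase _"] sps_signature_def)
qed

locale sps_model = state_transformer C T S Y
  for C :: "('o, 'm) bicc" (structure) and T S :: "('o, 'm) monad" and Y :: 'o +
  fixes \<Sigma> :: "('b, 'k, 'e) signature" and A :: "'b \<Rightarrow> 'o" and a :: "'k + 'e \<Rightarrow> 'm"
  assumes lc: "lc_structure \<Sigma> (struct_S C T Y A a)"
begin

abbreviation \<A>S :: "('o, 'm, 'b, 'k, 'e) lc_struct" where "\<A>S \<equiv> struct_S C T Y A a"

abbreviation \<A>T :: "('o, 'm, 'b + unit, 'k, 'e) lc_struct" where "\<A>T \<equiv> struct_T \<Sigma> C T Y A a"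

abbreviation \<Sigma>T :: "('b + unit, 'k, 'e) signature" where "\<Sigma>T \<equiv> sps_signature \<Sigma>"

sublocale SM: lc_model C S \<Sigma> \<A>S
proof
  show "cat \<A>S = C" "mon \<A>S = S" by (simp_all add: struct_S_def S_eq)
qed (use lc in \<open>auto simp: lc_structure_def struct_S_def S_eq\<close>)

lemma struct_T_simps:
  "cat \<A>T = C" "mon \<A>T = T" "base_ob \<A>T (Inl b) = A b" "base_ob \<A>T (Inr ()) = Y"
  "op_arr \<A>T (Inl c) = prod_map C (a (Inl c)) (idn C Y)"
  "op_arr \<A>T (Inr e) = run (ty_ob \<A>S (car \<Sigma> (Inr e))) (a (Inr e))"
  by (simp_all add: struct_T_def run_def)

lemma struct_S_simps: "base_ob \<A>S = A" "op_arr \<A>S = a"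
  by (simp_all add: struct_S_def)

text \<open>Function types are the only ones whose interpretation mentions the monad.\<close>

lemma ty_ob_circ_ground: "ground t \<Longrightarrow> ty_ob \<A>T (circ t) = ty_ob \<A>S t"
  by (induction t) (simp_all add: struct_T_simps struct_S_simps)

lemma op_ground:
  "c \<in> constants \<Sigma> \<Longrightarrow> ground (ar \<Sigma> (Inl c)) \<and> ground (car \<Sigma> (Inl c))"
  "e \<in> effects \<Sigma> \<Longrightarrow> ground (ar \<Sigma> (Inr e)) \<and> ground (car \<Sigma> (Inr e))"
  using SM.wf_sig unfolding wf_signature_def by blast+

lemma sps_signature_simps:
  "constants \<Sigma>T = constants \<Sigma>" "effects \<Sigma>T = effects \<Sigma>"
  "c \<in> constants \<Sigma> \<Longrightarrow> ar \<Sigma>T (Inl c) = sps_ty (ar \<Sigma> (Inl c))"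
  "c \<in> constants \<Sigma> \<Longrightarrow> car \<Sigma>T (Inl c) = sps_ty (car \<Sigma> (Inl c))"
  "e \<in> effects \<Sigma> \<Longrightarrow> ar \<Sigma>T (Inr e) = sps_ty (ar \<Sigma> (Inr e))"
  "e \<in> effects \<Sigma> \<Longrightarrow> car \<Sigma>T (Inr e) = sps_ty (car \<Sigma> (Inr e))"
  by (simp_all add: sps_signature_def sps_ty_def circ_ground op_ground)

text \<open>The end points of the transformed operations fit because arities and coarities are
  ground, so that their objects are the same in both structures.\<close>

sublocale TM: lc_model C T \<Sigma>T \<A>T
proof
  show "cat \<A>T = C" "mon \<A>T = T" by (simp_all add: struct_T_simps)
  show "wf_signature \<Sigma>T"
    unfolding wf_signature_def
  proof
    fix k assume "k \<in> constants \<Sigma>T <+> effects \<Sigma>T"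
    then show "ground (ar \<Sigma>T k) \<and> wf_ty \<Sigma>T (ar \<Sigma>T k) \<and> ground (car \<Sigma>T k) \<and> wf_ty \<Sigma>T (car \<Sigma>T k)"
      using op_ground SM.op_wf
      by (auto elim!: PlusE simp: sps_signature_simps sps_ty_def ground_circ)
  qed
  show "base_ob \<A>T b \<in> obj C" if "b \<in> bases \<Sigma>T" for b
    using that SM.base_obj by (auto simp: sps_signature_def struct_T_simps struct_S_simps)
  show "ends C (op_arr \<A>T (Inl c)) = Some (ty_ob \<A>T (ar \<Sigma>T (Inl c)), ty_ob \<A>T (car \<Sigma>T (Inl c)))"
    if "c \<in> constants \<Sigma>T" for c
    using that SM.ends_const[of c] op_ground(1)[of c] SM.op_wf(1)[of c]
    by (simp add: sps_signature_simps sps_ty_def struct_T_simps struct_S_simps ty_ob_circ_ground)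
  show "ends C (op_arr \<A>T (Inr e)) = Some (ty_ob \<A>T (ar \<Sigma>T (Inr e)), tob T (ty_ob \<A>T (car \<Sigma>T (Inr e))))"
    if "e \<in> effects \<Sigma>T" for e
    using that SM.ends_effect[of e] op_ground(2)[of e] SM.op_wf(2)[of e]
    by (simp add: sps_signature_simps sps_ty_def struct_T_simps struct_S_simps ty_ob_circ_ground)
qed

lemma base_bY [simp]: "base_ob \<A>T (Inr ()) = Y"
  by (simp add: struct_T_simps)

abbreviation \<rho> :: "'b ty \<Rightarrow> 'm" where "\<rho> \<equiv> rho \<A>S \<A>T Y"

definition \<rho>' :: "'b ty \<Rightarrow> 'm" where "\<rho>' t = inverse_arr C (\<rho> t)"

declare rho.simps(6) [simp del]

text \<open>End points and invertibility are proved in one induction because the clause for function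
  types contains the inverse at the argument type.\<close>

lemma rho_is_inverse:
  assumes "wf_ty \<Sigma> t"
  shows "ends C (\<rho> t) = Some (ty_ob \<A>S t, ty_ob \<A>T (circ t)) \<and> is_inverse C (\<rho> t) (\<rho>' t)"
  using assms
proof (induction t)
  have I: "is_inverse C (\<rho> t) (\<rho>' t)" if "is_inverse C (\<rho> t) g" for t g
    unfolding \<rho>'_def using inverse_arr_eqI[OF that] that by simp
  
  {
    case (TBase b)
    then have "A b \<in> obj C" using SM.base_obj by (simp add: wf_ty_def struct_S_simps)
    then show ?case using I[of "TBase b" "idn C (A b)"] is_inverse_idn
      by (simp add: struct_T_simps struct_S_simps)
  next
    case TUnit
    then show ?case using I[of TUnit "idn C (terminal C)"] is_inverse_idn by simp
  next
    case (TProd t1 t2)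
    then show ?case using I[of "TProd t1 t2" "prod_map C (\<rho>' t1) (\<rho>' t2)"]
        is_inverse_prod_map[of "\<rho> t1" "\<rho>' t1" "\<rho> t2" "\<rho>' t2"]
      by simp
  next
    case TZero
    then show ?case using I[of TZero "idn C (initial C)"] is_inverse_idn by simp
  next
    case (TSum t1 t2)
    then show ?case using I[of "TSum t1 t2" "sum_map C (\<rho>' t1) (\<rho>' t2)"]
        is_inverse_sum_map[of "\<rho> t1" "\<rho>' t1" "\<rho> t2" "\<rho>' t2"]
      by simp
  next
    case (TFun t1 t2)
    let ?A = "ty_ob \<A>S t1" and ?B = "ty_ob \<A>S t2" and ?A' = "ty_ob \<A>T (circ t1)" and ?B' = "ty_ob \<A>T (circ t2)"
    have obj: "?A \<in> obj C" "?B \<in> obj C" "?A' \<in> obj C" "?B' \<in> obj C" using TFun.prems by simp_all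
    have 1: "ends C (\<rho> t1) = Some (?A, ?A')" "is_inverse C (\<rho> t1) (\<rho>' t1)"
      and 2: "ends C (\<rho> t2) = Some (?B, ?B')" "is_inverse C (\<rho> t2) (\<rho>' t2)"
      using TFun by simp_all
    have r: "ends C (\<rho>' t1) = Some (?A', ?A)" using 1 unfolding is_inverse_def by auto
    let ?i = "curry_iso C (tob T (?B' \<otimes> Y)) Y ?A'" and ?e = "expo_map C (tmap S (\<rho> t2)) (\<rho>' t1)"
    have rho: "\<rho> (TFun t1 t2) = ?i \<cdot> ?e" by (simp add: rho.simps(6) \<rho>'_def)
    obtain g where i: "is_inverse C ?i g"
      and ends_i: "ends C ?i = Some (expo C (expo C (tob T (?B' \<otimes> Y)) Y) ?A', expo C (tob T (?B' \<otimes> Y)) (?A' \<otimes> Y))"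
      using is_inverse_curry_iso[of "tob T (?B' \<otimes> Y)" Y ?A'] obj by auto
    \<comment> \<open>Exponent maps are contravariant in the exponent, so \<rho> and \<rho>' at
      \<open>t1\<close> trade places in the inverse.\<close>
    have e: "is_inverse C ?e (expo_map C (tmap S (\<rho>' t2)) (\<rho> t1))"
      using 1 2 by (intro is_inverse_expo_map S.is_inverse_tmap) auto
    have ends_e: "ends C ?e = Some (expo C (tob S ?B) ?A, expo C (expo C (tob T (?B' \<otimes> Y)) Y) ?A')"
      using 1 r 2 obj by (simp add: S_simps(1))
    show ?case
      using I[of "TFun t1 t2", unfolded rho, OF is_inverse_cmp[OF e i ends_e ends_i]] ends_i ends_e
      by (simp add: rho)
  }
qed

lemma ends_rho [simp]: "wf_ty \<Sigma> t \<Longrightarrow> ends C (\<rho> t) = Some (ty_ob \<A>S t, ty_ob \<A>T (circ t))"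
  using rho_is_inverse by blast

lemma ends_rho' [simp]: "wf_ty \<Sigma> t \<Longrightarrow> ends C (\<rho>' t) = Some (ty_ob \<A>T (circ t), ty_ob \<A>S t)"
  using rho_is_inverse[of t] unfolding is_inverse_def by auto

lemma rho_rho' [simp]: "wf_ty \<Sigma> t \<Longrightarrow> \<rho> t \<cdot> \<rho>' t = idn C (ty_ob \<A>T (circ t))"
  using rho_is_inverse[of t] unfolding is_inverse_def by auto

lemma rho_cancel [simp]:
  assumes "wf_ty \<Sigma> t"
  shows "ends C h \<equiv> Some (W, ty_ob \<A>T (circ t)) \<Longrightarrow> \<rho> t \<cdot> \<rho>' t \<cdot> h = h"
    and "ends C h \<equiv> Some (W, ty_ob \<A>S t) \<Longrightarrow> \<rho>' t \<cdot> \<rho> t \<cdot> h = h"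
  using is_inverse_cancel[of "\<rho>' t" "\<rho> t"] is_inverse_cancel[of "\<rho> t" "\<rho>' t"] is_inverse_sym[of "\<rho> t" "\<rho>' t"]
    rho_is_inverse[OF assms] assms by simp_all

lemma rho_ground: "ground t \<Longrightarrow> wf_ty \<Sigma> t \<Longrightarrow> \<rho> t = idn C (ty_ob \<A>S t)"
  by (induction t) (simp_all add: struct_S_simps)

lemma rho'_ground: "ground t \<Longrightarrow> wf_ty \<Sigma> t \<Longrightarrow> \<rho>' t = idn C (ty_ob \<A>S t)"
  using is_inverse_idn by (simp add: \<rho>'_def rho_ground inverse_arr_eqI)

text \<open>The behaviour of \<rho> at a function type under evaluation, with the currying
  isomorphism and the exponent map reduced away. In the induction on terms, abstraction and
  application use \<rho> at function types through this equation.\<close>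

lemma ev_rho_fun:
  assumes "wf_ty \<Sigma> t1" "wf_ty \<Sigma> t2"
    and "ends C u \<equiv> Some (W, expo C (tob S (ty_ob \<A>S t2)) (ty_ob \<A>S t1))"
    and "ends C v \<equiv> Some (W, ty_ob \<A>T (circ t1))" "ends C y \<equiv> Some (W, Y)"
  shows "ev C (tob T (ty_ob \<A>T (circ t2) \<otimes> Y)) (ty_ob \<A>T (circ t1) \<otimes> Y) \<cdot> \<langle>\<rho> (TFun t1 t2) \<cdot> u, \<langle>v, y\<rangle>\<rangle>
    = tmap T (prod_map C (\<rho> t2) (idn C Y))
      \<cdot> run (ty_ob \<A>S t2) (ev C (tob S (ty_ob \<A>S t2)) (ty_ob \<A>S t1) \<cdot> \<langle>u, \<rho>' t1 \<cdot> v\<rangle>) \<cdot> \<langle>idn C W, y\<rangle>"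
proof -
  let ?A = "ty_ob \<A>S t1" and ?B = "ty_ob \<A>S t2" and ?A' = "ty_ob \<A>T (circ t1)" and ?B' = "ty_ob \<A>T (circ t2)"
  note [simp del] = tmap_eq_bind S.tmap_eq_bind
  have W: "W \<in> obj C" using assms(3) by (rule ends_obj_dom)
  have obj: "?A \<in> obj C" "?B \<in> obj C" "?A' \<in> obj C" "?B' \<in> obj C" using assms by simp_all
  show ?thesis
    unfolding rho.simps(6)
    using assms W obj by (simp add: curry_iso_def run_def S_simps ev_curr_tuple flip: \<rho>'_def)
qed

lemma var_pr_rho:
  "i < length \<Gamma> \<Longrightarrow> \<forall>s \<in> set \<Gamma>. wf_ty \<Sigma> s
    \<Longrightarrow> var_pr \<A>T (map circ \<Gamma>) i \<cdot> \<rho> (ctx_ty \<Gamma>) = \<rho> (\<Gamma> ! i) \<cdot> var_pr \<A>S \<Gamma> i"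
proof (induction \<Gamma> arbitrary: i)
  case (Cons s \<Gamma>)
  show ?case
  proof (cases i)
    case 0
    then show ?thesis using Cons.prems by simp
  next
    case (Suc j)
    let ?X = "ctx_ob \<A>S \<Gamma>" and ?s = "ty_ob \<A>S s"
    have j: "j < length \<Gamma>" "wf_ty \<Sigma> (\<Gamma> ! j)" using Cons.prems Suc by simp_all
    have v: "ends C (var_pr \<A>T (map circ \<Gamma>) j) = Some (ctx_ob \<A>T (map circ \<Gamma>), ty_ob \<A>T (circ (\<Gamma> ! j)))"
      using TM.ends_var_pr[of j "map circ \<Gamma>"] j Cons.prems by simp
    have "var_pr \<A>T (map circ (s # \<Gamma>)) i \<cdot> \<rho> (ctx_ty (s # \<Gamma>))
        = (var_pr \<A>T (map circ \<Gamma>) j \<cdot> \<rho> (ctx_ty \<Gamma>)) \<cdot> pr1 C ?X ?s"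
      using Suc v Cons.prems by simp
    also have "\<dots> = (\<rho> (\<Gamma> ! j) \<cdot> var_pr \<A>S \<Gamma> j) \<cdot> pr1 C ?X ?s"
      using Cons.IH j Cons.prems by simp
    also have "\<dots> = \<rho> ((s # \<Gamma>) ! i) \<cdot> var_pr \<A>S (s # \<Gamma>) i"
      using Suc j Cons.prems by simp
    finally show ?thesis .
  qed
qed simp

end



section \<open>Correctness of the transformation\<close>

context sps_model
begin

lemma under_y:
  assumes "infer \<Sigma>T (bY # \<Gamma>) N \<equiv> Some t" "wf_ty \<Sigma>T s"
  shows "infer \<Sigma>T (bY # s # bY # \<Gamma>) (under_y N) = Some t"
    and "sem \<Sigma>T \<A>T (bY # s # bY # \<Gamma>) (under_y N) = (let G = ctx_ob \<A>T \<Gamma>; Z = ty_ob \<A>T s in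
      sem \<Sigma>T \<A>T (bY # \<Gamma>) N
        \<cdot> \<langle>pr1 C G Y \<cdot> pr1 C (G \<otimes> Y) Z \<cdot> pr1 C (G \<otimes> Y \<otimes> Z) Y, pr2 C (G \<otimes> Y \<otimes> Z) Y\<rangle>)"
proof -
  let ?G = "ctx_ob \<A>T \<Gamma>" and ?Z = "ty_ob \<A>T s"
  let ?h = "\<langle>pr1 C ?G Y \<cdot> pr1 C (?G \<otimes> Y) ?Z \<cdot> pr1 C (?G \<otimes> Y \<otimes> ?Z) Y, pr2 C (?G \<otimes> Y \<otimes> ?Z) Y\<rangle>"
  \<comment> \<open>The state stays the innermost variable, while a source variable, formerly below
    one state variable, now lies below \<open>y\<close>, \<open>z\<close> and the outer
    state.\<close>
  let ?r = "\<lambda>i. case i of 0 \<Rightarrow> 0 | Suc j \<Rightarrow> j + 3"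
  have N: "infer \<Sigma>T (bY # \<Gamma>) N = Some t" using assms(1) by simp
  have wf: "\<forall>s \<in> set \<Gamma>. wf_ty \<Sigma>T s" using TM.infer_wf(1)[OF N] by simp
  have h: "ends C ?h = Some (ctx_ob \<A>T (bY # s # bY # \<Gamma>), ctx_ob \<A>T (bY # \<Gamma>))"
    using wf assms(2) by simp
  have r: "?r i < length (bY # s # bY # \<Gamma>) \<and> (bY # s # bY # \<Gamma>) ! ?r i = (bY # \<Gamma>) ! i
    \<and> var_pr \<A>T (bY # s # bY # \<Gamma>) (?r i) = var_pr \<A>T (bY # \<Gamma>) i \<cdot> ?h" if "i < length (bY # \<Gamma>)" for i
    using that wf assms(2) by (cases i) (simp_all add: numeral_3_eq_3)
  show "infer \<Sigma>T (bY # s # bY # \<Gamma>) (under_y N) = Some t"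
    and "sem \<Sigma>T \<A>T (bY # s # bY # \<Gamma>) (under_y N) = (let G = ctx_ob \<A>T \<Gamma>; Z = ty_ob \<A>T s in
      sem \<Sigma>T \<A>T (bY # \<Gamma>) N
        \<cdot> \<langle>pr1 C G Y \<cdot> pr1 C (G \<otimes> Y) Z \<cdot> pr1 C (G \<otimes> Y \<otimes> Z) Y, pr2 C (G \<otimes> Y \<otimes> Z) Y\<rangle>)"
    using TM.sem_rename[OF N h _ r] wf assms(2) unfolding under_y_def Let_def by simp_all
qed

text \<open>The substituted projections denote units after projections, so \<open>sem_subst\<close>
  applies; the tuple reads the variable and the state from \<open>z\<close> and discards the outer
  state.\<close>

lemma split_z:
  assumes "infer \<Sigma>T (bY # s # \<Gamma>) N \<equiv> Some t"
  shows "infer \<Sigma>T (TProd s bY # bY # \<Gamma>) (split_z N) = Some t"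
    and "sem \<Sigma>T \<A>T (TProd s bY # bY # \<Gamma>) (split_z N) = (let G = ctx_ob \<A>T \<Gamma>; Z = ty_ob \<A>T s in
      sem \<Sigma>T \<A>T (bY # s # \<Gamma>) N
        \<cdot> \<langle>\<langle>pr1 C G Y \<cdot> pr1 C (G \<otimes> Y) (Z \<otimes> Y), pr1 C Z Y \<cdot> pr2 C (G \<otimes> Y) (Z \<otimes> Y)\<rangle>,
          pr2 C Z Y \<cdot> pr2 C (G \<otimes> Y) (Z \<otimes> Y)\<rangle>)"
proof -
  let ?G = "ctx_ob \<A>T \<Gamma>" and ?Z = "ty_ob \<A>T s"
  let ?h = "\<langle>\<langle>pr1 C ?G Y \<cdot> pr1 C (?G \<otimes> Y) (?Z \<otimes> Y), pr1 C ?Z Y \<cdot> pr2 C (?G \<otimes> Y) (?Z \<otimes> Y)\<rangle>,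
    pr2 C ?Z Y \<cdot> pr2 C (?G \<otimes> Y) (?Z \<otimes> Y)\<rangle>"
  let ?s = "\<lambda>i. case i of 0 \<Rightarrow> Proj2 (Var 0) | Suc 0 \<Rightarrow> Proj1 (Var 0) | Suc (Suc j) \<Rightarrow> Var (j + 2)"
  have N: "infer \<Sigma>T (bY # s # \<Gamma>) N = Some t" using assms by simp
  have wf: "wf_ty \<Sigma>T s" "\<forall>s \<in> set \<Gamma>. wf_ty \<Sigma>T s" using TM.infer_wf(1)[OF N] by simp_all
  have "infer \<Sigma>T (TProd s bY # bY # \<Gamma>) (?s i) = Some ((bY # s # \<Gamma>) ! i)
      \<and> sem \<Sigma>T \<A>T (TProd s bY # bY # \<Gamma>) (?s i)
        = unit T (ty_ob \<A>T ((bY # s # \<Gamma>) ! i)) \<cdot> var_pr \<A>T (bY # s # \<Gamma>) i \<cdot> ?h"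
    if "i < length (bY # s # \<Gamma>)" for i
  proof (cases i)
    case 0
    then show ?thesis using wf by (simp add: TM.sem_simps)
  next
    case (Suc k)
    then show ?thesis using wf that by (cases k) (simp_all add: TM.sem_simps)
  qed
  then have sub: "TM.subst_arr (bY # s # \<Gamma>) (TProd s bY # bY # \<Gamma>) ?s ?h"
    unfolding TM.subst_arr_def using wf by simp
  show "infer \<Sigma>T (TProd s bY # bY # \<Gamma>) (split_z N) = Some t"
    unfolding split_z_def by (rule TM.sem_subst(1)[OF N sub])
  show "sem \<Sigma>T \<A>T (TProd s bY # bY # \<Gamma>) (split_z N) = (let G = ctx_ob \<A>T \<Gamma>; Z = ty_ob \<A>T s in
      sem \<Sigma>T \<A>T (bY # s # \<Gamma>) N
        \<cdot> \<langle>\<langle>pr1 C G Y \<cdot> pr1 C (G \<otimes> Y) (Z \<otimes> Y), pr1 C Z Y \<cdot> pr2 C (G \<otimes> Y) (Z \<otimes> Y)\<rangle>,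
          pr2 C Z Y \<cdot> pr2 C (G \<otimes> Y) (Z \<otimes> Y)\<rangle>)"
    unfolding split_z_def Let_def by (rule TM.sem_subst(2)[OF N sub])
qed

text \<open>Typing is bundled with the equation because the semantic clauses compute with types.
  Placing \<rho> on both sides, instead of its inverse on one, confines inverses in the induction to
  function types.\<close>

definition simulates :: "'b ctx \<Rightarrow> ('b, 'k, 'e) tm \<Rightarrow> 'b ty \<Rightarrow> bool" where
  "simulates \<Gamma> M t \<longleftrightarrow> infer \<Sigma> \<Gamma> M = Some t
    \<and> infer \<Sigma>T (bY # map circ \<Gamma>) (sps \<Sigma> \<Gamma> M) = Some (TProd (circ t) bY)
    \<and> sem \<Sigma>T \<A>T (bY # map circ \<Gamma>) (sps \<Sigma> \<Gamma> M)
        \<cdot> \<langle>\<rho> (ctx_ty \<Gamma>) \<cdot> pr1 C (ctx_ob \<A>S \<Gamma>) Y, pr2 C (ctx_ob \<A>S \<Gamma>) Y\<rangle>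
      = tmap T (prod_map C (\<rho> t) (idn C Y)) \<cdot> run (ty_ob \<A>S t) (sem \<Sigma> \<A>S \<Gamma> M)"

lemma simulates_infer:
  assumes "simulates \<Gamma> M t"
  shows "infer \<Sigma> \<Gamma> M = Some t"
    and "infer \<Sigma>T (bY # map circ \<Gamma>) (sps \<Sigma> \<Gamma> M) = Some (TProd (circ t) bY)"
    and "\<forall>s \<in> set \<Gamma>. wf_ty \<Sigma> s" "wf_ty \<Sigma> t"
  using assms SM.infer_wf[of \<Gamma> M t] unfolding simulates_def by auto

text \<open>The equation for arbitrary environment and state: normalised goals contain transformed
  subterms in this form, so it can be used for rewriting.\<close>

lemma simulates_tuple:
  assumes M: "simulates \<Gamma> M t" and "ends C u \<equiv> Some (W, ctx_ob \<A>S \<Gamma>)" "ends C y \<equiv> Some (W, Y)"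
  shows "sem \<Sigma>T \<A>T (bY # map circ \<Gamma>) (sps \<Sigma> \<Gamma> M) \<cdot> \<langle>\<rho> (ctx_ty \<Gamma>) \<cdot> u, y\<rangle>
    = tmap T (prod_map C (\<rho> t) (idn C Y)) \<cdot> run (ty_ob \<A>S t) (sem \<Sigma> \<A>S \<Gamma> M) \<cdot> \<langle>u, y\<rangle>"
proof -
  note [simp] = simulates_infer[OF M] and [simp del] = tmap_eq_bind
  let ?P = "sem \<Sigma>T \<A>T (bY # map circ \<Gamma>) (sps \<Sigma> \<Gamma> M)"
  have "?P \<cdot> \<langle>\<rho> (ctx_ty \<Gamma>) \<cdot> u, y\<rangle>
      = (?P \<cdot> \<langle>\<rho> (ctx_ty \<Gamma>) \<cdot> pr1 C (ctx_ob \<A>S \<Gamma>) Y, pr2 C (ctx_ob \<A>S \<Gamma>) Y\<rangle>) \<cdot> \<langle>u, y\<rangle>"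
    using assms by simp
  also have "\<dots> = (tmap T (prod_map C (\<rho> t) (idn C Y)) \<cdot> run (ty_ob \<A>S t) (sem \<Sigma> \<A>S \<Gamma> M)) \<cdot> \<langle>u, y\<rangle>"
    using M unfolding simulates_def by simp
  finally show ?thesis using assms by simp
qed

text \<open>Under a binder the simplifier splits \<rho> of the context into a tuple, which
  \<open>simulates_tuple\<close> would no longer match.\<close>

lemma simulates_tuple_Cons:
  assumes M: "simulates (s # \<Gamma>) M t"
    and "ends C u \<equiv> Some (W, ctx_ob \<A>S \<Gamma>)" "ends C v \<equiv> Some (W, ty_ob \<A>S s)" "ends C y \<equiv> Some (W, Y)"
  shows "sem \<Sigma>T \<A>T (bY # circ s # map circ \<Gamma>) (sps \<Sigma> (s # \<Gamma>) M) \<cdot> \<langle>\<langle>\<rho> (ctx_ty \<Gamma>) \<cdot> u, \<rho> s \<cdot> v\<rangle>, y\<rangle>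
    = tmap T (prod_map C (\<rho> t) (idn C Y)) \<cdot> run (ty_ob \<A>S t) (sem \<Sigma> \<A>S (s # \<Gamma>) M) \<cdot> \<langle>\<langle>u, v\<rangle>, y\<rangle>"
  using simulates_tuple[OF M, of "\<langle>u, v\<rangle>" W y] simulates_infer[OF M] assms(2-4)
  by (simp del: tmap_eq_bind)

text \<open>Once subterms are rewritten by \<open>simulates_tuple\<close>, most cases close because
  both sides normalise to the same binds and units. Operations also need \<rho> to be the identity
  at ground types, variables need \<open>var_pr_rho\<close>, and abstraction has to compare two
  arrows into an exponential.\<close>

lemma sps_simulates: "typing \<Sigma> \<Gamma> M t \<Longrightarrow> simulates \<Gamma> M t"
proof (induction rule: typing.induct)
  case (t_Var \<Gamma> i)
  have wf: "wf_ty \<Sigma> (\<Gamma> ! i)" using t_Var by simp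
  have v: "ends C (var_pr \<A>T (map circ \<Gamma>) i) = Some (ctx_ob \<A>T (map circ \<Gamma>), ty_ob \<A>T (circ (\<Gamma> ! i)))"
    using TM.ends_var_pr[of i "map circ \<Gamma>"] t_Var by simp
  have "var_pr \<A>T (map circ \<Gamma>) i \<cdot> \<rho> (ctx_ty \<Gamma>) \<cdot> pr1 C (ctx_ob \<A>S \<Gamma>) Y
     = \<rho> (\<Gamma> ! i) \<cdot> var_pr \<A>S \<Gamma> i \<cdot> pr1 C (ctx_ob \<A>S \<Gamma>) Y"
  proof -
    have "var_pr \<A>T (map circ \<Gamma>) i \<cdot> \<rho> (ctx_ty \<Gamma>) \<cdot> pr1 C (ctx_ob \<A>S \<Gamma>) Y
      = (var_pr \<A>T (map circ \<Gamma>) i \<cdot> \<rho> (ctx_ty \<Gamma>)) \<cdot> pr1 C (ctx_ob \<A>S \<Gamma>) Y"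
      using t_Var wf v by simp
    also have "\<dots> = (\<rho> (\<Gamma> ! i) \<cdot> var_pr \<A>S \<Gamma> i) \<cdot> pr1 C (ctx_ob \<A>S \<Gamma>) Y"
      using t_Var by (simp only: var_pr_rho)
    finally show ?thesis using t_Var wf v by simp
  qed
  then show ?case
    unfolding simulates_def using t_Var wf v by (simp add: TM.sem_simps SM.sem_simps)
next
  case (t_Const c \<Gamma> M)
  note M = t_Const.IH
  note [simp] = simulates_infer[OF M] simulates_tuple[OF M] sps_signature_simps[unfolded sps_ty_def]
    struct_T_simps(5) struct_S_simps
  have "ends C (a (Inl c)) = Some (ty_ob \<A>S (ar \<Sigma> (Inl c)), ty_ob \<A>S (car \<Sigma> (Inl c)))"
    using SM.ends_const[of c] t_Const.hyps by simp
  then show ?case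
    unfolding simulates_def using t_Const.hyps op_ground(1)[of c] SM.op_wf(1)[of c]
    by (simp add: TM.sem_simps SM.sem_simps rho_ground ty_ob_circ_ground)
next
  case (t_Effect e \<Gamma> M)
  note M = t_Effect.IH
  note [simp] = simulates_infer[OF M] simulates_tuple[OF M] sps_signature_simps[unfolded sps_ty_def]
    struct_T_simps(6) struct_S_simps
  have "ends C (a (Inr e)) = Some (ty_ob \<A>S (ar \<Sigma> (Inr e)), tob S (ty_ob \<A>S (car \<Sigma> (Inr e))))"
    using SM.ends_effect[of e] t_Effect.hyps by simp
  then show ?case
    unfolding simulates_def using t_Effect.hyps op_ground(2)[of e] SM.op_wf(2)[of e]
    by (simp add: TM.sem_simps SM.sem_simps rho_ground ty_ob_circ_ground)
next
  case (t_Unit \<Gamma>)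
  then show ?case
    unfolding simulates_def by (simp add: TM.sem_simps SM.sem_simps)
next
  case (t_Pair \<Gamma> M t1 N t2)
  note [simp] = t_Pair.IH[THEN simulates_infer(1)] t_Pair.IH[THEN simulates_infer(2)]
    t_Pair.IH[THEN simulates_infer(3)] t_Pair.IH[THEN simulates_infer(4)]
    t_Pair.IH[THEN simulates_tuple] under_y
  show ?case
    unfolding simulates_def by (simp add: TM.sem_simps SM.sem_simps sps_ty_def)
next
  case (t_Proj1 \<Gamma> M t1 t2)
  note M = t_Proj1.IH
  note [simp] = simulates_infer[OF M] simulates_tuple[OF M]
  have "wf_ty \<Sigma> t1" "wf_ty \<Sigma> t2" using simulates_infer(4)[OF M] by simp_all
  then show ?case
    unfolding simulates_def by (simp add: TM.sem_simps SM.sem_simps sps_ty_def)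
next
  case (t_Proj2 \<Gamma> M t1 t2)
  note M = t_Proj2.IH
  note [simp] = simulates_infer[OF M] simulates_tuple[OF M]
  have "wf_ty \<Sigma> t1" "wf_ty \<Sigma> t2" using simulates_infer(4)[OF M] by simp_all
  then show ?case
    unfolding simulates_def by (simp add: TM.sem_simps SM.sem_simps sps_ty_def)
next
  case (t_Abort t \<Gamma> M)
  note M = t_Abort.IH
  note [simp] = simulates_infer[OF M] simulates_tuple[OF M]
  show ?case
    unfolding simulates_def using t_Abort.hyps
    by (simp add: TM.sem_simps SM.sem_simps sps_ty_def cmp_cobang_cmp[where h = "\<rho> t"])
next
  case (t_Inj1 t2 \<Gamma> M t1)
  note M = t_Inj1.IH
  note [simp] = simulates_infer[OF M] simulates_tuple[OF M]
  show ?case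
    unfolding simulates_def using t_Inj1.hyps by (simp add: TM.sem_simps SM.sem_simps sps_ty_def)
next
  case (t_Inj2 t1 \<Gamma> M t2)
  note M = t_Inj2.IH
  note [simp] = simulates_infer[OF M] simulates_tuple[OF M]
  show ?case
    unfolding simulates_def using t_Inj2.hyps by (simp add: TM.sem_simps SM.sem_simps sps_ty_def)
next
  case (t_Case \<Gamma> M t1 t2 N1 t N2)
  note M = t_Case.IH(1) and N = t_Case.IH(2,3)
  note [simp] = simulates_infer[OF M] simulates_tuple[OF M]
    simulates_infer[OF N(1), simplified] simulates_tuple_Cons[OF N(1)]
    simulates_infer[OF N(2), simplified] simulates_tuple_Cons[OF N(2)] split_z
  show ?case
    unfolding simulates_def by (simp add: TM.sem_simps SM.sem_simps sps_ty_def)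
next
  case (t_Lam t1 \<Gamma> M t2)
  note M = t_Lam.IH
  note [simp] = simulates_infer[OF M, simplified] split_z
  let ?A = "ty_ob \<A>S t1" and ?B = "ty_ob \<A>S t2" and ?A' = "ty_ob \<A>T (circ t1)" and ?B' = "ty_ob \<A>T (circ t2)"
  let ?G = "ctx_ob \<A>S \<Gamma>"
  let ?GY = "?G \<otimes> Y" and ?AY = "?A' \<otimes> Y"
  let ?u = "pr1 C ?G Y \<cdot> pr1 C ?GY ?AY" and ?v = "pr1 C ?A' Y \<cdot> pr2 C ?GY ?AY" and ?y = "pr2 C ?A' Y \<cdot> pr2 C ?GY ?AY"
  let ?P = "sem \<Sigma>T \<A>T (bY # circ t1 # map circ \<Gamma>) (sps \<Sigma> (t1 # \<Gamma>) M)"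
  \<comment> \<open>\<open>?L\<close> is the target closure over the translated environment,
    \<open>?R\<close> the source closure. Both ignore the state in which the abstraction is
    evaluated; the body runs in the state supplied with the argument.\<close>
  let ?L = "curr C ?GY ?AY (?P \<cdot> \<langle>\<langle>\<rho> (ctx_ty \<Gamma>) \<cdot> ?u, ?v\<rangle>, ?y\<rangle>)"
  let ?R = "curr C ?GY ?A (sem \<Sigma> \<A>S (t1 # \<Gamma>) M \<cdot> \<langle>pr1 C ?G Y \<cdot> pr1 C ?GY ?A, pr2 C ?GY ?A\<rangle>)"
  have "?L = \<rho> (TFun t1 t2) \<cdot> ?R"
  proof (rule expo_ext[of _ ?GY "tob T (?B' \<otimes> Y)" ?AY])
    \<comment> \<open>The induction hypothesis accepts only arguments in the image of \<rho>, so the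
      target argument \<open>?v\<close> is written as \<rho> after \<rho>'.\<close>
    have "ev C (tob T (?B' \<otimes> Y)) ?AY \<cdot> \<langle>?L \<cdot> pr1 C ?GY ?AY, pr2 C ?GY ?AY\<rangle>
        = ?P \<cdot> \<langle>\<langle>\<rho> (ctx_ty \<Gamma>) \<cdot> ?u, \<rho> t1 \<cdot> \<rho>' t1 \<cdot> ?v\<rangle>, ?y\<rangle>"
      by simp
    also have "\<dots> = tmap T (prod_map C (\<rho> t2) (idn C Y))
        \<cdot> run ?B (sem \<Sigma> \<A>S (t1 # \<Gamma>) M) \<cdot> \<langle>\<langle>?u, \<rho>' t1 \<cdot> ?v\<rangle>, ?y\<rangle>"
      by (rule simulates_tuple_Cons[OF M]) simp_all
    \<comment> \<open>The body is recognised as \<open>?R\<close> applied to the argument carried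
      back by \<rho>', the shape on the right of \<open>ev_rho_fun\<close>.\<close>
    also have "\<dots> = tmap T (prod_map C (\<rho> t2) (idn C Y))
        \<cdot> run ?B (ev C (tob S ?B) ?A \<cdot> \<langle>?R \<cdot> pr1 C ?GY ?AY, \<rho>' t1 \<cdot> ?v\<rangle>) \<cdot> \<langle>idn C (?GY \<otimes> ?AY), ?y\<rangle>"
      by (simp del: tmap_eq_bind)
    also have "\<dots> = ev C (tob T (?B' \<otimes> Y)) ?AY \<cdot> \<langle>\<rho> (TFun t1 t2) \<cdot> ?R \<cdot> pr1 C ?GY ?AY, \<langle>?v, ?y\<rangle>\<rangle>"
      by (rule ev_rho_fun[symmetric]) simp_all
    also have "\<dots> = ev C (tob T (?B' \<otimes> Y)) ?AY \<cdot> \<langle>(\<rho> (TFun t1 t2) \<cdot> ?R) \<cdot> pr1 C ?GY ?AY, pr2 C ?GY ?AY\<rangle>"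
      by simp
    finally show "ev C (tob T (?B' \<otimes> Y)) ?AY \<cdot> \<langle>?L \<cdot> pr1 C ?GY ?AY, pr2 C ?GY ?AY\<rangle>
        = ev C (tob T (?B' \<otimes> Y)) ?AY \<cdot> \<langle>(\<rho> (TFun t1 t2) \<cdot> ?R) \<cdot> pr1 C ?GY ?AY, pr2 C ?GY ?AY\<rangle>" .
  qed simp_all
  then show ?case
    unfolding simulates_def by (simp add: TM.sem_simps SM.sem_simps sps_ty_def)
next
  case (t_App \<Gamma> M t1 t2 N)
  note [simp] = t_App.IH[THEN simulates_infer(1)] t_App.IH[THEN simulates_infer(2)]
    t_App.IH[THEN simulates_infer(3)] t_App.IH[THEN simulates_infer(4)]
    t_App.IH[THEN simulates_tuple] under_y ev_rho_fun
  have "wf_ty \<Sigma> t1" "wf_ty \<Sigma> t2" using simulates_infer(4)[OF t_App.IH(1)] by simp_all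
  then show ?case
    unfolding simulates_def by (simp add: TM.sem_simps SM.sem_simps sps_ty_def)
qed

section \<open>Weakest pre-conditions of source and target\<close>

lemma wp_state:
  assumes \<tau>: "em_algebra C T \<Omega> \<tau>" and M: "typing \<Sigma> \<Gamma> M t" and q: "ends C Q = Some (ty_ob \<A>S t, expo C \<Omega> Y)"
  shows "ends C (wp \<Sigma> \<A>S (state_algebra C T Y \<Omega> \<tau>) \<Gamma> M Q) = Some (ctx_ob \<A>S \<Gamma>, expo C \<Omega> Y)"
    and "uncurr C \<Omega> Y (wp \<Sigma> \<A>S (state_algebra C T Y \<Omega> \<tau>) \<Gamma> M Q)
      = \<tau> \<cdot> tmap T (uncurr C \<Omega> Y Q) \<cdot> run (ty_ob \<A>S t) (sem \<Sigma> \<A>S \<Gamma> M)"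
proof -
  have "infer \<Sigma> \<Gamma> M = Some t" using M by (simp add: infer_iff)
  then have "ends C (sem \<Sigma> \<A>S \<Gamma> M) = Some (ctx_ob \<A>S \<Gamma>, tob S (ty_ob \<A>S t))" by simp
  moreover have "ends C \<tau> = Some (tob T \<Omega>, \<Omega>)" "\<Omega> \<in> obj C" using \<tau> by (simp_all add: em_algebra_def)
  ultimately show "ends C (wp \<Sigma> \<A>S (state_algebra C T Y \<Omega> \<tau>) \<Gamma> M Q) = Some (ctx_ob \<A>S \<Gamma>, expo C \<Omega> Y)"
    and "uncurr C \<Omega> Y (wp \<Sigma> \<A>S (state_algebra C T Y \<Omega> \<tau>) \<Gamma> M Q)
      = \<tau> \<cdot> tmap T (uncurr C \<Omega> Y Q) \<cdot> run (ty_ob \<A>S t) (sem \<Sigma> \<A>S \<Gamma> M)"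
    unfolding wp_def SM.cat_model SM.mon_model using uncurr_algebra q by blast+
qed

lemma wp_sps:
  assumes \<tau>: "em_algebra C T \<Omega> \<tau>" and M: "typing \<Sigma> \<Gamma> M t" and q: "ends C Q = Some (ty_ob \<A>S t, expo C \<Omega> Y)"
  shows "uncurr C \<Omega> Y (wp \<Sigma> \<A>S (state_algebra C T Y \<Omega> \<tau>) \<Gamma> M Q \<cdot> \<rho>' (ctx_ty \<Gamma>))
    = wp \<Sigma>T \<A>T \<tau> (sps_ctx \<Gamma>) (sps \<Sigma> \<Gamma> M) (uncurr C \<Omega> Y (Q \<cdot> \<rho>' t))"
proof -
  note M = sps_simulates[OF M]
  note [simp] = simulates_infer[OF M] and [simp del] = tmap_eq_bind S.tmap_eq_bind
  have \<tau>: "ends C \<tau> = Some (tob T \<Omega>, \<Omega>)" "\<Omega> \<in> obj C" using \<tau> by (simp_all add: em_algebra_def)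
  let ?G = "ctx_ob \<A>S \<Gamma>" and ?G' = "ctx_ob \<A>T (map circ \<Gamma>)"
  let ?w = "wp \<Sigma> \<A>S (state_algebra C T Y \<Omega> \<tau>) \<Gamma> M Q"
  let ?e = "\<langle>\<rho>' (ctx_ty \<Gamma>) \<cdot> pr1 C ?G' Y, pr2 C ?G' Y\<rangle>"
  let ?run = "run (ty_ob \<A>S t) (sem \<Sigma> \<A>S \<Gamma> M)"
  let ?P = "sem \<Sigma>T \<A>T (bY # map circ \<Gamma>) (sps \<Sigma> \<Gamma> M)"
  have \<rho>': "ends C (\<rho>' (ctx_ty \<Gamma>)) = Some (?G', ?G)" using ends_rho'[of "ctx_ty \<Gamma>"] by simp
  have obj: "?G \<in> obj C" "?G' \<in> obj C" using ends_obj[OF \<rho>'] by simp_all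
  note w = wp_state[OF assms]
  \<comment> \<open>Inserting the identity \<rho> after \<rho>' into the environment allows the
    simulation to be solved for the interpretation of the transformed term.\<close>
  have "?P = ?P \<cdot> \<langle>\<rho> (ctx_ty \<Gamma>) \<cdot> \<rho>' (ctx_ty \<Gamma>) \<cdot> pr1 C ?G' Y, pr2 C ?G' Y\<rangle>"
    using obj by simp
  also have "\<dots> = tmap T (prod_map C (\<rho> t) (idn C Y)) \<cdot> ?run \<cdot> ?e"
    by (rule simulates_tuple[OF M]) (use \<rho>' obj in simp_all)
  finally have P: "?P = tmap T (prod_map C (\<rho> t) (idn C Y)) \<cdot> ?run \<cdot> ?e" .
  have "uncurr C \<Omega> Y (?w \<cdot> \<rho>' (ctx_ty \<Gamma>)) = uncurr C \<Omega> Y ?w \<cdot> ?e"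
    using w(1) \<rho>' obj \<tau> by simp
  also have "\<dots> = \<tau> \<cdot> tmap T (uncurr C \<Omega> Y Q) \<cdot> ?run \<cdot> ?e"
    unfolding w(2) using \<rho>' obj \<tau> q by simp
  \<comment> \<open>The \<rho> at the result type contained in \<open>?P\<close> cancels against
    \<rho>' in the post-condition.\<close>
  also have "\<dots> = \<tau> \<cdot> tmap T (uncurr C \<Omega> Y (Q \<cdot> \<rho>' t)) \<cdot> ?P"
    unfolding P using \<rho>' obj \<tau> q by (simp add: tmap_tmap_cmp)
  finally show ?thesis
    by (simp add: wp_def sps_ctx_def)
qed

end

theorem theorem5p5:
  fixes C :: "('o, 'm) bicc" and T :: "('o, 'm) monad" and Y \<Omega> :: 'o
    and \<Sigma> :: "('b, 'k, 'e) signature" and A :: "'b \<Rightarrow> 'o" and a :: "'k + 'e \<Rightarrow> 'm"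
    and \<tau> :: 'm and \<A>S :: "('o, 'm, 'b, 'k, 'e) lc_struct"
    and \<A>T :: "('o, 'm, 'b + unit, 'k, 'e) lc_struct"
    and \<Gamma> :: "'b ctx" and M :: "('b, 'k, 'e) tm" and t :: "'b ty" and Q :: 'm
  assumes "stable_bicartesian_closed C"
    and "strong_monad C T"
    and "Y \<in> obj C"
    and AS: "\<A>S = struct_S C T Y A a"
    and "lc_structure \<Sigma> \<A>S"
    and AT: "\<A>T = struct_T \<Sigma> C T Y A a"
    and "em_algebra C T \<Omega> \<tau>"
    and "typing \<Sigma> \<Gamma> M t"
    and "Q \<in> hom C (ty_ob \<A>S t) (expo C \<Omega> Y)"
  shows "uncurr C \<Omega> Y
        (wp \<Sigma> \<A>S (state_algebra C T Y \<Omega> \<tau>) \<Gamma> M Q \<cdot>\<^bsub>C\<^esub> inverse_arr C (rho_ctx \<A>S \<A>T Y \<Gamma>))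
      = wp (sps_signature \<Sigma>) \<A>T \<tau> (sps_ctx \<Gamma>) (sps \<Sigma> \<Gamma> M)
        (uncurr C \<Omega> Y (Q \<cdot>\<^bsub>C\<^esub> inverse_arr C (rho \<A>S \<A>T Y t)))
    \<and> ((\<forall>s \<in> set \<Gamma>. ground s) \<and> ground t \<longrightarrow>
      uncurr C \<Omega> Y (wp \<Sigma> \<A>S (state_algebra C T Y \<Omega> \<tau>) \<Gamma> M Q)
      = wp (sps_signature \<Sigma>) \<A>T \<tau> (sps_ctx \<Gamma>) (sps \<Sigma> \<Gamma> M) (uncurr C \<Omega> Y Q))"
proof -
  interpret T: strong_monad C T by fact
  \<comment> \<open>Being a structure over the state monad includes the strong monad laws for
    it.\<close>
  have "strong_monad C (state_monad C T Y)"
    using \<open>lc_structure \<Sigma> \<A>S\<close> unfolding AS lc_structure_def struct_S_def by simp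
  then interpret S: strong_monad C "state_monad C T Y" .
  interpret sps_model C T "state_monad C T Y" Y \<Sigma> A a
    by unfold_locales (use assms in \<open>simp_all add: AS\<close>)
  have q: "ends C Q = Some (ty_ob (struct_S C T Y A a) t, expo C \<Omega> Y)"
    using assms(9) by (simp add: AS)
  note eq = wp_sps[OF \<open>em_algebra C T \<Omega> \<tau>\<close> \<open>typing \<Sigma> \<Gamma> M t\<close> q]
  have wf: "\<forall>s \<in> set \<Gamma>. wf_ty \<Sigma> s" "wf_ty \<Sigma> t"
    using typing_wf[OF SM.wf_sig \<open>typing \<Sigma> \<Gamma> M t\<close>] by simp_all
  have "uncurr C \<Omega> Y (wp \<Sigma> \<A>S (state_algebra C T Y \<Omega> \<tau>) \<Gamma> M Q)
      = wp (sps_signature \<Sigma>) \<A>T \<tau> (sps_ctx \<Gamma>) (sps \<Sigma> \<Gamma> M) (uncurr C \<Omega> Y Q)"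
    if "\<forall>s \<in> set \<Gamma>. ground s" "ground t"
  proof -
    \<comment> \<open>At ground types both inverses are identities; the end points of
      \<open>Q\<close> and of the pre-condition are what allows these identities to be
      removed.\<close>
    have "\<Omega> \<in> obj C" using \<open>em_algebra C T \<Omega> \<tau>\<close> by (simp add: em_algebra_def)
    then show ?thesis
      using eq that wf q wp_state(1)[OF \<open>em_algebra C T \<Omega> \<tau>\<close> \<open>typing \<Sigma> \<Gamma> M t\<close> q]
      by (simp add: AS AT rho'_ground)
  qed
  then show ?thesis
    using eq by (simp add: AS AT \<rho>'_def)
qed

end
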